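(* Let $G$ be an $N$-graph with assigned angles given by $\mathcal D$. The functional $\overline{\mathcal E}$ is the lower semicontinuous envelope of the functional $\mathcal E$ (defined on $\mathcal C_{\mathrm{Reg}}$) with respect to the weak convergence in $H^2$, that is, for every network $\mathcal N_\infty=(G,\Gamma_\infty)$, $$\overline{\mathcal E}(\mathcal N_\infty)=\inf\Big\{\liminf_{n\to\infty}\mathcal E(\mathcal N_n)\;:\;\mathcal N_n=(G,\Gamma_n)\in\mathcal C_{\mathrm{Reg}},\ \mathcal N_n\rightharpoonup\mathcal N_\infty\text{ weakly in }H^2\Big\}$$ (with $\inf\emptyset=+\infty$). Moreover, $\overline{\mathcal E}$ admits a minimizer among all (possibly singular) networks $\mathcal N=(G,\Gamma)$.
   Context: Fix integers $N\ge 1$, $d\ge2$. Let $I_i=[0,1]\times\{i\}$ for $i=1,\dots,N$, $E=\bigcup_i I_i$, $V=\bigcup_i\{0,1\}\times\{i\}$. An $N$-graph is a topological quotient $G=E/\sim$, where $\sim$ is an equivalence relation identifying points of $V$ only; $\pi:E\to G$ is the projection, $E_i=\pi(I_i)$ are the edges, $V_G=\pi(V)$ the vertices (junctions). For $p\in V_G$, $\pi^{-1}(p)$ is a finite set of pairs $(z,i)\in\{0,1\}\times\{1,\dots,N\}$. A subgraph $H\subseteq G$ is the union of a (possibly empty) collection of edges with the same identifications. A network is a pair $\mathcal N=(G,\Gamma)$ with $\Gamma:G\to\mathbb R^d$ continuous such that each $\gamma^i=\Gamma|_{E_i}$ (viewed as a map on $[0,1]$) is either constant (a singular curve) or an immersion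 of class $H^2$ (a regular curve); curves are considered up to reparametrization. $\mathrm{Sing}(\mathcal N)$ is the subgraph whose edges are those carrying singular curves; $\mathcal N$ is regular if $\mathrm{Sing}(\mathcal N)=\emptyset$. A sequence $(G,\Gamma_n)$ converges to $(G,\Gamma_\infty)$ in a given topology if for every $i$ the curves $\Gamma_n|_{E_i}$ converge to $\Gamma_\infty|_{E_i}$, up to reparametrization, in that topology. Outer tangents: for a regular curve $\gamma^i$ and $z\in\{0,1\}$, $\tau^{z,i}=(-1)^z\dot\gamma^i(z)/|\dot\gamma^i(z)|$. $G$ has assigned angles if a unit vector $d^{z,i}\in\mathbb S^{d-1}$ is given for each $(z,i)\in\{0,1\}\times\{1,\dots,N\}$; $\mathcal D$ is the collection of these; subgraphs inherit the assignment. Angle condition: a (possibly singular) network $(G,\Gamma)$ satisfies the angle condition if for every singular curve $\gamma^i$ there exist unit vectors $\tau^{0,i}=-\tau^{1,i}$ (virtual tangents) such that for every $p\in V_G$ there is a rotation $\mathrm R_p$ of $\mathbb R^d$ with $\tau^{z,i}=\mathrm R_p(d^{z,i})$ for all $(z,i)\in\pi^{-1}(p)$, where $\tau^{z,i}$ is the real outer tangent if $\gamma^i$ is regular and the virtual one if $\gamma^i$ is singular. $\mathcal C_{\mathrm{Reg}}$ is the class of regular networks $(G,\Gamma)$ satisfying the angle condition. Stratified straight: a subgraph $H\subseteq G$ is stratified straight if there are subgraphs $\emptyset=H_q\subset H_{q-1}\subset\dots\subset H_1\subset H_0=H$ and maps $\Sigma_j:H_j\to\mathbb R^d$ such that for $j=0,\dots,q-1$: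 $(H_j,\Sigma_j)$ is a network satisfying the angle condition, with (real or virtual) tangents coinciding with those associated with $(H_0,\Sigma_0)$, its regular curves are straight segments, and $H_{j+1}=\mathrm{Sing}((H_j,\Sigma_j))$. Degenerate networks: $\mathcal N=(G,\Gamma)$ belongs to $\mathcal C_{\mathrm{Deg}}$ if it satisfies the angle condition with some (real or virtual) tangents $\tau^{z,i}$ and $\mathrm{Sing}(\mathcal N)$ is a stratified straight subgraph with (real or virtual) tangents coinciding with these $\tau^{z,i}$. (So $\mathcal C_{\mathrm{Reg}}\subset\mathcal C_{\mathrm{Deg}}$.) Energies: for any network, $\widetilde{\mathcal E}(\mathcal N)=\sum_i\big(\int_{\gamma^i}|\vec k^i|^2\,ds+\ell(\gamma^i)\big)$, the sum being over regular curves, with $\vec k^i$ the curvature vector, $s$ arclength and $\ell$ length (singular curves contribute $0$). $\mathcal E$ denotes this functional on regular networks. $\overline{\mathcal E}(\mathcal N)=\widetilde{\mathcal E}(\mathcal N)$ if $\mathcal N\in\mathcal C_{\mathrm{Deg}}$ and $\overline{\mathcal E}(\mathcal N)=+\infty$ otherwise. *)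

theory Defs
  imports "HOL-Analysis.Analysis" "HOL-Library.Extended_Real"
begin

section \<open>Curves of class H2 on the unit interval\<close>

definition L2_unit :: "(real \<Rightarrow> 'a::euclidean_space) \<Rightarrow> bool" where
  "L2_unit f \<longleftrightarrow> set_borel_measurable lborel {0..1} f \<and>
     set_integrable lborel {0..1} (\<lambda>t. (norm (f t))\<^sup>2)"

definition velocity :: "(real \<Rightarrow> 'a::euclidean_space) \<Rightarrow> real \<Rightarrow> 'a" where
  "velocity c t = vector_derivative c (at t within {0..1})"

text \<open>One-dimensional Sobolev functions are represented by their continuous representative:
  \<open>c\<close> has class H2 on the unit interval iff it is differentiable there and its derivative is
  the indefinite integral of a square integrable function, the weak second derivative.\<close>

definition weak_second_deriv :: "(real \<Rightarrow> 'a::euclidean_space) \<Rightarrow> (real \<Rightarrow> 'a) \<Rightarrow> bool" where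
  "weak_second_deriv c h \<longleftrightarrow> L2_unit h \<and>
     (\<forall>t\<in>{0..1}. velocity c t = velocity c 0 + (LINT s:{0..t}|lborel. h s))"

definition H2_curve :: "(real \<Rightarrow> 'a::euclidean_space) \<Rightarrow> bool" where
  "H2_curve c \<longleftrightarrow> (\<forall>t\<in>{0..1}. c differentiable (at t within {0..1})) \<and>
     (\<exists>h. weak_second_deriv c h)"

text \<open>The weak second derivative is determined up to a null set of parameters; it is only used
  under integrals.\<close>

definition acceleration :: "(real \<Rightarrow> 'a::euclidean_space) \<Rightarrow> real \<Rightarrow> 'a" where
  "acceleration c = (SOME h. weak_second_deriv c h)"

definition H2_inner :: "(real \<Rightarrow> 'a::euclidean_space) \<Rightarrow> (real \<Rightarrow> 'a) \<Rightarrow> real" where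
  "H2_inner c e = (LINT t:{0..1}|lborel.
     c t \<bullet> e t + velocity c t \<bullet> velocity e t + acceleration c t \<bullet> acceleration e t)"

text \<open>Weak convergence in the Hilbert space H2, whose continuous linear functionals are the
  inner products with its elements.\<close>

definition weakly_converges_H2 ::
    "(nat \<Rightarrow> real \<Rightarrow> 'a::euclidean_space) \<Rightarrow> (real \<Rightarrow> 'a) \<Rightarrow> bool" where
  "weakly_converges_H2 F f \<longleftrightarrow> (\<forall>n. H2_curve (F n)) \<and> H2_curve f \<and>
     (\<forall>e. H2_curve e \<longrightarrow> (\<lambda>n. H2_inner (F n) e) \<longlonglongrightarrow> H2_inner f e)"

definition singular_curve :: "(real \<Rightarrow> 'a::euclidean_space) \<Rightarrow> bool" where
  "singular_curve c \<longleftrightarrow> c constant_on {0..1}"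

definition regular_curve :: "(real \<Rightarrow> 'a::euclidean_space) \<Rightarrow> bool" where
  "regular_curve c \<longleftrightarrow> H2_curve c \<and> (\<forall>t\<in>{0..1}. velocity c t \<noteq> 0)"

text \<open>Reparametrizations preserve the orientation: the two ends of an edge are distinguished in
  the graph.\<close>

definition reparametrization :: "(real \<Rightarrow> real) \<Rightarrow> bool" where
  "reparametrization \<phi> \<longleftrightarrow> H2_curve \<phi> \<and> \<phi> 0 = 0 \<and> \<phi> 1 = 1 \<and> (\<forall>t\<in>{0..1}. velocity \<phi> t > 0)"

definition straight_curve :: "(real \<Rightarrow> 'a::euclidean_space) \<Rightarrow> bool" where
  "straight_curve c \<longleftrightarrow> path_image c = closed_segment (c 0) (c 1)"

text \<open>The curvature vector is the derivative of the unit tangent \<open>T = sgn c'\<close> with respect to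
  arclength \<open>s\<close>, where \<open>ds = \<bar>c'\<bar> dt\<close>; that is, the component of \<open>c''\<close> orthogonal to
  \<open>T\<close>, divided by \<open>\<bar>c'\<bar>\<^sup>2\<close>.\<close>

definition curvature :: "(real \<Rightarrow> 'a::euclidean_space) \<Rightarrow> real \<Rightarrow> 'a" where
  "curvature c t = (let T = sgn (velocity c t); a = acceleration c t
     in (1 / (norm (velocity c t))\<^sup>2) *\<^sub>R (a - (a \<bullet> T) *\<^sub>R T))"

definition curve_length :: "(real \<Rightarrow> 'a::euclidean_space) \<Rightarrow> real" where
  "curve_length c = (LINT t:{0..1}|lborel. norm (velocity c t))"

definition bending_energy :: "(real \<Rightarrow> 'a::euclidean_space) \<Rightarrow> real" where
  "bending_energy c = (LINT t:{0..1}|lborel. (norm (curvature c t))\<^sup>2 * norm (velocity c t))"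

section \<open>Graphs\<close>

type_synonym point = "real \<times> nat"

text \<open>Points of the disjoint union of the intervals are pairs (parameter, index of the interval).
  A graph is given by the number of intervals and an equivalence relation on this union.\<close>

definition intervals :: "nat set \<Rightarrow> point set" where
  "intervals S = {0..1} \<times> S"

definition interval_ends :: "nat set \<Rightarrow> point set" where
  "interval_ends S = {0, 1} \<times> S"

definition N_graph :: "nat \<Rightarrow> (point \<times> point) set \<Rightarrow> bool" where
  "N_graph N R \<longleftrightarrow> equiv (intervals {1..N}) R \<and>
     (\<forall>(x, y)\<in>R. x \<noteq> y \<longrightarrow> x \<in> interval_ends {1..N} \<and> y \<in> interval_ends {1..N})"

definition proj :: "(point \<times> point) set \<Rightarrow> point \<Rightarrow> point set" where
  "proj R x = R `` {x}"

definition graph_topology :: "nat \<Rightarrow> (point \<times> point) set \<Rightarrow> point set topology" where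
  "graph_topology N R = topology (\<lambda>U. U \<subseteq> intervals {1..N} // R \<and>
     openin (top_of_set (intervals {1..N})) {x \<in> intervals {1..N}. proj R x \<in> U})"

lemma openin_graph_topology:
  "openin (graph_topology N R) U \<longleftrightarrow> U \<subseteq> intervals {1..N} // R \<and>
     openin (top_of_set (intervals {1..N})) {x \<in> intervals {1..N}. proj R x \<in> U}"
proof -
  let ?E = "intervals {1..N}"
  let ?P = "\<lambda>U. {x \<in> ?E. proj R x \<in> U}"
  have "istopology (\<lambda>U. U \<subseteq> ?E // R \<and> openin (top_of_set ?E) (?P U))"
    unfolding istopology_def
  proof (intro conjI allI impI)
    fix S T
    assume S: "S \<subseteq> ?E // R \<and> openin (top_of_set ?E) (?P S)"
      and T: "T \<subseteq> ?E // R \<and> openin (top_of_set ?E) (?P T)"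
    have "?P (S \<inter> T) = ?P S \<inter> ?P T" by auto
    with S T show "openin (top_of_set ?E) (?P (S \<inter> T))" by (simp only: openin_Int)
    from S show "S \<inter> T \<subseteq> ?E // R" by auto
  next
    fix K
    assume K: "\<forall>U\<in>K. U \<subseteq> ?E // R \<and> openin (top_of_set ?E) (?P U)"
    then show "\<Union>K \<subseteq> ?E // R" by auto
    have "?P (\<Union>K) = \<Union>(?P ` K)" by auto
    moreover have "openin (top_of_set ?E) (\<Union>(?P ` K))"
      using K by (intro openin_Union) auto
    ultimately show "openin (top_of_set ?E) (?P (\<Union>K))" by (simp only:)
  qed
  then show ?thesis by (simp add: graph_topology_def topology_inverse')
qed

text \<open>A subgraph is a union of edges of the ambient graph and is given by the set \<open>S\<close> of indices
  of its edges; the identifications are those of the ambient graph.\<close>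

definition subgraph_topology ::
    "nat \<Rightarrow> (point \<times> point) set \<Rightarrow> nat set \<Rightarrow> point set topology" where
  "subgraph_topology N R S = subtopology (graph_topology N R) (proj R ` intervals S)"

definition junctions :: "(point \<times> point) set \<Rightarrow> nat set \<Rightarrow> point set set" where
  "junctions R S = proj R ` interval_ends S"

definition junction_fibre ::
    "(point \<times> point) set \<Rightarrow> nat set \<Rightarrow> point set \<Rightarrow> (nat \<times> nat) set" where
  "junction_fibre R S p = {(z, i). z \<in> {0, 1} \<and> i \<in> S \<and> proj R (real z, i) = p}"

definition assigned_angles :: "nat \<Rightarrow> (nat \<Rightarrow> nat \<Rightarrow> 'a::euclidean_space) \<Rightarrow> bool" where
  "assigned_angles N D \<longleftrightarrow> (\<forall>z\<in>{0, 1}. \<forall>i\<in>{1..N}. norm (D z i) = 1)"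

section \<open>Networks\<close>

definition edge_curve ::
    "(point \<times> point) set \<Rightarrow> (point set \<Rightarrow> 'a::euclidean_space) \<Rightarrow> nat \<Rightarrow> real \<Rightarrow> 'a" where
  "edge_curve R \<Gamma> i t = \<Gamma> (proj R (t, i))"

definition network ::
    "nat \<Rightarrow> (point \<times> point) set \<Rightarrow> nat set \<Rightarrow> (point set \<Rightarrow> 'a::euclidean_space) \<Rightarrow> bool" where
  "network N R S \<Gamma> \<longleftrightarrow> continuous_map (subgraph_topology N R S) euclidean \<Gamma> \<and>
     (\<forall>i\<in>S. singular_curve (edge_curve R \<Gamma> i) \<or> regular_curve (edge_curve R \<Gamma> i))"

definition Sing ::
    "(point \<times> point) set \<Rightarrow> nat set \<Rightarrow> (point set \<Rightarrow> 'a::euclidean_space) \<Rightarrow> nat set" where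
  "Sing R S \<Gamma> = {i \<in> S. singular_curve (edge_curve R \<Gamma> i)}"

definition outer_tangent :: "nat \<Rightarrow> (real \<Rightarrow> 'a::euclidean_space) \<Rightarrow> 'a" where
  "outer_tangent z c = (-1) ^ z *\<^sub>R sgn (velocity c (real z))"

text \<open>\<open>\<tau>\<close> is a family of real (on regular curves) or virtual (on singular curves) tangents.\<close>

definition tangents ::
    "(point \<times> point) set \<Rightarrow> nat set \<Rightarrow> (point set \<Rightarrow> 'a::euclidean_space)
      \<Rightarrow> (nat \<Rightarrow> nat \<Rightarrow> 'a) \<Rightarrow> bool" where
  "tangents R S \<Gamma> \<tau> \<longleftrightarrow>
     (\<forall>i \<in> S - Sing R S \<Gamma>. \<forall>z\<in>{0, 1}. \<tau> z i = outer_tangent z (edge_curve R \<Gamma> i)) \<and>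
     (\<forall>i \<in> Sing R S \<Gamma>. norm (\<tau> 0 i) = 1 \<and> \<tau> 0 i = - \<tau> 1 i)"

definition angle_condition_with ::
    "(point \<times> point) set \<Rightarrow> nat set \<Rightarrow> (nat \<Rightarrow> nat \<Rightarrow> real ^ 'd) \<Rightarrow> (point set \<Rightarrow> real ^ 'd)
      \<Rightarrow> (nat \<Rightarrow> nat \<Rightarrow> real ^ 'd) \<Rightarrow> bool" where
  "angle_condition_with R S D \<Gamma> \<tau> \<longleftrightarrow> tangents R S \<Gamma> \<tau> \<and>
     (\<forall>p \<in> junctions R S. \<exists>Q. rotation_matrix Q \<and>
        (\<forall>(z, i) \<in> junction_fibre R S p. \<tau> z i = Q *v D z i))"

definition angle_condition ::
    "(point \<times> point) set \<Rightarrow> nat set \<Rightarrow> (nat \<Rightarrow> nat \<Rightarrow> real ^ 'd) \<Rightarrow> (point set \<Rightarrow> real ^ 'd)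
      \<Rightarrow> bool" where
  "angle_condition R S D \<Gamma> \<longleftrightarrow> (\<exists>\<tau>. angle_condition_with R S D \<Gamma> \<tau>)"

definition C_Reg ::
    "nat \<Rightarrow> (point \<times> point) set \<Rightarrow> (nat \<Rightarrow> nat \<Rightarrow> real ^ 'd) \<Rightarrow> (point set \<Rightarrow> real ^ 'd) set" where
  "C_Reg N R D = {\<Gamma>. network N R {1..N} \<Gamma> \<and> Sing R {1..N} \<Gamma> = {} \<and> angle_condition R {1..N} D \<Gamma>}"

text \<open>\<open>S\<close> is stratified straight with tangents \<open>\<tau>\<close>: the strata are \<open>H 0 = S, \<dots>, H q = {}\<close>, and
  the same family \<open>\<tau>\<close> serves as tangents on every stratum.\<close>

definition stratified_straight_with ::
    "nat \<Rightarrow> (point \<times> point) set \<Rightarrow> nat set \<Rightarrow> (nat \<Rightarrow> nat \<Rightarrow> real ^ 'd)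
      \<Rightarrow> (nat \<Rightarrow> nat \<Rightarrow> real ^ 'd) \<Rightarrow> bool" where
  "stratified_straight_with N R S D \<tau> \<longleftrightarrow>
     (\<exists>q (H :: nat \<Rightarrow> nat set) (\<Sigma> :: nat \<Rightarrow> point set \<Rightarrow> real ^ 'd).
        H 0 = S \<and> H q = {} \<and>
        (\<forall>j<q. H (Suc j) \<subset> H j \<and>
           network N R (H j) (\<Sigma> j) \<and>
           angle_condition_with R (H j) D (\<Sigma> j) \<tau> \<and>
           (\<forall>i \<in> H j - Sing R (H j) (\<Sigma> j). straight_curve (edge_curve R (\<Sigma> j) i)) \<and>
           H (Suc j) = Sing R (H j) (\<Sigma> j)))"

definition C_Deg ::
    "nat \<Rightarrow> (point \<times> point) set \<Rightarrow> (nat \<Rightarrow> nat \<Rightarrow> real ^ 'd) \<Rightarrow> (point set \<Rightarrow> real ^ 'd) set" where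
  "C_Deg N R D = {\<Gamma>. network N R {1..N} \<Gamma> \<and>
     (\<exists>\<tau>. angle_condition_with R {1..N} D \<Gamma> \<tau> \<and>
          stratified_straight_with N R (Sing R {1..N} \<Gamma>) D \<tau>)}"

definition weakly_converges_network ::
    "nat \<Rightarrow> (point \<times> point) set \<Rightarrow> (nat \<Rightarrow> point set \<Rightarrow> 'a::euclidean_space)
      \<Rightarrow> (point set \<Rightarrow> 'a) \<Rightarrow> bool" where
  "weakly_converges_network N R \<Gamma>s \<Gamma> \<longleftrightarrow>
     (\<forall>i\<in>{1..N}. \<exists>\<phi>. (\<forall>n. reparametrization (\<phi> n)) \<and>
        weakly_converges_H2 (\<lambda>n. edge_curve R (\<Gamma>s n) i \<circ> \<phi> n) (edge_curve R \<Gamma> i))"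

section \<open>Energies\<close>

definition network_energy ::
    "nat \<Rightarrow> (point \<times> point) set \<Rightarrow> (point set \<Rightarrow> 'a::euclidean_space) \<Rightarrow> real" where
  "network_energy N R \<Gamma> = (\<Sum>i \<in> {1..N} - Sing R {1..N} \<Gamma>.
     bending_energy (edge_curve R \<Gamma> i) + curve_length (edge_curve R \<Gamma> i))"

definition relaxed_energy ::
    "nat \<Rightarrow> (point \<times> point) set \<Rightarrow> (nat \<Rightarrow> nat \<Rightarrow> real ^ 'd) \<Rightarrow> (point set \<Rightarrow> real ^ 'd) \<Rightarrow> ereal" where
  "relaxed_energy N R D \<Gamma> = (if \<Gamma> \<in> C_Deg N R D then ereal (network_energy N R \<Gamma>) else \<infinity>)"

end

theory Submission
  imports Defs "HOL-Complex_Analysis.Great_Picard" "HOL-Real_Asymp.Real_Asymp"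
begin

text \<open>Up to reparametrization and translation, a regular curve of length \<open>l\<close> and bending energy
  \<open>B\<close> is given by \<open>l\<close> and by its tangent indicatrix \<open>\<theta>\<close>: the path in the unit sphere that runs
  through the unit tangents at constant speed in arclength. It has a square integrable derivative
  with \<open>\<integral>|\<theta>'|\<^sup>2 = l B\<close>, the chord of the curve is \<open>l \<integral>\<theta>\<close>, and the outer tangents are \<open>\<theta> 0\<close> and
  \<open>- \<theta> 1\<close> (\<open>tangent_indicatrix_exists\<close>). Energy, angles and gluing conditions are conditions on
  these data, and the proof works with the data.

  Compactness. If the energies of regular networks are bounded, then so are the lengths and the
  bending energies of their edges, the indicatrices are uniformly Hoelder continuous, and a
  subsequence of the data converges (\<open>network_compactness\<close>): \<open>l\<^sub>n \<longlonglongrightarrow> l\<close>, \<open>B\<^sub>n \<longlonglongrightarrow> \<beta>\<close>, and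
  \<open>\<theta>\<^sub>n \<longlonglongrightarrow> \<theta>\<close> uniformly, with \<open>\<integral>|\<theta>'|\<^sup>2 \<le> l \<beta>\<close>. So the limit of the energies dominates the
  energy of a network with limit data. Where \<open>l = 0\<close> the path \<open>\<theta>\<close> is constant, and its value is
  the virtual tangent. Rotations form a compact set, which gives the angle condition in the limit.
  To see that the collapsed edges are stratified straight, take any nonempty set of them and divide
  the positions of the vertices by the total length of these edges. The chords then converge to
  nonnegative multiples of the virtual tangents, not all zero, and the limits are again
  differences of vertex positions, because the differences along the edges of a finite graph that
  come from vertex positions form a closed set (\<open>converging_differences_potential\<close>). This gives the
  first stratum; the edges whose multiple is zero are treated in the same way
  (\<open>limit_potential\<close>, \<open>stratified_straightI\<close>, \<open>limit_network\<close>).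

  Lower semicontinuity. A weakly convergent sequence in H2 is bounded, and its velocities converge
  pointwise. Hence the lengths and indicatrices of the limit network are the limits of
  the data (\<open>weak_limit_edge\<close>), and the previous paragraph applies (\<open>lower_semicontinuity\<close>).

  Recovery. Let \<open>\<Sigma>\<close> be the first stratum of a degenerate network. Moving the vertices by a small multiple of
  \<open>\<Sigma>\<close> turns the edges on which \<open>\<Sigma>\<close> is regular into short segments in the direction of their
  virtual tangents, without bending energy; the regular edges are corrected by a smooth function that is
  flat at the ends, so that no tangent changes. The new network has the same tangents and one stratum
  less (\<open>resolve_one_stratum\<close>), and induction leads to a regular network
  (\<open>degenerate_approximation\<close>).

  Minimizer. By recovery there are regular networks whose energies tend to the infimum; their limit
  data are the data of some degenerate network, built by placing the vertices and gluing
  (\<open>limit_realization\<close>), and its energy is at most the infimum.\<close>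

section \<open>Square integrable functions on a finite measure space\<close>

definition L2 :: "'a measure \<Rightarrow> ('a \<Rightarrow> 'b::euclidean_space) \<Rightarrow> bool" where
  "L2 M f \<longleftrightarrow> f \<in> borel_measurable M \<and> integrable M (\<lambda>x. (norm (f x))\<^sup>2)"

definition inner_L2 :: "'a measure \<Rightarrow> ('a \<Rightarrow> 'b::euclidean_space) \<Rightarrow> ('a \<Rightarrow> 'b) \<Rightarrow> real" where
  "inner_L2 M f g = (LINT x|M. f x \<bullet> g x)"

definition norm_L2 :: "'a measure \<Rightarrow> ('a \<Rightarrow> 'b::euclidean_space) \<Rightarrow> real" where
  "norm_L2 M f = sqrt (inner_L2 M f f)"

lemma L2_measurable: "L2 M f \<Longrightarrow> f \<in> borel_measurable M"
  by (simp add: L2_def)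

lemma L2_inner_integrable:
  assumes "L2 M f" "L2 M g"
  shows "integrable M (\<lambda>x. f x \<bullet> g x)"
proof (rule Bochner_Integration.integrable_bound)
  show "integrable M (\<lambda>x. (norm (f x))\<^sup>2 + (norm (g x))\<^sup>2)"
    using assms by (simp add: L2_def)
  show "(\<lambda>x. f x \<bullet> g x) \<in> borel_measurable M"
    using assms by (auto simp: L2_def)
  show "AE x in M. norm (f x \<bullet> g x) \<le> norm ((norm (f x))\<^sup>2 + (norm (g x))\<^sup>2)"
  proof (rule AE_I2)
    fix x
    have "norm (f x \<bullet> g x) \<le> norm (f x) * norm (g x)"
      using Cauchy_Schwarz_ineq2 by auto
    also have "\<dots> \<le> (norm (f x))\<^sup>2 + (norm (g x))\<^sup>2"
      using sum_squares_bound[of "norm (f x)" "norm (g x)"]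
        mult_nonneg_nonneg[OF norm_ge_zero[of "f x"] norm_ge_zero[of "g x"]] by linarith
    finally show "norm (f x \<bullet> g x) \<le> norm ((norm (f x))\<^sup>2 + (norm (g x))\<^sup>2)"
      by simp
  qed
qed

lemma L2_lincomb:
  assumes "L2 M f" "L2 M g"
  shows "L2 M (\<lambda>x. a *\<^sub>R f x + b *\<^sub>R g x)"
proof -
  have "integrable M (\<lambda>x. a\<^sup>2 * (norm (f x))\<^sup>2 + b\<^sup>2 * (norm (g x))\<^sup>2 + 2 * a * b * (f x \<bullet> g x))"
    using assms L2_inner_integrable[OF assms] by (auto simp: L2_def)
  also have "(\<lambda>x. a\<^sup>2 * (norm (f x))\<^sup>2 + b\<^sup>2 * (norm (g x))\<^sup>2 + 2 * a * b * (f x \<bullet> g x))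
      = (\<lambda>x. (norm (a *\<^sub>R f x + b *\<^sub>R g x))\<^sup>2)"
    by (rule ext, simp only: power2_norm_eq_inner)
      (simp add: algebra_simps inner_commute power2_eq_square)
  finally show ?thesis
    using assms by (auto simp: L2_def)
qed

lemma L2_diff: "L2 M f \<Longrightarrow> L2 M g \<Longrightarrow> L2 M (\<lambda>x. f x - g x)"
  using L2_lincomb[of M f g 1 "-1"] by simp

lemma L2_add: "L2 M f \<Longrightarrow> L2 M g \<Longrightarrow> L2 M (\<lambda>x. f x + g x)"
  using L2_lincomb[of M f g 1 1] by simp

lemma L2_scale: "L2 M f \<Longrightarrow> L2 M (\<lambda>x. c *\<^sub>R f x)"
  using L2_lincomb[of M f f c 0] by simp

lemma L2_norm: "L2 M f \<Longrightarrow> L2 M (\<lambda>x. norm (f x))"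
  by (auto simp: L2_def)

lemma L2_bounded:
  assumes "finite_measure M" "f \<in> borel_measurable M" "\<And>x. x \<in> space M \<Longrightarrow> norm (f x) \<le> B"
  shows "L2 M f"
proof -
  interpret finite_measure M by fact
  have "integrable M (\<lambda>x. (norm (f x))\<^sup>2)"
    by (rule integrable_const_bound[where B="B\<^sup>2"]) (use assms in \<open>auto intro!: power_mono\<close>)
  with assms show ?thesis by (simp add: L2_def)
qed

lemma L2_dominated:
  fixes f :: "'a \<Rightarrow> 'b::euclidean_space" and g :: "'a \<Rightarrow> 'c::euclidean_space"
  assumes "L2 M g" "f \<in> borel_measurable M" "\<And>x. x \<in> space M \<Longrightarrow> norm (f x) \<le> B * norm (g x)"
  shows "L2 M f"
proof -
  have "integrable M (\<lambda>x. (norm (f x))\<^sup>2)"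
  proof (rule Bochner_Integration.integrable_bound)
    show "integrable M (\<lambda>x. B\<^sup>2 * (norm (g x))\<^sup>2)"
      using assms by (simp add: L2_def)
    show "(\<lambda>x. (norm (f x))\<^sup>2) \<in> borel_measurable M"
      using assms by auto
    show "AE x in M. norm ((norm (f x))\<^sup>2) \<le> norm (B\<^sup>2 * (norm (g x))\<^sup>2)"
    proof (rule AE_I2)
      fix x assume "x \<in> space M"
      then have "(norm (f x))\<^sup>2 \<le> (B * norm (g x))\<^sup>2" using assms(3) by (intro power_mono) auto
      then show "norm ((norm (f x))\<^sup>2) \<le> norm (B\<^sup>2 * (norm (g x))\<^sup>2)"
        by (simp add: power_mult_distrib)
    qed
  qed
  then show ?thesis using assms by (simp add: L2_def)
qed

lemma L2_mult_bounded:
  fixes f :: "'a \<Rightarrow> 'b::euclidean_space" and w :: "'a \<Rightarrow> real"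
  assumes "L2 M f" "w \<in> borel_measurable M" "\<And>x. x \<in> space M \<Longrightarrow> \<bar>w x\<bar> \<le> B"
  shows "L2 M (\<lambda>x. w x *\<^sub>R f x)"
proof (rule L2_dominated[OF assms(1)])
  show "(\<lambda>x. w x *\<^sub>R f x) \<in> borel_measurable M" using assms(2) L2_measurable[OF assms(1)] by auto
  show "norm (w x *\<^sub>R f x) \<le> B * norm (f x)" if "x \<in> space M" for x
    using mult_right_mono[OF assms(3)[OF that] norm_ge_zero[of "f x"]] by simp
qed

lemma inner_L2_commute: "inner_L2 M f g = inner_L2 M g f"
  by (simp add: inner_L2_def inner_commute)

lemma inner_L2_lincomb:
  assumes "L2 M f" "L2 M g" "L2 M h"
  shows "inner_L2 M (\<lambda>x. a *\<^sub>R f x + b *\<^sub>R g x) h = a * inner_L2 M f h + b * inner_L2 M g h"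
proof -
  have "inner_L2 M (\<lambda>x. a *\<^sub>R f x + b *\<^sub>R g x) h = (LINT x|M. a * (f x \<bullet> h x) + b * (g x \<bullet> h x))"
    by (simp add: inner_L2_def inner_add_left)
  also have "\<dots> = (LINT x|M. a * (f x \<bullet> h x)) + (LINT x|M. b * (g x \<bullet> h x))"
    using L2_inner_integrable[OF assms(1,3)] L2_inner_integrable[OF assms(2,3)]
    by (intro Bochner_Integration.integral_add integrable_mult_right) auto
  finally show ?thesis by (simp add: inner_L2_def)
qed

lemma inner_L2_self: "inner_L2 M f f = (LINT x|M. (norm (f x))\<^sup>2)"
  by (simp add: inner_L2_def power2_norm_eq_inner)

lemma inner_L2_self_nonneg [simp]: "0 \<le> inner_L2 M f f"
  by (simp add: inner_L2_self)

lemma norm_L2_nonneg [simp]: "0 \<le> norm_L2 M f"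
  by (simp add: norm_L2_def)

lemma norm_L2_power2: "(norm_L2 M f)\<^sup>2 = inner_L2 M f f"
  by (simp add: norm_L2_def)

lemma inner_L2_square_lincomb:
  assumes "L2 M f" "L2 M g"
  shows "inner_L2 M (\<lambda>x. a *\<^sub>R f x + b *\<^sub>R g x) (\<lambda>x. a *\<^sub>R f x + b *\<^sub>R g x)
    = a\<^sup>2 * inner_L2 M f f + 2 * a * b * inner_L2 M f g + b\<^sup>2 * inner_L2 M g g"
proof -
  note c = L2_lincomb[OF assms]
  have "inner_L2 M f (\<lambda>x. a *\<^sub>R f x + b *\<^sub>R g x) = a * inner_L2 M f f + b * inner_L2 M f g"
    and "inner_L2 M g (\<lambda>x. a *\<^sub>R f x + b *\<^sub>R g x) = a * inner_L2 M f g + b * inner_L2 M g g"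
    using inner_L2_lincomb[OF assms(1,2) assms(1)] inner_L2_lincomb[OF assms(1,2) assms(2)]
    by (simp_all add: inner_L2_commute)
  then show ?thesis
    using inner_L2_lincomb[OF assms c] by (simp add: algebra_simps power2_eq_square)
qed

lemma inner_L2_Cauchy_Schwarz:
  assumes "L2 M f" "L2 M g"
  shows "\<bar>inner_L2 M f g\<bar> \<le> norm_L2 M f * norm_L2 M g"
proof -
  have q: "0 \<le> a\<^sup>2 * inner_L2 M f f + 2 * a * b * inner_L2 M f g + b\<^sup>2 * inner_L2 M g g" for a b
    using inner_L2_square_lincomb[OF assms, of a b] inner_L2_self_nonneg by metis
  have "(inner_L2 M f g)\<^sup>2 \<le> inner_L2 M f f * inner_L2 M g g"
  proof (cases "inner_L2 M g g = 0")
    case True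
    have "inner_L2 M f g = 0"
    proof (rule ccontr)
      assume n: "inner_L2 M f g \<noteq> 0"
      have "0 \<le> inner_L2 M f f + 2 * b * inner_L2 M f g" for b
        using q[of 1 b] True by simp
      from this[of "- (inner_L2 M f f + 1) / (2 * inner_L2 M f g)"] n show False
        by (simp add: field_simps)
    qed
    then show ?thesis using True by simp
  next
    case False
    then have p: "inner_L2 M g g > 0" using inner_L2_self_nonneg[of M g] by linarith
    have "0 \<le> (inner_L2 M g g) * (inner_L2 M f f * inner_L2 M g g - (inner_L2 M f g)\<^sup>2)"
      using q[of "inner_L2 M g g" "- inner_L2 M f g"] by (simp add: algebra_simps power2_eq_square)
    with p show ?thesis by (simp add: zero_le_mult_iff)
  qed
  then have "sqrt ((inner_L2 M f g)\<^sup>2) \<le> sqrt (inner_L2 M f f * inner_L2 M g g)" by (rule real_sqrt_le_mono)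
  then show ?thesis by (simp add: norm_L2_def real_sqrt_mult)
qed

lemma norm_L2_add:
  assumes "L2 M f" "L2 M g"
  shows "norm_L2 M (\<lambda>x. f x + g x) \<le> norm_L2 M f + norm_L2 M g"
proof -
  have "inner_L2 M (\<lambda>x. f x + g x) (\<lambda>x. f x + g x) = inner_L2 M f f + 2 * inner_L2 M f g + inner_L2 M g g"
    using inner_L2_square_lincomb[OF assms, of 1 1] by simp
  also have "\<dots> \<le> (norm_L2 M f + norm_L2 M g)\<^sup>2"
    using inner_L2_Cauchy_Schwarz[OF assms] by (simp add: power2_sum norm_L2_power2)
  finally show ?thesis
    by (simp add: norm_L2_def real_le_lsqrt)
qed

lemma norm_L2_minus: "norm_L2 M (\<lambda>x. f x - g x) = norm_L2 M (\<lambda>x. g x - f x)"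
  by (simp add: norm_L2_def inner_L2_self norm_minus_commute)

lemma norm_L2_triangle:
  assumes "L2 M f" "L2 M g" "L2 M h"
  shows "norm_L2 M (\<lambda>x. f x - h x) \<le> norm_L2 M (\<lambda>x. f x - g x) + norm_L2 M (\<lambda>x. g x - h x)"
  using norm_L2_add[OF L2_diff[OF assms(1,2)] L2_diff[OF assms(2,3)]] by simp

lemma norm_L2_le_diff:
  assumes "L2 M f" "L2 M g"
  shows "norm_L2 M g \<le> norm_L2 M f + norm_L2 M (\<lambda>x. f x - g x)"
  using norm_L2_add[OF assms(1) L2_diff[OF assms(2,1)]] norm_L2_minus[of M f g] by simp

lemma norm_L2_scale: "norm_L2 M (\<lambda>x. c *\<^sub>R f x) = \<bar>c\<bar> * norm_L2 M f"
  by (simp add: norm_L2_def inner_L2_self power_mult_distrib real_sqrt_mult)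

lemma norm_L2_norm: "norm_L2 M (\<lambda>x. norm (f x)) = norm_L2 M f"
  by (simp add: norm_L2_def inner_L2_self)

lemma L2_integrable:
  assumes "finite_measure M" "L2 M f"
  shows "integrable M f"
proof -
  interpret finite_measure M by fact
  have "L2 M (\<lambda>x. 1::real)" by (rule L2_bounded[where B=1]) (use assms in auto)
  from L2_inner_integrable[OF L2_norm[OF assms(2)] this]
  have "integrable M (\<lambda>x. norm (f x))" by simp
  then show ?thesis using L2_measurable[OF assms(2)] by (simp add: integrable_norm_iff)
qed

lemma integral_norm_le_norm_L2:
  assumes "finite_measure M" "L2 M f"
  shows "(LINT x|M. norm (f x)) \<le> sqrt (measure M (space M)) * norm_L2 M f"
proof -
  interpret finite_measure M by fact
  have 1: "L2 M (\<lambda>x. 1::real)" by (rule L2_bounded[where B=1]) (use assms in auto)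
  have "\<bar>inner_L2 M (\<lambda>x. norm (f x)) (\<lambda>x. 1::real)\<bar> \<le> norm_L2 M f * norm_L2 M (\<lambda>x. 1::real)"
    using inner_L2_Cauchy_Schwarz[OF L2_norm[OF assms(2)] 1] by (simp add: norm_L2_norm)
  also have "norm_L2 M (\<lambda>x. 1::real) = sqrt (measure M (space M))"
    by (simp add: norm_L2_def inner_L2_def)
  finally show ?thesis by (simp add: inner_L2_def mult.commute)
qed

text \<open>On a finite measure space an L2-Cauchy sequence is L1-Cauchy, so a subsequence converges
  almost everywhere; by Fatou's lemma the pointwise limit is the limit in L2.\<close>

lemma L2_complete:
  fixes s :: "nat \<Rightarrow> 'a \<Rightarrow> 'b::euclidean_space"
  assumes fin: "finite_measure M" and s: "\<And>n. L2 M (s n)"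
    and C: "\<And>e. e > 0 \<Longrightarrow> \<exists>N. \<forall>i\<ge>N. \<forall>j\<ge>N. norm_L2 M (\<lambda>x. s i x - s j x) < e"
  obtains f where "L2 M f" "(\<lambda>n. norm_L2 M (\<lambda>x. s n x - f x)) \<longlonglongrightarrow> 0"
proof -
  interpret finite_measure M by fact
  have [measurable]: "s n \<in> borel_measurable M" for n using s by (simp add: L2_def)
  let ?m = "sqrt (measure M (space M))"
  have "\<exists>N. \<forall>i\<ge>N. \<forall>j\<ge>N. (LINT x|M. norm (s i x - s j x)) < e" if "e > 0" for e
  proof -
    have m: "?m + 1 > 0" by (simp add: add_nonneg_pos)
    from C[of "e / (?m + 1)"] that m
    obtain N where N: "\<And>i j. i \<ge> N \<Longrightarrow> j \<ge> N \<Longrightarrow> norm_L2 M (\<lambda>x. s i x - s j x) < e / (?m + 1)"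
      by (meson divide_pos_pos)
    have "(LINT x|M. norm (s i x - s j x)) < e" if "i \<ge> N" "j \<ge> N" for i j
    proof -
      have "(LINT x|M. norm (s i x - s j x)) \<le> ?m * norm_L2 M (\<lambda>x. s i x - s j x)"
        by (rule integral_norm_le_norm_L2[OF fin L2_diff[OF s s]])
      also have "\<dots> \<le> (?m + 1) * norm_L2 M (\<lambda>x. s i x - s j x)"
        by (intro mult_right_mono) auto
      also have "\<dots> < (?m + 1) * (e / (?m + 1))"
        using N[OF that] m by (intro mult_strict_left_mono) auto
      finally show ?thesis using m by simp
    qed
    then show ?thesis by blast
  qed
  with cauchy_L1_AE_cauchy_subseq[of M s] L2_integrable[OF fin s]
  obtain r where r: "strict_mono r" and AEc: "AE x in M. Cauchy (\<lambda>i. s (r i) x)"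
    by blast
  define f where "f x = lim (\<lambda>i. s (r i) x)" for x
  have [measurable]: "f \<in> borel_measurable M"
    unfolding f_def by measurable
  have AEl: "AE x in M. (\<lambda>i. s (r i) x) \<longlonglongrightarrow> f x"
    using AEc by eventually_elim (simp add: f_def Cauchy_convergent_iff convergent_LIMSEQ_iff)
  have key: "L2 M (\<lambda>x. s n x - f x) \<and> norm_L2 M (\<lambda>x. s n x - f x) \<le> e"
    if e: "e > 0" and n: "n \<ge> N" and N: "\<And>i j. i \<ge> N \<Longrightarrow> j \<ge> N \<Longrightarrow> norm_L2 M (\<lambda>x. s i x - s j x) < e"
    for e N n
  proof -
    have "(\<integral>\<^sup>+x. ennreal ((norm (s n x - f x))\<^sup>2) \<partial>M)
        = (\<integral>\<^sup>+x. liminf (\<lambda>i. ennreal ((norm (s n x - s (r i) x))\<^sup>2)) \<partial>M)"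
    proof (rule nn_integral_cong_AE, use AEl in eventually_elim)
      fix x assume l: "(\<lambda>i. s (r i) x) \<longlonglongrightarrow> f x"
      have "(\<lambda>i. ennreal ((norm (s n x - s (r i) x))\<^sup>2)) \<longlonglongrightarrow> ennreal ((norm (s n x - f x))\<^sup>2)"
        by (intro tendsto_ennrealI tendsto_intros l)
      then show "ennreal ((norm (s n x - f x))\<^sup>2) = liminf (\<lambda>i. ennreal ((norm (s n x - s (r i) x))\<^sup>2))"
        by (rule lim_imp_Liminf[OF sequentially_bot, symmetric])
    qed
    also have "\<dots> \<le> liminf (\<lambda>i. \<integral>\<^sup>+x. ennreal ((norm (s n x - s (r i) x))\<^sup>2) \<partial>M)"
      by (rule nn_integral_liminf) auto
    also have "\<dots> \<le> liminf (\<lambda>i::nat. ennreal (e\<^sup>2))"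
    proof (rule Liminf_mono)
      have "eventually (\<lambda>i. r i \<ge> N) sequentially"
        using r filterlim_subseq[OF r] by (simp add: filterlim_at_top)
      then show "\<forall>\<^sub>F i in sequentially. (\<integral>\<^sup>+x. ennreal ((norm (s n x - s (r i) x))\<^sup>2) \<partial>M) \<le> ennreal (e\<^sup>2)"
      proof eventually_elim
        case (elim i)
        have "(\<integral>\<^sup>+x. ennreal ((norm (s n x - s (r i) x))\<^sup>2) \<partial>M) = ennreal (LINT x|M. (norm (s n x - s (r i) x))\<^sup>2)"
          using L2_diff[OF s s, of n "r i"] by (intro nn_integral_eq_integral) (auto simp: L2_def)
        also have "(LINT x|M. (norm (s n x - s (r i) x))\<^sup>2) = (norm_L2 M (\<lambda>x. s n x - s (r i) x))\<^sup>2"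
          by (simp add: norm_L2_power2 inner_L2_self)
        also have "\<dots> \<le> e\<^sup>2" using N[OF n elim] by (intro power_mono) auto
        finally show ?case by (simp add: ennreal_leI)
      qed
    qed
    also have "\<dots> = ennreal (e\<^sup>2)" by (simp add: Liminf_const)
    finally have *: "(\<integral>\<^sup>+x. ennreal ((norm (s n x - f x))\<^sup>2) \<partial>M) \<le> ennreal (e\<^sup>2)" .
    then have L: "L2 M (\<lambda>x. s n x - f x)"
      unfolding L2_def by (auto intro!: integrableI_bounded simp: order_le_less_trans)
    then have "ennreal (LINT x|M. (norm (s n x - f x))\<^sup>2) \<le> ennreal (e\<^sup>2)"
      using * by (subst nn_integral_eq_integral[symmetric]) (auto simp: L2_def)
    then have "inner_L2 M (\<lambda>x. s n x - f x) (\<lambda>x. s n x - f x) \<le> e\<^sup>2"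
      using e by (simp add: inner_L2_self)
    then show ?thesis using L e by (simp add: norm_L2_def real_le_lsqrt)
  qed
  obtain N where N: "\<And>i j. i \<ge> N \<Longrightarrow> j \<ge> N \<Longrightarrow> norm_L2 M (\<lambda>x. s i x - s j x) < 1"
    using C[of 1] by auto
  have "L2 M (\<lambda>x. s N x - f x)" using key[of 1 N N] N by auto
  from L2_diff[OF s[of N] this] have "L2 M f" by simp
  moreover have "(\<lambda>n. norm_L2 M (\<lambda>x. s n x - f x)) \<longlonglongrightarrow> 0"
  proof (rule LIMSEQ_I)
    fix e :: real assume e: "e > 0"
    then obtain N where N: "\<And>i j. i \<ge> N \<Longrightarrow> j \<ge> N \<Longrightarrow> norm_L2 M (\<lambda>x. s i x - s j x) < e / 2"
      using C[of "e/2"] by auto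
    have "norm (norm_L2 M (\<lambda>x. s n x - f x) - 0) < e" if "n \<ge> N" for n
      using key[OF _ that N] e by auto
    then show "\<exists>no. \<forall>n\<ge>no. norm (norm_L2 M (\<lambda>x. s n x - f x) - 0) < e" by blast
  qed
  ultimately show ?thesis using that by blast
qed

text \<open>The least norms in the sets \<open>K n\<close> increase with \<open>n\<close> and are bounded. By the
  parallelogram law, elements whose norm is almost least therefore form a Cauchy sequence. The lemma
  plays the role of weak compactness: a bounded sequence that satisfies convex constraints with
  vanishing errors is replaced by a strongly convergent one that satisfies the same constraints.\<close>

lemma nested_convex_selection:
  fixes K :: "nat \<Rightarrow> ('a \<Rightarrow> 'b::euclidean_space) set"
  assumes fin: "finite_measure M"
    and dec: "\<And>m n. m \<le> n \<Longrightarrow> K n \<subseteq> K m"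
    and L: "\<And>n x. x \<in> K n \<Longrightarrow> L2 M x"
    and conv: "\<And>n x y. x \<in> K n \<Longrightarrow> y \<in> K n \<Longrightarrow> (\<lambda>t. (1/2) *\<^sub>R x t + (1/2) *\<^sub>R y t) \<in> K n"
    and bd: "\<And>n. \<exists>x\<in>K n. inner_L2 M x x \<le> C"
  obtains y z where "\<And>n. y n \<in> K n" "L2 M z" "(\<lambda>n. norm_L2 M (\<lambda>x. y n x - z x)) \<longlonglongrightarrow> 0" "inner_L2 M z z \<le> C"
proof -
  define r where "r n = (INF x\<in>K n. inner_L2 M x x)" for n
  have bb: "bdd_below ((\<lambda>x. inner_L2 M x x) ` K n)" for n
    by (rule bdd_belowI2[where m=0]) simp
  have rle: "r n \<le> inner_L2 M x x" if "x \<in> K n" for n x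
    unfolding r_def by (rule cINF_lower[OF bb that])
  have rC: "r n \<le> C" for n
    using bd[of n] rle by (meson order_trans)
  have rmono: "r m \<le> r n" if "m \<le> n" for m n
    unfolding r_def using dec[OF that] bd[of n] bb by (intro cINF_superset_mono) auto
  have "\<exists>x\<in>K n. inner_L2 M x x < r n + 1 / (real n + 1)" for n
  proof -
    have ne: "(\<lambda>x. inner_L2 M x x) ` K n \<noteq> {}" using bd[of n] by blast
    show ?thesis
      using cInf_lessD[OF ne, of "r n + 1 / (real n + 1)"] unfolding r_def by auto
  qed
  then obtain y where y: "\<And>n. y n \<in> K n" and yr: "\<And>n. inner_L2 M (y n) (y n) < r n + 1 / (real n + 1)"
    by metis
  have "incseq r" using rmono by (auto simp: incseq_def)
  then obtain R where R: "r \<longlonglongrightarrow> R" and rR: "\<And>n. r n \<le> R"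
    using incseq_convergent[of r C] rC by blast
  have est: "inner_L2 M (\<lambda>t. y m t - y k t) (\<lambda>t. y m t - y k t) \<le> 2 * (R - r m) + 4 / (real m + 1)"
    if "m \<le> k" for m k
  proof -
    note Lm = L[OF y[of m]] and Lk = L[OF y[of k]]
    have "y k \<in> K m" using dec[OF that] y by blast
    from rle[OF conv[OF y[of m] this]]
    have 1: "4 * r m \<le> inner_L2 M (y m) (y m) + 2 * inner_L2 M (y m) (y k) + inner_L2 M (y k) (y k)"
      using inner_L2_square_lincomb[OF Lm Lk, of "1/2" "1/2"] by (simp add: power2_eq_square)
    have "1 / (real k + 1) \<le> 1 / (real m + 1)" using that by (simp add: frac_le)
    then have "inner_L2 M (y m) (y m) - 2 * inner_L2 M (y m) (y k) + inner_L2 M (y k) (y k) \<le> 2 * (R - r m) + 4 / (real m + 1)"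
      using 1 yr[of m] yr[of k] rR[of k] rR[of m] by auto
    then show ?thesis
      using inner_L2_square_lincomb[OF Lm Lk, of 1 "-1"] by simp
  qed
  have e0: "(\<lambda>m. 2 * (R - r m) + 4 / (real m + 1)) \<longlonglongrightarrow> 0"
  proof -
    have "(\<lambda>m. 4 / (real m + 1)) \<longlonglongrightarrow> 0" by real_asymp
    moreover have "(\<lambda>m. 2 * (R - r m)) \<longlonglongrightarrow> 2 * (R - R)" by (intro tendsto_intros R)
    ultimately show ?thesis using tendsto_add[of "\<lambda>m. 2 * (R - r m)" "2*(R-R)"] by fastforce
  qed
  have "\<exists>N. \<forall>i\<ge>N. \<forall>j\<ge>N. norm_L2 M (\<lambda>x. y i x - y j x) < e" if e: "e > 0" for e
  proof -
    have "eventually (\<lambda>m. 2 * (R - r m) + 4 / (real m + 1) < e\<^sup>2) sequentially"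
      using e0 e by (intro order_tendstoD(2)) auto
    then obtain N where N: "\<And>m. m \<ge> N \<Longrightarrow> 2 * (R - r m) + 4 / (real m + 1) < e\<^sup>2"
      by (auto simp: eventually_sequentially)
    have *: "norm_L2 M (\<lambda>x. y i x - y j x) < e" if "i \<ge> N" "i \<le> j" for i j
    proof -
      have "inner_L2 M (\<lambda>t. y i t - y j t) (\<lambda>t. y i t - y j t) < e\<^sup>2"
        using est[OF that(2)] N[OF that(1)] by linarith
      then show ?thesis using e by (simp add: norm_L2_def real_less_lsqrt)
    qed
    show ?thesis using * norm_L2_minus by (metis linear)
  qed
  from L2_complete[OF fin L[OF y] this]
  obtain z where z: "L2 M z" "(\<lambda>n. norm_L2 M (\<lambda>x. y n x - z x)) \<longlonglongrightarrow> 0" by blast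
  have "norm_L2 M z \<le> sqrt C"
  proof (rule LIMSEQ_le_const)
    have "(\<lambda>n. sqrt (C + 1 / (real n + 1)) + norm_L2 M (\<lambda>x. y n x - z x)) \<longlonglongrightarrow> sqrt (C + 0) + 0"
      by (intro tendsto_intros z(2)) real_asymp
    then show "(\<lambda>n. sqrt (C + 1 / (real n + 1)) + norm_L2 M (\<lambda>x. y n x - z x)) \<longlonglongrightarrow> sqrt C"
      by simp
    show "\<exists>N. \<forall>n\<ge>N. norm_L2 M z \<le> sqrt (C + 1 / (real n + 1)) + norm_L2 M (\<lambda>x. y n x - z x)"
    proof (intro exI allI impI)
      fix n
      have "norm_L2 M (y n) \<le> sqrt (C + 1 / (real n + 1))"
        unfolding norm_L2_def using yr[of n] rC[of n] by (intro real_sqrt_le_mono) linarith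
      then show "norm_L2 M z \<le> sqrt (C + 1 / (real n + 1)) + norm_L2 M (\<lambda>x. y n x - z x)"
        using norm_L2_le_diff[OF L[OF y] z(1), of n] by linarith
    qed
  qed
  then have "inner_L2 M z z \<le> C" by (simp add: norm_L2_def)
  with y z that show ?thesis by blast
qed

text \<open>The Banach-Steinhaus theorem for the functionals \<open>z \<mapsto> inner_L2 M (X n) z\<close> on a closed subspace,
  by a gliding hump. If the norms were unbounded, one could choose \<open>W k\<close> among the \<open>X n\<close> with norm
  above \<open>4 ^ k\<close> and add up multiples of norm \<open>3 ^ - k\<close> of them. With the right signs, the
  partial sum up to \<open>W k\<close> has inner product at least \<open>3 ^ - k * norm (W k)\<close> with \<open>W k\<close>, and the
  remaining terms reduce this by at most one half, which leaves \<open>(4/3) ^ k / 2\<close>.\<close>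

lemma uniform_boundedness:
  fixes X :: "nat \<Rightarrow> 'a \<Rightarrow> 'b::euclidean_space"
  assumes fin: "finite_measure M"
    and L: "\<And>x. x \<in> V \<Longrightarrow> L2 M x"
    and lin: "\<And>x y a b. x \<in> V \<Longrightarrow> y \<in> V \<Longrightarrow> (\<lambda>t. a *\<^sub>R x t + b *\<^sub>R y t) \<in> V"
    and closed: "\<And>y z. (\<And>n. y n \<in> V) \<Longrightarrow> L2 M z \<Longrightarrow> (\<lambda>n::nat. norm_L2 M (\<lambda>x. y n x - z x)) \<longlonglongrightarrow> 0 \<Longrightarrow> z \<in> V"
    and X: "\<And>n. X n \<in> V"
    and bd: "\<And>z. z \<in> V \<Longrightarrow> \<exists>B. \<forall>n. \<bar>inner_L2 M (X n) z\<bar> \<le> B"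
  shows "\<exists>B. \<forall>n. norm_L2 M (X n) \<le> B"
proof (rule ccontr)
  assume "\<not> ?thesis"
  then have "\<forall>k. \<exists>n. norm_L2 M (X n) > 4 ^ k" by (meson not_le)
  then obtain m where m: "\<And>k. norm_L2 M (X (m k)) > 4 ^ k" by metis
  \<comment> \<open>the hump: \<open>W k\<close> has norm above \<open>4 ^ k\<close>\<close>
  define W where "W k = X (m k)" for k
  define \<nu> where "\<nu> k = norm_L2 M (W k)" for k
  have \<nu>pos: "\<nu> k > 0" for k
    using m[of k] zero_less_power[of "4::real" k] by (simp add: \<nu>_def W_def del: zero_less_power)
  have WV: "W k \<in> V" and WL: "L2 M (W k)" for k using X L by (auto simp: W_def)
  define c where "c k = (1/3) ^ k / \<nu> k" for k
  have cpos: "c k > 0" for k using \<nu>pos by (simp add: c_def)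
  define pick where "pick k y = (if \<bar>inner_L2 M (W k) (\<lambda>t. y t + c k *\<^sub>R W k t)\<bar> \<ge> (1/3)^k * \<nu> k
      then (\<lambda>t. y t + c k *\<^sub>R W k t) else (\<lambda>t. y t - c k *\<^sub>R W k t))" for k y
  define Y where "Y = rec_nat (\<lambda>t. 0) pick"
  have Y0: "Y 0 = (\<lambda>t. 0)" and YS: "Y (Suc k) = pick k (Y k)" for k
    by (simp_all add: Y_def)
  have YV: "Y k \<in> V" for k
  proof (induction k)
    case 0 show ?case using lin[OF X[of 0] X[of 0], of 0 0] by (simp add: Y0)
  next
    case (Suc k)
    show ?case using lin[OF Suc WV[of k], of 1 "c k"] lin[OF Suc WV[of k], of 1 "- c k"]
      by (simp add: YS pick_def)
  qed
  note YL = L[OF YV]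
  have step: "norm_L2 M (\<lambda>t. Y (Suc k) t - Y k t) = (1/3)^k" for k
  proof -
    have "norm_L2 M (\<lambda>t. Y (Suc k) t - Y k t) = \<bar>c k\<bar> * \<nu> k"
      using norm_L2_scale[of M "c k" "W k"] norm_L2_scale[of M "- c k" "W k"]
      by (simp add: YS pick_def \<nu>_def)
    also have "\<dots> = (1/3)^k" using \<nu>pos[of k] by (simp add: c_def)
    finally show ?thesis .
  qed
  have big: "\<bar>inner_L2 M (W k) (Y (Suc k))\<bar> \<ge> (1/3)^k * \<nu> k" for k
  proof (cases "\<bar>inner_L2 M (W k) (\<lambda>t. Y k t + c k *\<^sub>R W k t)\<bar> \<ge> (1/3)^k * \<nu> k")
    case True then show ?thesis by (simp add: YS pick_def)
  next
    case False
    have e1: "inner_L2 M (W k) (\<lambda>t. Y k t + c k *\<^sub>R W k t) = inner_L2 M (Y k) (W k) + c k * inner_L2 M (W k) (W k)"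
      using inner_L2_lincomb[OF YL[of k] WL[of k] WL[of k], of 1 "c k"] by (simp add: inner_L2_commute)
    have e2: "inner_L2 M (W k) (\<lambda>t. Y k t - c k *\<^sub>R W k t) = inner_L2 M (Y k) (W k) - c k * inner_L2 M (W k) (W k)"
      using inner_L2_lincomb[OF YL[of k] WL[of k] WL[of k], of 1 "- c k"] by (simp add: inner_L2_commute)
    have "c k * inner_L2 M (W k) (W k) = (1/3)^k * \<nu> k"
      using \<nu>pos[of k] by (simp add: c_def \<nu>_def norm_L2_power2[symmetric] power2_eq_square)
    then show ?thesis using False e1 e2 by (simp add: YS pick_def)
  qed
  \<comment> \<open>the steps after stage \<open>k\<close> sum to at most \<open>3/2 * (1/3)^k\<close>, which is half a step if \<open>k\<close> is replaced by \<open>k + 1\<close>\<close>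
  have tail: "norm_L2 M (\<lambda>t. Y (k + j) t - Y k t) \<le> 3/2 * (1/3)^k * (1 - (1/3)^j)" for k j
  proof (induction j)
    case 0 show ?case by (simp add: norm_L2_def inner_L2_def)
  next
    case (Suc j)
    have "norm_L2 M (\<lambda>t. Y (k + Suc j) t - Y k t)
        \<le> norm_L2 M (\<lambda>t. Y (k + Suc j) t - Y (k + j) t) + norm_L2 M (\<lambda>t. Y (k + j) t - Y k t)"
      by (rule norm_L2_triangle[OF YL YL YL])
    also have "\<dots> \<le> (1/3)^(k+j) + 3/2 * (1/3)^k * (1 - (1/3)^j)"
      using Suc step[of "k + j"] by simp
    also have "\<dots> = 3/2 * (1/3)^k * (1 - (1/3)^Suc j)"
      by (simp add: power_add field_simps)
    finally show ?case .
  qed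
  have tail': "norm_L2 M (\<lambda>t. Y j t - Y k t) \<le> 3/2 * (1/3)^k" if "k \<le> j" for j k
  proof -
    have "norm_L2 M (\<lambda>t. Y j t - Y k t) \<le> 3/2 * (1/3)^k * (1 - (1/3)^(j-k))"
      using tail[of k "j - k"] that by simp
    also have "\<dots> \<le> 3/2 * (1/3)^k * 1" by (intro mult_left_mono) auto
    finally show ?thesis by simp
  qed
  have "\<exists>N. \<forall>i\<ge>N. \<forall>j\<ge>N. norm_L2 M (\<lambda>x. Y i x - Y j x) < e" if e: "e > 0" for e
  proof -
    have "(\<lambda>k. 3/2 * (1/3::real)^k) \<longlonglongrightarrow> 0" by real_asymp
    then have "eventually (\<lambda>k. 3/2 * (1/3::real)^k < e) sequentially"
      using e by (intro order_tendstoD(2)) auto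
    then obtain N where N: "\<And>k. k \<ge> N \<Longrightarrow> 3/2 * (1/3::real)^k < e"
      by (auto simp: eventually_sequentially)
    have *: "norm_L2 M (\<lambda>x. Y i x - Y j x) < e" if "j \<ge> N" "j \<le> i" for i j
      using tail'[OF that(2)] N[OF that(1)] by linarith
    show ?thesis using * norm_L2_minus by (metis linear)
  qed
  from L2_complete[OF fin YL this]
  obtain z where z: "L2 M z" "(\<lambda>n. norm_L2 M (\<lambda>x. Y n x - z x)) \<longlonglongrightarrow> 0" by blast
  have zV: "z \<in> V" by (rule closed[OF YV z])
  have zt: "norm_L2 M (\<lambda>x. Y k x - z x) \<le> 3/2 * (1/3)^k" for k
  proof (rule LIMSEQ_le_const)
    have "(\<lambda>n. 3/2 * (1/3)^k + norm_L2 M (\<lambda>x. Y n x - z x)) \<longlonglongrightarrow> 3/2 * (1/3)^k + 0"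
      by (intro tendsto_intros z(2))
    then show "(\<lambda>n. 3/2 * (1/3)^k + norm_L2 M (\<lambda>x. Y n x - z x)) \<longlonglongrightarrow> 3/2 * (1/3)^k" by simp
    show "\<exists>N. \<forall>n\<ge>N. norm_L2 M (\<lambda>x. Y k x - z x) \<le> 3/2 * (1/3)^k + norm_L2 M (\<lambda>x. Y n x - z x)"
    proof (intro exI allI impI)
      fix n assume "k \<le> n"
      from norm_L2_triangle[OF YL[of k] YL[of n] z(1)] tail'[OF this] norm_L2_minus[of M "Y k" "Y n"]
      show "norm_L2 M (\<lambda>x. Y k x - z x) \<le> 3/2 * (1/3)^k + norm_L2 M (\<lambda>x. Y n x - z x)" by linarith
    qed
  qed
  have lower: "\<bar>inner_L2 M (W k) z\<bar> \<ge> 1/2 * (4/3)^k" for k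
  proof -
    have d: "L2 M (\<lambda>x. Y (Suc k) x - z x)" by (rule L2_diff[OF YL z(1)])
    have "inner_L2 M (\<lambda>x. Y (Suc k) x - z x) (W k) = inner_L2 M (Y (Suc k)) (W k) - inner_L2 M z (W k)"
      using inner_L2_lincomb[OF YL[of "Suc k"] z(1) WL[of k], of 1 "-1"] by simp
    moreover have "\<bar>inner_L2 M (\<lambda>x. Y (Suc k) x - z x) (W k)\<bar> \<le> (1/2 * (1/3)^k) * \<nu> k"
    proof -
      have "\<bar>inner_L2 M (\<lambda>x. Y (Suc k) x - z x) (W k)\<bar> \<le> norm_L2 M (\<lambda>x. Y (Suc k) x - z x) * \<nu> k"
        unfolding \<nu>_def by (rule inner_L2_Cauchy_Schwarz[OF d WL])
      also have "\<dots> \<le> (1/2 * (1/3)^k) * \<nu> k"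
        using zt[of "Suc k"] \<nu>pos[of k] by (intro mult_right_mono) auto
      finally show ?thesis .
    qed
    ultimately have "\<bar>inner_L2 M (W k) z\<bar> \<ge> 1/2 * ((1/3)^k * \<nu> k)"
      using big[of k] abs_triangle_ineq2[of "inner_L2 M (W k) (Y (Suc k))" "inner_L2 M (W k) z"]
        inner_L2_commute[of M z "W k"] inner_L2_commute[of M "Y (Suc k)" "W k"] by linarith
    moreover have "(1/3)^k * \<nu> k \<ge> (1/3)^k * 4^k"
      using m[of k] by (intro mult_left_mono) (auto simp: \<nu>_def W_def)
    moreover have "(1/3::real)^k * 4^k = (4/3)^k" by (simp add: power_mult_distrib[symmetric])
    ultimately show ?thesis by linarith
  qed
  obtain B where B: "\<And>n. \<bar>inner_L2 M (X n) z\<bar> \<le> B" using bd[OF zV] by blast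
  obtain k where "2 * B < (4/3)^k" using real_arch_pow[of "4/3" "2 * B"] by auto
  with lower[of k] B[of "m k"] show False by (simp add: W_def)
qed

section \<open>Curves of class H2 on the unit interval\<close>

definition lborel01 :: "real measure" where
  "lborel01 = restrict_space lborel {0..1}"

lemma space_lborel01 [simp]: "space lborel01 = {0..1}"
  by (simp add: lborel01_def)

lemma AE_lborel01_iff: "(AE t in lborel01. P t) \<longleftrightarrow> (AE t in lborel. t \<in> {0..1} \<longrightarrow> P t)"
  unfolding lborel01_def by (rule AE_restrict_space_iff) simp

lemma finite_measure_lborel01: "finite_measure lborel01"
  by (rule finite_measureI) (simp add: lborel01_def emeasure_restrict_space)

lemma measure_lborel01 [simp]: "measure lborel01 {0..1} = 1"
  by (simp add: lborel01_def measure_restrict_space)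

lemma borel_measurable_lborel01_iff:
  fixes f :: "real \<Rightarrow> 'a::euclidean_space"
  shows "f \<in> borel_measurable lborel01 \<longleftrightarrow> set_borel_measurable lborel {0..1} f"
  by (simp add: lborel01_def set_borel_measurable_def borel_measurable_restrict_space_iff)

lemma integrable_lborel01_iff:
  fixes f :: "real \<Rightarrow> 'a::euclidean_space"
  shows "integrable lborel01 f \<longleftrightarrow> set_integrable lborel {0..1} f"
  by (simp add: lborel01_def set_integrable_def integrable_restrict_space)

lemma integral_lborel01:
  fixes f :: "real \<Rightarrow> 'a::euclidean_space"
  shows "(LINT t|lborel01. f t) = (LINT t:{0..1}|lborel. f t)"
  by (simp add: lborel01_def set_lebesgue_integral_def integral_restrict_space)

lemma L2_unit_iff: "L2_unit f \<longleftrightarrow> L2 lborel01 f"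
  by (simp add: L2_unit_def L2_def borel_measurable_lborel01_iff integrable_lborel01_iff)

lemma integrable_lborel01_subinterval:
  fixes f :: "real \<Rightarrow> 'a::euclidean_space"
  assumes "integrable lborel01 f" "0 \<le> a" "b \<le> 1"
  shows "set_integrable lborel {a..b} f"
  by (rule set_integrable_subset[of lborel "{0..1}"]) (use assms in \<open>auto simp: integrable_lborel01_iff\<close>)

lemma set_LINT_eq_integral:
  fixes f :: "real \<Rightarrow> 'a::euclidean_space"
  assumes "integrable lborel01 f" "0 \<le> a" "b \<le> 1"
  shows "(LINT t:{a..b}|lborel. f t) = integral {a..b} f" "f integrable_on {a..b}"
  using set_borel_integral_eq_integral[OF integrable_lborel01_subinterval[OF assms]] by auto

lemma set_LINT_lborel01:
  fixes f :: "real \<Rightarrow> 'a::euclidean_space"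
  assumes "0 \<le> a" "b \<le> 1"
  shows "(LINT t:{a..b}|lborel. f t) = (LINT t|lborel01. indicator {a..b} t *\<^sub>R f t)"
  unfolding integral_lborel01 set_lebesgue_integral_def
  by (rule Bochner_Integration.integral_cong) (use assms in \<open>auto simp: indicator_def\<close>)

lemma set_LINT_combine:
  fixes f :: "real \<Rightarrow> 'a::euclidean_space"
  assumes "integrable lborel01 f" "0 \<le> s" "s \<le> t" "t \<le> 1"
  shows "(LINT r:{0..t}|lborel. f r) = (LINT r:{0..s}|lborel. f r) + (LINT r:{s..t}|lborel. f r)"
  using Henstock_Kurzweil_Integration.integral_combine[of 0 s t f] assms
  by (simp add: set_LINT_eq_integral)

lemma continuous_integrable_lborel01:
  fixes f :: "real \<Rightarrow> 'a::euclidean_space"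
  assumes "continuous_on {0..1} f"
  shows "integrable lborel01 f"
  using borel_integrable_atLeastAtMost'[OF assms] by (simp add: integrable_lborel01_iff)

lemma continuous_measurable_lborel01:
  fixes f :: "real \<Rightarrow> 'a::euclidean_space"
  assumes "continuous_on {0..1} f"
  shows "f \<in> borel_measurable lborel01"
  using continuous_integrable_lborel01[OF assms] by (rule borel_measurable_integrable)

lemma continuous_L2:
  fixes f :: "real \<Rightarrow> 'a::euclidean_space"
  assumes "continuous_on {0..1} f"
  shows "L2 lborel01 f"
proof -
  have "integrable lborel01 (\<lambda>x. (norm (f x))\<^sup>2)"
    by (rule continuous_integrable_lborel01) (intro continuous_intros assms)
  then show ?thesis using continuous_measurable_lborel01[OF assms] by (simp add: L2_def)
qed

lemma set_LINT_singleton: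
  fixes f :: "real \<Rightarrow> 'a::euclidean_space"
  shows "(LINT r:{0}|lborel. f r) = 0"
proof -
  have "AE r in lborel. indicator {0::real} r *\<^sub>R f r = 0"
    using AE_lborel_singleton[of 0] by eventually_elim (auto simp: indicator_def)
  then have "(LINT r|lborel. indicator {0::real} r *\<^sub>R f r) = 0"
    by (rule integral_eq_zero_AE)
  then show ?thesis by (simp add: set_lebesgue_integral_def)
qed

lemma norm_set_LINT_le:
  fixes h :: "real \<Rightarrow> 'a::euclidean_space"
  assumes "L2 lborel01 h" "0 \<le> s" "s \<le> t" "t \<le> 1"
  shows "norm (LINT r:{s..t}|lborel. h r) \<le> sqrt (t - s) * norm_L2 lborel01 h"
proof -
  let ?i = "\<lambda>r. indicator {s..t} r :: real"
  have Li: "L2 lborel01 ?i"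
    by (rule L2_bounded[OF finite_measure_lborel01, where B=1]) (auto simp: lborel01_def indicator_def intro!: measurable_restrict_space1)
  have "norm (LINT r:{s..t}|lborel. h r) \<le> (LINT r|lborel01. norm (?i r *\<^sub>R h r))"
    using assms by (simp add: set_LINT_lborel01 integral_norm_bound del: norm_scaleR)
  also have "\<dots> = inner_L2 lborel01 ?i (\<lambda>r. norm (h r))"
    by (simp add: inner_L2_def)
  also have "\<dots> \<le> norm_L2 lborel01 ?i * norm_L2 lborel01 h"
    using inner_L2_Cauchy_Schwarz[OF Li L2_norm[OF assms(1)]] by (simp add: norm_L2_norm)
  also have "norm_L2 lborel01 ?i = sqrt (t - s)"
  proof -
    have "inner_L2 lborel01 ?i ?i = (LINT r|lborel01. indicator {s..t} r *\<^sub>R 1)"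
      unfolding inner_L2_def by (rule Bochner_Integration.integral_cong) (auto simp: indicator_def)
    also have "\<dots> = (LINT r:{s..t}|lborel. 1)"
      using assms by (subst set_LINT_lborel01) auto
    also have "\<dots> = t - s" using assms by (simp add: set_lebesgue_integral_def)
    finally show ?thesis by (simp add: norm_L2_def)
  qed
  finally show ?thesis .
qed

text \<open>The two indefinite integrals agree on half-lines, which generate the Borel sets and are
  closed under intersection; so they agree on all Borel sets.\<close>

lemma density_unique_unit:
  fixes f g :: "real \<Rightarrow> 'a::euclidean_space"
  assumes f: "integrable lborel01 f" and g: "integrable lborel01 g"
    and eq: "\<And>t. t \<in> {0..1} \<Longrightarrow> (LINT s:{0..t}|lborel. f s) = (LINT s:{0..t}|lborel. g s)"
  shows "AE t in lborel01. f t = g t"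
proof -
  define d where "d t = indicator {0..1::real} t *\<^sub>R (f t - g t)" for t
  have dint: "integrable lborel d"
    using Bochner_Integration.integrable_diff[OF f g]
    unfolding d_def integrable_lborel01_iff set_integrable_def by simp
  have dz: "(LINT s:{0..t}|lborel. d s) = 0" if "t \<in> {0..1}" for t
  proof -
    have "(LINT s:{0..t}|lborel. d s) = (LINT s:{0..t}|lborel. f s - g s)"
      unfolding set_lebesgue_integral_def d_def
      by (rule Bochner_Integration.integral_cong) (use that in \<open>auto simp: indicator_def\<close>)
    also have "\<dots> = (LINT s:{0..t}|lborel. f s) - (LINT s:{0..t}|lborel. g s)"
      using that f g by (intro set_integral_diff integrable_lborel01_subinterval) auto
    finally show ?thesis using eq[OF that] by simp
  qed
  have base: "(LINT s:{..a}|lborel. d s) = 0" for a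
  proof -
    have "(LINT s:{..a}|lborel. d s) = (if a < 0 then 0 else (LINT s:{0..min a 1}|lborel. d s))"
    proof (cases "a < 0")
      case True
      then have "(\<lambda>s. indicator {..a} s *\<^sub>R d s) = (\<lambda>s. 0)"
        by (auto simp: indicator_def d_def)
      then have "(LINT s:{..a}|lborel. d s) = 0"
        by (simp add: set_lebesgue_integral_def)
      then show ?thesis using True by simp
    next
      case False
      then have "(LINT s:{..a}|lborel. d s) = (LINT s:{0..min a 1}|lborel. d s)"
        unfolding set_lebesgue_integral_def
        by (intro Bochner_Integration.integral_cong refl) (auto simp: indicator_def d_def)
      then show ?thesis using False by simp
    qed
    also have "\<dots> = 0" using dz[of "min a 1"] by (auto simp: not_less)
    finally show ?thesis .
  qed
  have tot: "(LINT s|lborel. d s) = 0"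
  proof -
    have "(LINT s|lborel. d s) = (LINT s:{0..1}|lborel. d s)"
      unfolding set_lebesgue_integral_def
      by (intro Bochner_Integration.integral_cong) (auto simp: indicator_def d_def)
    then show ?thesis using dz[of 1] by simp
  qed
  have "(LINT s:A|lborel. d s) = 0" if "A \<in> sets lborel" for A
  proof -
    have si: "set_integrable lborel B d" if "B \<in> sets borel" for B
      unfolding set_integrable_def using integrable_mult_indicator[OF _ dint, of B] that by simp
    have A: "A \<in> sigma_sets UNIV (range (\<lambda>a::real. {..a}))"
      using that by (simp add: borel_eq_atMost)
    have bor: "B \<in> sets borel" if "B \<in> sigma_sets UNIV (range (\<lambda>a::real. {..a}))" for B
      using that by (simp add: borel_eq_atMost)
    have st: "Int_stable (range (\<lambda>a::real. {..a}))"
      by (auto simp: Int_stable_def)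
    have sp: "range (\<lambda>a::real. {..a}) \<subseteq> Pow UNIV" by simp
    show ?thesis
      using st sp A
    proof (induction rule: sigma_sets_induct_disjoint)
      case (basic A)
      then show ?case using base by auto
    next
      case empty
      show ?case by (simp add: set_lebesgue_integral_def)
    next
      case (compl A)
      have "(LINT s:(UNIV - A) \<union> A|lborel. d s) = (LINT s:UNIV - A|lborel. d s) + (LINT s:A|lborel. d s)"
        using bor[OF compl(1)] by (intro set_integral_Un si) auto
      then show ?case using compl(2) tot by (simp add: set_lebesgue_integral_def)
    next
      case (union A)
      have dj: "A i \<inter> A j = {}" if "i \<noteq> j" for i j
        using union(1) that by (auto simp: disjoint_family_on_def)
      have Ab: "A i \<in> sets borel" for i using union(2) bor by blast
      have "(LINT s:(\<Union>i. A i)|lborel. d s) = (\<Sum>i. (LINT s:(A i)|lborel. d s))"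
        using Ab dj by (intro lebesgue_integral_countable_add si) auto
      then show ?case using union(3) by simp
    qed
  qed
  then have "AE t in lborel. d t = 0" by (rule sigma_finite_measure.density_zero[OF sigma_finite_lborel dint])
  then have "AE t in lborel. t \<in> {0..1} \<longrightarrow> f t = g t"
    by eventually_elim (auto simp: d_def indicator_def split: if_splits)
  then show ?thesis by (simp only: AE_lborel01_iff)
qed

lemma primitive_continuous:
  fixes h :: "real \<Rightarrow> 'a::euclidean_space"
  assumes "integrable lborel01 h"
  shows "continuous_on {0..1} (\<lambda>t. LINT s:{0..t}|lborel. h s)"
proof -
  have "continuous_on {0..1} (\<lambda>t. integral {0..t} h)"
    using set_LINT_eq_integral(2)[OF assms, of 0 1] by (intro indefinite_integral_continuous_1) auto
  then show ?thesis
    by (rule continuous_on_eq) (simp add: set_LINT_eq_integral[OF assms])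
qed

lemma velocity_eqI:
  assumes "(c has_vector_derivative v) (at t within {0..1})" "t \<in> {0..1}"
  shows "velocity c t = v"
  unfolding velocity_def using assms
  by (intro vector_derivative_within_closed_interval) auto

text \<open>The acceleration is chosen among functions that are equal almost everywhere, so it is
  identified with \<open>h\<close> only up to a null set.\<close>

lemma H2_curveI:
  fixes c v h :: "real \<Rightarrow> 'a::euclidean_space"
  assumes d: "\<And>t. t \<in> {0..1} \<Longrightarrow> (c has_vector_derivative v t) (at t within {0..1})"
    and h: "L2 lborel01 h" and v: "\<And>t. t \<in> {0..1} \<Longrightarrow> v t = v 0 + (LINT s:{0..t}|lborel. h s)"
  shows "H2_curve c" "\<And>t. t \<in> {0..1} \<Longrightarrow> velocity c t = v t" "AE t in lborel01. acceleration c t = h t"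
proof -
  show vel: "velocity c t = v t" if "t \<in> {0..1}" for t
    using d[OF that] that by (rule velocity_eqI)
  have "velocity c t = velocity c 0 + (LINT s:{0..t}|lborel. h s)" if "t \<in> {0..1}" for t
    using v[OF that] vel[OF that] vel[of 0] by simp
  then have w: "weak_second_deriv c h"
    using h unfolding weak_second_deriv_def L2_unit_iff by blast
  then show "H2_curve c"
    using d unfolding H2_curve_def differentiable_def has_vector_derivative_def by blast
  have w2: "weak_second_deriv c (acceleration c)"
    unfolding acceleration_def by (rule someI[of "weak_second_deriv c", OF w])
  show "AE t in lborel01. acceleration c t = h t"
  proof (rule density_unique_unit)
    show "integrable lborel01 (acceleration c)" "integrable lborel01 h"
      using w w2 L2_integrable[OF finite_measure_lborel01] unfolding weak_second_deriv_def L2_unit_iff by blast+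
    fix t :: real assume "t \<in> {0..1}"
    then show "(LINT s:{0..t}|lborel. acceleration c s) = (LINT s:{0..t}|lborel. h s)"
      using w w2 unfolding weak_second_deriv_def by (metis add_left_cancel)
  qed
qed

lemma H2_curveD:
  fixes c :: "real \<Rightarrow> 'a::euclidean_space"
  assumes "H2_curve c"
  shows "\<And>t. t \<in> {0..1} \<Longrightarrow> (c has_vector_derivative velocity c t) (at t within {0..1})"
    and "L2 lborel01 (acceleration c)"
    and "\<And>t. t \<in> {0..1} \<Longrightarrow> velocity c t = velocity c 0 + (LINT s:{0..t}|lborel. acceleration c s)"
proof -
  show "(c has_vector_derivative velocity c t) (at t within {0..1})" if "t \<in> {0..1}" for t
    using assms that unfolding H2_curve_def velocity_def by (simp add: vector_derivative_works)
  have "weak_second_deriv c (acceleration c)"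
    using someI_ex[of "weak_second_deriv c"] assms unfolding H2_curve_def acceleration_def by blast
  then show "L2 lborel01 (acceleration c)"
    and "\<And>t. t \<in> {0..1} \<Longrightarrow> velocity c t = velocity c 0 + (LINT s:{0..t}|lborel. acceleration c s)"
    unfolding weak_second_deriv_def L2_unit_iff by blast+
qed

lemma H2_velocity_continuous:
  assumes "H2_curve c"
  shows "continuous_on {0..1} (velocity c)"
proof -
  have "continuous_on {0..1} (\<lambda>t. velocity c 0 + (LINT s:{0..t}|lborel. acceleration c s))"
    by (intro continuous_intros primitive_continuous L2_integrable[OF finite_measure_lborel01] H2_curveD(2) assms)
  then show ?thesis
    by (rule continuous_on_eq) (metis H2_curveD(3)[OF assms])
qed

lemma H2_continuous:
  assumes "H2_curve c"
  shows "continuous_on {0..1} c"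
  using H2_curveD(1)[OF assms] has_vector_derivative_continuous continuous_on_eq_continuous_within by blast

lemma regular_curve_speed_bounds:
  assumes "regular_curve c"
  obtains \<kappa> K where "0 < \<kappa>" "\<And>t. t \<in> {0..1} \<Longrightarrow> \<kappa> \<le> norm (velocity c t)" "\<And>t. t \<in> {0..1} \<Longrightarrow> norm (velocity c t) \<le> K"
proof -
  have c: "continuous_on {0..1} (\<lambda>t. norm (velocity c t))"
    using assms by (intro continuous_intros H2_velocity_continuous) (simp add: regular_curve_def)
  obtain x where x: "x \<in> {0..1}" "\<And>y. y \<in> {0..1} \<Longrightarrow> norm (velocity c x) \<le> norm (velocity c y)"
    using continuous_attains_inf[OF _ _ c] by auto
  obtain z where z: "z \<in> {0..1}" "\<And>y. y \<in> {0..1} \<Longrightarrow> norm (velocity c y) \<le> norm (velocity c z)"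
    using continuous_attains_sup[OF _ _ c] by auto
  show ?thesis
    by (rule that[of "norm (velocity c x)" "norm (velocity c z)"])
      (use assms x z in \<open>auto simp: regular_curve_def\<close>)
qed

text \<open>If the increments of \<open>W\<close> are of smaller order than those of the indefinite integral of \<open>g\<close>,
  then they add up to zero along fine partitions. This replaces differentiation almost everywhere
  in the chain rule below.\<close>

lemma constant_if_increments_small:
  fixes W :: "real \<Rightarrow> 'a::euclidean_space"
  assumes g: "integrable lborel01 g" and g0: "\<And>t. 0 \<le> g t"
    and inc: "\<And>e. e > 0 \<Longrightarrow> \<exists>d>0. \<forall>s t. 0 \<le> s \<and> s \<le> t \<and> t \<le> 1 \<and> t - s < d \<longrightarrow>
      norm (W t - W s) \<le> e * (LINT r:{s..t}|lborel. g r)"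
    and t: "t \<in> {0..1}"
  shows "W t = (W 0 :: 'a)"
proof -
  have le: "norm (W t - W 0) \<le> e * (LINT r:{0..t}|lborel. g r)" if e: "e > 0" for e
  proof -
    obtain d where d: "d > 0" "\<And>s t. 0 \<le> s \<Longrightarrow> s \<le> t \<Longrightarrow> t \<le> 1 \<Longrightarrow> t - s < d \<Longrightarrow>
      norm (W t - W s) \<le> e * (LINT r:{s..t}|lborel. g r)" using inc[OF e] by auto
    have "norm (W t - W 0) \<le> e * (LINT r:{0..t}|lborel. g r)" if "t \<in> {0..1}" "t \<le> real k * (d/2)" for k t
      using that
    proof (induction k arbitrary: t)
      case 0
      then have "t = 0" by simp
      then show ?case using e by (simp add: set_LINT_singleton)
    next
      case (Suc k)
      define s where "s = max 0 (t - d/2)"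
      have s: "s \<in> {0..1}" "s \<le> t" "s \<le> real k * (d/2)" "t - s < d"
        using Suc.prems d(1) by (auto simp: s_def algebra_simps max_def)
      have "norm (W t - W 0) \<le> norm (W t - W s) + norm (W s - W 0)"
        by (metis norm_triangle_ineq diff_add_cancel add_diff_eq)
      also have "\<dots> \<le> e * (LINT r:{s..t}|lborel. g r) + e * (LINT r:{0..s}|lborel. g r)"
        using d(2)[of s t] s Suc by (intro add_mono) auto
      also have "\<dots> = e * (LINT r:{0..t}|lborel. g r)"
        using set_LINT_combine[OF g, of s t] s Suc.prems by (simp add: distrib_left)
      finally show ?case .
    qed
    moreover obtain k where "t \<le> real k * (d/2)"
      using ex_less_of_nat_mult[of "d/2" t] d(1) by (auto simp: mult.commute intro: less_imp_le)
    ultimately show ?thesis using t by blast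
  qed
  have "norm (W t - W 0) \<le> 0"
  proof (rule field_le_epsilon)
    fix e :: real assume e: "e > 0"
    define G where "G = (LINT r:{0..t}|lborel. g r)"
    have G: "G \<ge> 0" unfolding G_def set_lebesgue_integral_def
      by (rule Bochner_Integration.integral_nonneg) (simp add: g0)
    have "norm (W t - W 0) \<le> e / (G + 1) * G" using le[of "e / (G+1)"] e G by (simp add: G_def)
    also have "\<dots> \<le> e" using e G by (simp add: field_simps)
    finally show "norm (W t - W 0) \<le> 0 + e" by simp
  qed
  then show ?thesis by simp
qed

section \<open>Absolute continuity of the unit tangent\<close>

text \<open>The derivative of \<open>sgn\<close> at \<open>x\<close>, applied to \<open>z\<close>: the component of \<open>z\<close> orthogonal to \<open>x\<close>, divided by
  \<open>|x|\<close>. Along a regular curve it maps the acceleration to the derivative of the unit tangent.\<close>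

definition dsgn :: "'a::euclidean_space \<Rightarrow> 'a \<Rightarrow> 'a" where
  "dsgn x z = (1 / norm x) *\<^sub>R (z - (z \<bullet> sgn x) *\<^sub>R sgn x)"

lemma norm_dsgn_le: "norm (dsgn x z) \<le> (2 / norm x) * norm z"
proof (cases "x = 0")
  case False
  have "norm (z - (z \<bullet> sgn x) *\<^sub>R sgn x) \<le> norm z + \<bar>z \<bullet> sgn x\<bar> * norm (sgn x)"
    using norm_triangle_ineq4[of z "(z \<bullet> sgn x) *\<^sub>R sgn x"] by simp
  also have "\<dots> \<le> norm z + norm z"
    using Cauchy_Schwarz_ineq2[of z "sgn x"] False by (simp add: norm_sgn)
  finally have "norm (z - (z \<bullet> sgn x) *\<^sub>R sgn x) \<le> 2 * norm z" by simp
  from mult_left_mono[OF this, of "1 / norm x"] show ?thesis by (simp add: dsgn_def)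
qed (simp add: dsgn_def)

lemma sgn_scaled: "(x::'a::euclidean_space) = norm x *\<^sub>R sgn x"
  by (cases "x = 0") (auto simp: sgn_div_norm)

lemma sgn_Lipschitz:
  fixes x y :: "'a::euclidean_space"
  assumes "x \<noteq> 0" "y \<noteq> 0"
  shows "norm (sgn y - sgn x) \<le> 2 * norm (y - x) / norm x"
proof -
  have "norm x *\<^sub>R (sgn y - sgn x) = (y - x) + (norm x - norm y) *\<^sub>R sgn y"
    using sgn_scaled[of x] sgn_scaled[of y] by (simp add: algebra_simps)
  then have "norm x * norm (sgn y - sgn x) = norm ((y - x) + (norm x - norm y) *\<^sub>R sgn y)"
    by (metis abs_norm_cancel norm_scaleR)
  also have "\<dots> \<le> norm (y - x) + \<bar>norm x - norm y\<bar> * norm (sgn y)"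
    using norm_triangle_ineq[of "y - x" "(norm x - norm y) *\<^sub>R sgn y"] by simp
  also have "\<dots> \<le> norm (y - x) + norm (y - x)"
    using norm_triangle_ineq3[of x y] assms by (simp add: norm_sgn norm_minus_commute)
  finally show ?thesis using assms by (simp add: field_simps)
qed

text \<open>Multiplied by \<open>|x|\<close>, the remainder is a combination of \<open>sgn y - sgn x\<close> and \<open>sgn x\<close> with
  coefficients \<open>|x| - |y|\<close>, of first order in \<open>y - x\<close>, and \<open>|y| - |x| - (y - x) \<bullet> sgn x\<close>, of second
  order.\<close>

lemma sgn_first_order:
  fixes x y :: "'a::euclidean_space"
  assumes "x \<noteq> 0" "y \<noteq> 0"
  shows "norm (sgn y - sgn x - dsgn x (y - x)) \<le> 4 * (norm (y - x))\<^sup>2 / (norm x)\<^sup>2"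
proof -
  define X Y d e where "X = norm x" "Y = norm y" "d = y - x" "e = Y - X - d \<bullet> sgn x"
  note defs = this
  have X: "X > 0" "Y > 0" using assms by (auto simp: defs)
  have xs: "x = X *\<^sub>R sgn x" and ys: "y = Y *\<^sub>R sgn y"
    unfolding defs by (rule sgn_scaled)+
  have u: "sgn x \<bullet> sgn x = 1" "sgn y \<bullet> sgn y = 1"
    using assms by (simp_all add: power2_norm_eq_inner[symmetric] norm_sgn)
  have le1: "z \<bullet> sgn x \<le> norm z" "z \<bullet> sgn y \<le> norm z" for z
    using norm_cauchy_schwarz[of z "sgn x"] norm_cauchy_schwarz[of z "sgn y"] assms by (simp_all add: norm_sgn)
  have xx: "x \<bullet> sgn x = X" and yy: "y \<bullet> sgn y = Y"
    using arg_cong[OF xs, of "\<lambda>z. z \<bullet> sgn x"] arg_cong[OF ys, of "\<lambda>z. z \<bullet> sgn y"] u by simp_all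
  have e0: "0 \<le> e" using le1(1)[of y] xx by (simp add: defs inner_diff_left)
  have "e = d \<bullet> (sgn y - sgn x) + (x \<bullet> sgn y - X)"
    using xx yy by (simp add: defs(3,4) inner_diff_left inner_diff_right)
  also have "\<dots> \<le> norm d * norm (sgn y - sgn x)"
    using norm_cauchy_schwarz[of d "sgn y - sgn x"] le1(2)[of x] by (simp add: defs(1))
  also have "\<dots> \<le> norm d * (2 * norm d / X)"
    using sgn_Lipschitz[OF assms] by (intro mult_left_mono) (auto simp: defs)
  finally have e1: "e \<le> 2 * (norm d)\<^sup>2 / X" by (simp add: power2_eq_square mult.left_commute)
  have "X *\<^sub>R (sgn y - sgn x - dsgn x d) = (X - Y) *\<^sub>R (sgn y - sgn x) - e *\<^sub>R sgn x"
  proof -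
    define b where "b = d \<bullet> sgn x"
    have d1: "X *\<^sub>R dsgn x d = d - b *\<^sub>R sgn x"
      using X by (simp add: dsgn_def defs(1) b_def)
    have d2: "d = Y *\<^sub>R sgn y - X *\<^sub>R sgn x" using xs ys by (simp add: defs(3))
    have e': "e = Y - X - b" by (simp add: defs(4) b_def)
    have "X *\<^sub>R (sgn y - sgn x - dsgn x d) = X *\<^sub>R sgn y - X *\<^sub>R sgn x - (d - b *\<^sub>R sgn x)"
      by (simp add: d1 scaleR_diff_right)
    also have "\<dots> = (X - Y) *\<^sub>R (sgn y - sgn x) - e *\<^sub>R sgn x"
      by (subst d2) (simp add: e' algebra_simps)
    finally show ?thesis .
  qed
  then have "X * norm (sgn y - sgn x - dsgn x d) = norm ((X - Y) *\<^sub>R (sgn y - sgn x) - e *\<^sub>R sgn x)"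
    using X by (metis abs_of_pos norm_scaleR)
  also have "\<dots> \<le> \<bar>X - Y\<bar> * norm (sgn y - sgn x) + \<bar>e\<bar> * norm (sgn x)"
    using norm_triangle_ineq4[of "(X - Y) *\<^sub>R (sgn y - sgn x)" "e *\<^sub>R sgn x"] by simp
  also have "\<dots> \<le> norm d * (2 * norm d / X) + 2 * (norm d)\<^sup>2 / X"
  proof (intro add_mono mult_mono)
    show "\<bar>X - Y\<bar> \<le> norm d" using norm_triangle_ineq3[of x y] by (simp add: defs norm_minus_commute)
    show "norm (sgn y - sgn x) \<le> 2 * norm d / X" using sgn_Lipschitz[OF assms] by (simp add: defs)
    show "\<bar>e\<bar> * norm (sgn x) \<le> 2 * (norm d)\<^sup>2 / X" using e0 e1 assms by (simp add: norm_sgn)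
  qed auto
  also have "\<dots> = 4 * (norm d)\<^sup>2 / X" by (simp add: power2_eq_square)
  finally have "norm (sgn y - sgn x - dsgn x d) \<le> (4 * (norm d)\<^sup>2 / X) / X"
    using X by (simp add: pos_le_divide_eq mult.commute)
  then show ?thesis by (simp add: defs(1,3) power2_eq_square)
qed

lemma dsgn_Lipschitz:
  fixes x y z :: "'a::euclidean_space"
  assumes "0 < \<kappa>" "\<kappa> \<le> norm x" "\<kappa> \<le> norm y"
  shows "norm (dsgn y z - dsgn x z) \<le> 6 / \<kappa>\<^sup>2 * norm (y - x) * norm z"
proof -
  have ne: "x \<noteq> 0" "y \<noteq> 0" using assms by auto
  have pos: "0 < norm x" "0 < norm y" using ne by auto
  have kk: "\<kappa>\<^sup>2 \<le> norm x * norm y" "\<kappa>\<^sup>2 \<le> norm x * norm x"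
    using assms by (auto simp: power2_eq_square intro!: mult_mono)
  define p where "p = norm y *\<^sub>R dsgn y z"
  have p: "p = z - (z \<bullet> sgn y) *\<^sub>R sgn y" using ne by (simp add: p_def dsgn_def)
  have np: "norm p \<le> 2 * norm z"
    using norm_dsgn_le[of y z] ne by (simp add: p_def field_simps)
  have "dsgn y z - dsgn x z = (1 / norm y - 1 / norm x) *\<^sub>R p
      + (1 / norm x) *\<^sub>R ((z \<bullet> (sgn x - sgn y)) *\<^sub>R sgn x + (z \<bullet> sgn y) *\<^sub>R (sgn x - sgn y))"
    by (simp add: p dsgn_def algebra_simps inner_diff_right)
  then have "norm (dsgn y z - dsgn x z) \<le> \<bar>1 / norm y - 1 / norm x\<bar> * norm p
      + (1 / norm x) * norm ((z \<bullet> (sgn x - sgn y)) *\<^sub>R sgn x + (z \<bullet> sgn y) *\<^sub>R (sgn x - sgn y))"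
    by (metis (no_types, lifting) norm_triangle_ineq norm_scaleR abs_divide abs_norm_cancel abs_one)
  also have "\<dots> \<le> (norm (y - x) / \<kappa>\<^sup>2) * (2 * norm z) + (4 / \<kappa>\<^sup>2) * norm (y - x) * norm z"
  proof (rule add_mono)
    have "\<bar>1 / norm y - 1 / norm x\<bar> = \<bar>norm x - norm y\<bar> / (norm x * norm y)"
      using pos by (simp add: field_simps abs_divide abs_mult)
    also have "\<dots> \<le> norm (y - x) / \<kappa>\<^sup>2"
      using norm_triangle_ineq3[of x y] kk assms(1) by (intro frac_le) (auto simp: norm_minus_commute)
    finally have "\<bar>1 / norm y - 1 / norm x\<bar> \<le> norm (y - x) / \<kappa>\<^sup>2" .
    then show "\<bar>1 / norm y - 1 / norm x\<bar> * norm p \<le> (norm (y - x) / \<kappa>\<^sup>2) * (2 * norm z)"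
      by (intro mult_mono np) auto
    have "norm ((z \<bullet> (sgn x - sgn y)) *\<^sub>R sgn x + (z \<bullet> sgn y) *\<^sub>R (sgn x - sgn y))
        \<le> \<bar>z \<bullet> (sgn x - sgn y)\<bar> * norm (sgn x) + \<bar>z \<bullet> sgn y\<bar> * norm (sgn x - sgn y)"
      by (metis norm_triangle_ineq norm_scaleR)
    also have "\<dots> \<le> norm z * norm (sgn x - sgn y) + norm z * norm (sgn x - sgn y)"
      using Cauchy_Schwarz_ineq2[of z "sgn x - sgn y"] Cauchy_Schwarz_ineq2[of z "sgn y"] ne
      by (intro add_mono mult_right_mono) (auto simp: norm_sgn)
    also have "\<dots> \<le> 2 * norm z * (2 * norm (y - x) / norm x)"
      using mult_left_mono[OF sgn_Lipschitz[OF ne], of "2 * norm z"] by (simp add: norm_minus_commute)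
    finally have "(1 / norm x) * norm ((z \<bullet> (sgn x - sgn y)) *\<^sub>R sgn x + (z \<bullet> sgn y) *\<^sub>R (sgn x - sgn y))
        \<le> (1 / norm x) * (2 * norm z * (2 * norm (y - x) / norm x))"
      by (intro mult_left_mono) auto
    also have "\<dots> = (4 * norm (y - x) * norm z) / (norm x * norm x)" by simp
    also have "\<dots> \<le> (4 * norm (y - x) * norm z) / \<kappa>\<^sup>2"
      using kk assms(1) pos by (intro divide_left_mono mult_pos_pos) auto
    finally show "(1 / norm x) * norm ((z \<bullet> (sgn x - sgn y)) *\<^sub>R sgn x + (z \<bullet> sgn y) *\<^sub>R (sgn x - sgn y))
        \<le> (4 / \<kappa>\<^sup>2) * norm (y - x) * norm z" by simp
  qed
  also have "\<dots> = 6 / \<kappa>\<^sup>2 * norm (y - x) * norm z" by (simp add: field_simps)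
  finally show ?thesis .
qed

lemma bounded_linear_dsgn: "bounded_linear (dsgn x)"
proof -
  have "linear (dsgn x)"
    by (intro linearI) (simp_all add: dsgn_def inner_add_left algebra_simps)
  then show ?thesis by (simp add: linear_conv_bounded_linear)
qed

lemma regular_curve_nonzero: "regular_curve c \<Longrightarrow> t \<in> {0..1} \<Longrightarrow> velocity c t \<noteq> 0"
  by (simp add: regular_curve_def)

lemma tangent_continuous:
  assumes "regular_curve c"
  shows "continuous_on {0..1} (\<lambda>t. sgn (velocity c t))"
  using assms by (intro continuous_on_sgn H2_velocity_continuous) (auto simp: regular_curve_def)

lemma speed_curvature_eq_dsgn:
  "norm (velocity c t) *\<^sub>R curvature c t = dsgn (velocity c t) (acceleration c t)"
  by (cases "velocity c t = 0") (simp_all add: curvature_def Let_def dsgn_def power2_eq_square)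

lemma tangent_derivative_L2:
  assumes "regular_curve c"
  shows "L2 lborel01 (\<lambda>t. dsgn (velocity c t) (acceleration c t))"
proof -
  have H: "H2_curve c" using assms by (simp add: regular_curve_def)
  obtain \<kappa> K where \<kappa>: "0 < \<kappa>" "\<And>t. t \<in> {0..1} \<Longrightarrow> \<kappa> \<le> norm (velocity c t)"
    using regular_curve_speed_bounds[OF assms] by metis
  have [measurable]: "(\<lambda>t. sgn (velocity c t)) \<in> borel_measurable lborel01"
    by (rule continuous_measurable_lborel01[OF tangent_continuous[OF assms]])
  have [measurable]: "velocity c \<in> borel_measurable lborel01"
    by (rule continuous_measurable_lborel01[OF H2_velocity_continuous[OF H]])
  have [measurable]: "acceleration c \<in> borel_measurable lborel01"
    by (rule L2_measurable[OF H2_curveD(2)[OF H]])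
  show ?thesis
  proof (rule L2_dominated[OF H2_curveD(2)[OF H]])
    show "(\<lambda>t. dsgn (velocity c t) (acceleration c t)) \<in> borel_measurable lborel01"
      unfolding dsgn_def by measurable
    fix t assume "t \<in> space lborel01"
    then have "2 / norm (velocity c t) \<le> 2 / \<kappa>" using \<kappa> by (intro frac_le) auto
    then show "norm (dsgn (velocity c t) (acceleration c t)) \<le> (2 / \<kappa>) * norm (acceleration c t)"
      using norm_dsgn_le[of "velocity c t" "acceleration c t"] by (meson mult_right_mono norm_ge_zero order_trans)
  qed
qed

text \<open>The chain rule for \<open>sgn\<close> along the absolutely continuous velocity. On a short interval the
  Taylor remainder of \<open>sgn\<close> and the oscillation of its derivative are both small compared with the
  integral of \<open>|acceleration|\<close>.\<close>

lemma tangent_primitive: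
  assumes reg: "regular_curve c" and t: "t \<in> {0..1}"
  shows "sgn (velocity c t) = sgn (velocity c 0)
    + (LINT s:{0..t}|lborel. dsgn (velocity c s) (acceleration c s))"
proof -
  have H: "H2_curve c" using reg by (simp add: regular_curve_def)
  define v a w where "v = velocity c" "a = acceleration c" "w = (\<lambda>t. dsgn (v t) (a t))"
  note defs = this
  obtain \<kappa> K where \<kappa>: "0 < \<kappa>" "\<And>t. t \<in> {0..1} \<Longrightarrow> \<kappa> \<le> norm (v t)"
    using regular_curve_speed_bounds[OF reg] unfolding defs by metis
  have aint: "integrable lborel01 a" unfolding defs by (intro L2_integrable[OF finite_measure_lborel01] H2_curveD(2)[OF H])
  have wint: "integrable lborel01 w" unfolding defs by (intro L2_integrable[OF finite_measure_lborel01] tangent_derivative_L2 reg)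
  define W where "W t = sgn (v t) - (LINT s:{0..t}|lborel. w s)" for t
  have "W t = W 0"
  proof (rule constant_if_increments_small[OF integrable_norm[OF aint] _ _ t])
    fix e :: real assume e: "e > 0"
    define \<eta> where "\<eta> = e * \<kappa>\<^sup>2 / 10"
    have \<eta>: "\<eta> > 0" using e \<kappa> by (simp add: \<eta>_def)
    have "uniformly_continuous_on {0..1} v"
      unfolding defs by (intro compact_uniformly_continuous H2_velocity_continuous H) auto
    then obtain d where d: "d > 0" "\<And>s t. s \<in> {0..1} \<Longrightarrow> t \<in> {0..1} \<Longrightarrow> dist t s < d \<Longrightarrow> dist (v t) (v s) < \<eta>"
      unfolding uniformly_continuous_on_def using \<eta> by metis
    have "norm (W t - W s) \<le> e * (LINT r:{s..t}|lborel. norm (a r))"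
      if st: "0 \<le> s" "s \<le> t" "t \<le> 1" "t - s < d" for s t
    proof -
      have close: "norm (v r - v s) \<le> \<eta>" if "r \<in> {s..t}" for r
        using d(2)[of s r] st that by (auto simp: dist_norm less_imp_le)
      have sub: "set_integrable lborel {s..t} a" "set_integrable lborel {s..t} w"
        using aint wint st by (auto intro: integrable_lborel01_subinterval)
      have subn: "set_integrable lborel {s..t} (\<lambda>r. norm (a r))"
        using sub(1) by (rule set_integrable_norm)
      have incv: "v t - v s = (LINT r:{s..t}|lborel. a r)"
        using H2_curveD(3)[OF H, of t] H2_curveD(3)[OF H, of s] set_LINT_combine[OF aint, of s t] st
        by (simp add: defs)
      have nv: "norm (v t - v s) \<le> (LINT r:{s..t}|lborel. norm (a r))"
        unfolding incv using set_integral_norm_bound[OF sub(1)] .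
      have Dint: "dsgn (v s) (LINT r:{s..t}|lborel. a r) = (LINT r:{s..t}|lborel. dsgn (v s) (a r))"
        "set_integrable lborel {s..t} (\<lambda>r. dsgn (v s) (a r))"
      proof -
        interpret bounded_linear "dsgn (v s)" by (rule bounded_linear_dsgn)
        show "dsgn (v s) (LINT r:{s..t}|lborel. a r) = (LINT r:{s..t}|lborel. dsgn (v s) (a r))"
          using integral_bounded_linear[OF bounded_linear_axioms sub(1)[unfolded set_integrable_def]]
          by (simp add: set_lebesgue_integral_def scaleR)
        show "set_integrable lborel {s..t} (\<lambda>r. dsgn (v s) (a r))"
          using integrable_bounded_linear[OF bounded_linear_axioms sub(1)[unfolded set_integrable_def]]
          by (simp add: set_integrable_def scaleR)
      qed
      have "W t - W s = (sgn (v t) - sgn (v s) - dsgn (v s) (v t - v s))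
          + (dsgn (v s) (v t - v s) - (LINT r:{s..t}|lborel. w r))"
        using set_LINT_combine[OF wint, of s t] st by (simp add: W_def)
      also have "dsgn (v s) (v t - v s) - (LINT r:{s..t}|lborel. w r)
          = (LINT r:{s..t}|lborel. dsgn (v s) (a r) - w r)"
        unfolding incv Dint(1) by (rule set_integral_diff(2)[OF Dint(2) sub(2), symmetric])
      finally have "norm (W t - W s) \<le> norm (sgn (v t) - sgn (v s) - dsgn (v s) (v t - v s))
          + norm (LINT r:{s..t}|lborel. dsgn (v s) (a r) - w r)"
        by (simp add: norm_triangle_ineq)
      also have "\<dots> \<le> 4 / \<kappa>\<^sup>2 * \<eta> * (LINT r:{s..t}|lborel. norm (a r))
          + 6 / \<kappa>\<^sup>2 * \<eta> * (LINT r:{s..t}|lborel. norm (a r))"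
      proof (rule add_mono)
        have ks: "\<kappa> \<le> norm (v s)" "\<kappa> \<le> norm (v t)" using \<kappa>(2) st by auto
        have "norm (sgn (v t) - sgn (v s) - dsgn (v s) (v t - v s)) \<le> 4 * (norm (v t - v s))\<^sup>2 / (norm (v s))\<^sup>2"
          using ks \<kappa>(1) by (intro sgn_first_order) auto
        also have "\<dots> \<le> 4 * (norm (v t - v s))\<^sup>2 / \<kappa>\<^sup>2"
          using ks(1) \<kappa>(1) by (intro divide_left_mono) (auto intro!: power_mono mult_pos_pos)
        also have "\<dots> = 4 / \<kappa>\<^sup>2 * (norm (v t - v s) * norm (v t - v s))" by (simp add: power2_eq_square)
        also have "\<dots> \<le> 4 / \<kappa>\<^sup>2 * (\<eta> * (LINT r:{s..t}|lborel. norm (a r)))"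
          using close[of t] nv st \<eta> by (intro mult_left_mono mult_mono) auto
        finally show "norm (sgn (v t) - sgn (v s) - dsgn (v s) (v t - v s)) \<le> 4 / \<kappa>\<^sup>2 * \<eta> * (LINT r:{s..t}|lborel. norm (a r))"
          by simp
        have "norm (LINT r:{s..t}|lborel. dsgn (v s) (a r) - w r) \<le> (LINT r:{s..t}|lborel. norm (dsgn (v s) (a r) - w r))"
          by (rule set_integral_norm_bound[OF set_integral_diff(1)[OF Dint(2) sub(2)]])
        also have "\<dots> \<le> (LINT r:{s..t}|lborel. 6 / \<kappa>\<^sup>2 * \<eta> * norm (a r))"
        proof (rule set_integral_mono)
          show "set_integrable lborel {s..t} (\<lambda>r. norm (dsgn (v s) (a r) - w r))"
            by (rule set_integrable_norm[OF set_integral_diff(1)[OF Dint(2) sub(2)]])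
          show "set_integrable lborel {s..t} (\<lambda>r. 6 / \<kappa>\<^sup>2 * \<eta> * norm (a r))"
            by (rule set_integrable_mult_right) (rule subn)
          fix r assume r: "r \<in> {s..t}"
          have "norm (dsgn (v s) (a r) - w r) \<le> 6 / \<kappa>\<^sup>2 * norm (v s - v r) * norm (a r)"
            unfolding defs(3) using \<kappa>(2)[of r] r st ks by (intro dsgn_Lipschitz[OF \<kappa>(1)]) auto
          also have "\<dots> \<le> 6 / \<kappa>\<^sup>2 * \<eta> * norm (a r)"
            using close[OF r] by (intro mult_right_mono mult_left_mono) (auto simp: norm_minus_commute)
          finally show "norm (dsgn (v s) (a r) - w r) \<le> 6 / \<kappa>\<^sup>2 * \<eta> * norm (a r)" .
        qed
        also have "\<dots> = 6 / \<kappa>\<^sup>2 * \<eta> * (LINT r:{s..t}|lborel. norm (a r))"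
          by (rule set_integral_mult_right)
        finally show "norm (LINT r:{s..t}|lborel. dsgn (v s) (a r) - w r) \<le> 6 / \<kappa>\<^sup>2 * \<eta> * (LINT r:{s..t}|lborel. norm (a r))" .
      qed
      also have "\<dots> = e * (LINT r:{s..t}|lborel. norm (a r))"
        using \<kappa>(1) by (simp add: \<eta>_def field_simps)
      finally show ?thesis .
    qed
    then show "\<exists>d>0. \<forall>s t. 0 \<le> s \<and> s \<le> t \<and> t \<le> 1 \<and> t - s < d \<longrightarrow>
        norm (W t - W s) \<le> e * (LINT r:{s..t}|lborel. norm (a r))"
      using d(1) by blast
  qed auto
  then show ?thesis by (simp add: W_def defs set_LINT_singleton algebra_simps)
qed

section \<open>The tangent indicatrix\<close>

text \<open>The inverse \<open>\<psi>\<close> of the primitive of \<open>q\<close> is differentiable at the ends \<open>0\<close> and \<open>1\<close> as well, in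
  the two-sided sense that the substitution rule asks for, because \<open>q\<close> can be extended beyond the
  interval by its end values.\<close>

lemma inverse_arclength:
  fixes q :: "real \<Rightarrow> real"
  assumes cont: "continuous_on {0..1} q" and pos: "\<And>t. t \<in> {0..1} \<Longrightarrow> 0 < q t"
    and one: "(LINT s:{0..1}|lborel. q s) = 1"
  obtains \<psi> where "\<psi> 0 = 0" "\<psi> 1 = 1" "\<And>x. x \<in> {0..1} \<Longrightarrow> \<psi> x \<in> {0..1}"
    "\<And>x. x \<in> {0..1} \<Longrightarrow> (\<psi> has_real_derivative 1 / q (\<psi> x)) (at x)"
    "\<And>t. t \<in> {0..1} \<Longrightarrow> (LINT s:{0..t}|lborel. q s) \<in> {0..1}"
    "\<And>t. t \<in> {0..1} \<Longrightarrow> \<psi> (LINT s:{0..t}|lborel. q s) = t"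
proof -
  \<comment> \<open>\<open>q\<close> continued by its end values\<close>
  define Q where "Q t = q (max 0 (min 1 t))" for t
  have Qpos: "0 < Q t" for t unfolding Q_def by (rule pos) auto
  have Qq: "Q t = q t" if "t \<in> {0..1}" for t
  proof -
    have "max 0 (min 1 t) = t" using that by auto
    then show ?thesis by (simp add: Q_def)
  qed
  have "continuous_on UNIV Q"
    unfolding Q_def by (rule continuous_on_compose2[OF cont]) (auto intro!: continuous_intros)
  then have Qc: "continuous_on A Q" for A by (rule continuous_on_subset) simp
  obtain G where G: "\<And>x. x \<in> {-1..2} \<Longrightarrow> (G has_vector_derivative Q x) (at x within {-1..2})"
    using antiderivative_continuous[OF Qc, of "-1" 2] by metis
  define S where "S t = G t - G 0" for t
  have dS: "(S has_real_derivative Q x) (at x)" if "-1 < x" "x < 2" for x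
  proof -
    have "(G has_real_derivative Q x) (at x within {-1..2})"
      using G[of x] that by (simp add: has_real_derivative_iff_has_vector_derivative)
    then have "(G has_real_derivative Q x) (at x)"
      using that by (simp add: at_within_Icc_at)
    then show ?thesis unfolding S_def by (auto intro!: derivative_eq_intros)
  qed
  have S0: "S 0 = 0" by (simp add: S_def)
  have Sint: "S t = (LINT s:{0..t}|lborel. q s)" if "t \<in> {0..1}" for t
  proof -
    have "(Q has_integral S t - S 0) {0..t}"
    proof (rule fundamental_theorem_of_calculus)
      fix x assume "x \<in> {0..t}"
      then show "(S has_vector_derivative Q x) (at x within {0..t})"
        using dS[of x] that
        by (auto simp: has_real_derivative_iff_has_vector_derivative intro: has_vector_derivative_at_within)
    qed (use that in auto)
    then have "(q has_integral S t - S 0) {0..t}"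
      by (rule has_integral_eq[rotated]) (use that in \<open>auto simp: Qq\<close>)
    then show ?thesis
      using that set_LINT_eq_integral(1)[OF continuous_integrable_lborel01[OF cont], of 0 t]
      by (simp add: S0 integral_unique)
  qed
  have S1: "S 1 = 1" using Sint[of 1] one by simp
  have mono: "S x < S y" if "-1 < x" "x < y" "y < 2" for x y
  proof (rule DERIV_pos_imp_increasing[OF that(2)])
    fix z assume "x \<le> z" "z \<le> y"
    then have "(S has_real_derivative Q z) (at z)" using that by (intro dS) auto
    then show "\<exists>D. (S has_real_derivative D) (at z) \<and> 0 < D" using Qpos[of z] by blast
  qed
  \<comment> \<open>any interval strictly between \<open>[0, 1]\<close> and \<open>[-1, 2]\<close> would do\<close>
  define a b :: real where "a = -1/2" "b = 3/2"
  note ab = this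
  have inj: "inj_on S {a..b}"
  proof (rule linorder_inj_onI)
    fix x y assume "x < y" "x \<in> {a..b}" "y \<in> {a..b}"
    then show "S x \<noteq> S y" using mono[of x y] by (auto simp: ab)
  qed auto
  define \<psi> where "\<psi> = inv_into {a..b} S"
  have \<psi>S: "\<psi> (S t) = t" if "t \<in> {a..b}" for t
    unfolding \<psi>_def by (rule inv_into_f_f[OF inj that])
  have Sc: "isCont S t" if "-1 < t" "t < 2" for t
    using dS[OF that] by (rule DERIV_isCont)
  have ex: "\<exists>t\<in>{l..u}. S t = y" if "a \<le> l" "l \<le> u" "u \<le> b" "S l \<le> y" "y \<le> S u" for y l u
    using IVT[of S l y u] that Sc by (auto simp: ab)
  have S\<psi>: "S (\<psi> y) = y" if "S a \<le> y" "y \<le> S b" for y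
    using ex[of a b y] that \<psi>S by (auto simp: ab)
  have Sa: "S a < 0" and Sb: "1 < S b" using mono[of a 0] mono[of 1 b] S0 S1 by (auto simp: ab)
  have rng: "\<psi> x \<in> {0..1}" if x: "x \<in> {0..1}" for x
  proof -
    obtain t where "t \<in> {0..1}" "S t = x" using ex[of 0 1 x] S0 S1 x by (auto simp: ab)
    then show ?thesis using \<psi>S[of t] by (auto simp: ab)
  qed
  show ?thesis
  proof
    show "\<psi> 0 = 0" using \<psi>S[of 0] S0 by (simp add: ab)
    show "\<psi> 1 = 1" using \<psi>S[of 1] S1 by (simp add: ab)
    show "\<psi> x \<in> {0..1}" if "x \<in> {0..1}" for x by (rule rng[OF that])
    show "(\<psi> has_real_derivative 1 / q (\<psi> x)) (at x)" if x: "x \<in> {0..1}" for x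
    proof -
      have z: "\<psi> x \<in> {0..1}" by (rule rng[OF x])
      have "isCont \<psi> (S (\<psi> x))"
        by (rule isCont_inverse_function2[of a _ b]) (use z \<psi>S Sc in \<open>auto simp: ab\<close>)
      then have "isCont \<psi> x" using S\<psi>[of x] x Sa Sb by simp
      then have "(\<psi> has_real_derivative inverse (Q (\<psi> x))) (at x)"
        using DERIV_inverse_function[of S "Q (\<psi> x)" \<psi> x "S a" "S b"] dS[of "\<psi> x"] z Qpos[of "\<psi> x"] x Sa Sb S\<psi>
        by fastforce
      then show ?thesis using Qq[OF z] by (simp add: inverse_eq_divide)
    qed
    fix t :: real assume t: "t \<in> {0..1}"
    show "(LINT s:{0..t}|lborel. q s) \<in> {0..1}"
      using Sint[OF t] mono[of 0 t] mono[of t 1] S0 S1 t by (cases "t = 0"; cases "t = 1") auto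
    show "\<psi> (LINT s:{0..t}|lborel. q s) = t"
      using \<psi>S[of t] Sint[OF t] t by (simp add: ab)
  qed
qed

lemma set_LINT_inner:
  fixes f :: "real \<Rightarrow> 'a::euclidean_space"
  assumes "set_integrable lborel A f"
  shows "(LINT x:A|lborel. f x \<bullet> b) = (LINT x:A|lborel. f x) \<bullet> b"
    "set_integrable lborel A (\<lambda>x. f x \<bullet> b)"
  using integral_inner_left[OF assms[unfolded set_integrable_def], of b]
    integrable_inner_left[OF assms[unfolded set_integrable_def], of b]
  by (simp_all add: set_lebesgue_integral_def set_integrable_def)

definition H1_path :: "(real \<Rightarrow> 'a::euclidean_space) \<Rightarrow> (real \<Rightarrow> 'a) \<Rightarrow> bool" where
  "H1_path \<theta> h \<longleftrightarrow> L2 lborel01 h \<and> (\<forall>t\<in>{0..1}. \<theta> t = \<theta> 0 + (LINT s:{0..t}|lborel. h s))"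

definition arclength_param :: "(real \<Rightarrow> 'a::euclidean_space) \<Rightarrow> real \<Rightarrow> real" where
  "arclength_param c t = (LINT s:{0..t}|lborel. norm (velocity c s)) / curve_length c"

lemma curve_length_pos:
  assumes "regular_curve c"
  shows "0 < curve_length c"
proof -
  obtain \<kappa> K where \<kappa>: "0 < \<kappa>" "\<And>t. t \<in> {0..1} \<Longrightarrow> \<kappa> \<le> norm (velocity c t)"
    using regular_curve_speed_bounds[OF assms] by metis
  have "integrable lborel01 (\<lambda>t. norm (velocity c t))"
    using assms by (intro continuous_integrable_lborel01 continuous_intros H2_velocity_continuous)
      (simp add: regular_curve_def)
  then have "(LINT t|lborel01. \<kappa>) \<le> (LINT t|lborel01. norm (velocity c t))"
    using \<kappa> finite_measure.integrable_const[OF finite_measure_lborel01] by (intro integral_mono) auto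
  then show ?thesis using \<kappa>(1) by (simp add: curve_length_def integral_lborel01[symmetric])
qed

text \<open>With \<open>\<psi>\<close> the inverse of the normalized arclength, \<open>\<theta> = sgn (velocity c) \<circ> \<psi>\<close>; its derivative is
  the length times the curvature vector at \<open>\<psi>\<close>, and both identities follow by substituting \<open>\<psi>\<close>.\<close>

lemma tangent_indicatrix_exists:
  fixes c :: "real \<Rightarrow> 'a::euclidean_space"
  assumes reg: "regular_curve c"
  obtains \<theta> h where "H1_path \<theta> h" "inner_L2 lborel01 h h = curve_length c * bending_energy c"
    "\<And>t. t \<in> {0..1} \<Longrightarrow> arclength_param c t \<in> {0..1}"
    "\<And>t. t \<in> {0..1} \<Longrightarrow> \<theta> (arclength_param c t) = sgn (velocity c t)"
    "\<And>x. x \<in> {0..1} \<Longrightarrow> norm (\<theta> x) = 1"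
    "\<theta> 0 = sgn (velocity c 0)" "\<theta> 1 = sgn (velocity c 1)"
    "c 1 - c 0 = curve_length c *\<^sub>R (LINT t:{0..1}|lborel. \<theta> t)"
proof -
  have H: "H2_curve c" using reg by (simp add: regular_curve_def)
  define l where "l = curve_length c"
  have l: "l > 0" unfolding l_def by (rule curve_length_pos[OF reg])
  define q where "q t = norm (velocity c t) / l" for t
  have qc: "continuous_on {0..1} q"
    unfolding q_def using l by (intro continuous_intros H2_velocity_continuous[OF H]) auto
  have qpos: "0 < q t" if "t \<in> {0..1}" for t
    using regular_curve_nonzero[OF reg that] l by (simp add: q_def)
  have ap: "arclength_param c t = (LINT s:{0..t}|lborel. q s)" for t
    by (simp add: arclength_param_def q_def l_def)
  have "(LINT s:{0..1}|lborel. q s) = 1"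
    using l by (simp add: q_def l_def curve_length_def)
  from inverse_arclength[OF qc qpos this] obtain \<psi> where \<psi>0: "\<psi> 0 = 0" and \<psi>1: "\<psi> 1 = 1"
    and rng: "\<And>x. x \<in> {0..1} \<Longrightarrow> \<psi> x \<in> {0..1}"
    and d\<psi>: "\<And>x. x \<in> {0..1} \<Longrightarrow> (\<psi> has_real_derivative 1 / q (\<psi> x)) (at x)"
    and sr: "\<And>t. t \<in> {0..1} \<Longrightarrow> (LINT s:{0..t}|lborel. q s) \<in> {0..1}"
    and \<psi>s: "\<And>t. t \<in> {0..1} \<Longrightarrow> \<psi> (LINT s:{0..t}|lborel. q s) = t" by blast
  have \<psi>c: "continuous_on {0..1} \<psi>"
    using d\<psi> by (intro continuous_at_imp_continuous_on ballI DERIV_isCont) blast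
  have q\<psi>c: "continuous_on {0..1} (\<lambda>x. 1 / q (\<psi> x))"
    using rng qpos by (intro continuous_intros continuous_on_compose2[OF qc \<psi>c]) (force+)
  define w where "w t = dsgn (velocity c t) (acceleration c t)" for t
  have wL: "L2 lborel01 w" unfolding w_def by (rule tangent_derivative_L2[OF reg])
  have wint: "integrable lborel01 w" by (rule L2_integrable[OF finite_measure_lborel01 wL])
  define \<theta> where "\<theta> x = sgn (velocity c (\<psi> x))" for x
  define h where "h x = (1 / q (\<psi> x)) *\<^sub>R w (\<psi> x)" for x
  have sub: "set_integrable lborel {0..\<sigma>} (\<lambda>x. f (\<psi> x) * (1 / q (\<psi> x)))"
      "(LINT x:{0..\<psi> \<sigma>}|lborel. f x) = (LINT x:{0..\<sigma>}|lborel. f (\<psi> x) * (1 / q (\<psi> x)))"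
    if \<sigma>: "\<sigma> \<in> {0..1}" and f: "integrable lborel01 f" for \<sigma> and f :: "real \<Rightarrow> real"
  proof -
    have i: "set_integrable lborel {\<psi> 0..\<psi> \<sigma>} f"
      using rng[OF \<sigma>] f by (intro integrable_lborel01_subinterval) (auto simp: \<psi>0)
    have d: "(\<psi> has_real_derivative 1 / q (\<psi> x)) (at x)" if "x \<in> {0..\<sigma>}" for x
      using that \<sigma> by (intro d\<psi>) auto
    have c: "continuous_on {0..\<sigma>} (\<lambda>x. 1 / q (\<psi> x))"
      by (rule continuous_on_subset[OF q\<psi>c]) (use \<sigma> in auto)
    have p: "0 \<le> 1 / q (\<psi> x)" if "x \<in> {0..\<sigma>}" for x
      using qpos[OF rng, of x] that \<sigma> by auto
    show "set_integrable lborel {0..\<sigma>} (\<lambda>x. f (\<psi> x) * (1 / q (\<psi> x)))"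
      using integral_substitution(1)[OF i d c p] \<sigma> by auto
    show "(LINT x:{0..\<psi> \<sigma>}|lborel. f x) = (LINT x:{0..\<sigma>}|lborel. f (\<psi> x) * (1 / q (\<psi> x)))"
      using integral_substitution(2)[OF i d c p] \<sigma> by (simp add: \<psi>0 set_lebesgue_integral_def mult.commute)
  qed
  have hb: "h x \<bullet> b = (w (\<psi> x) \<bullet> b) * (1 / q (\<psi> x))" for x b
    by (simp add: h_def)
  have wb: "integrable lborel01 (\<lambda>x. w x \<bullet> b)" for b using wint by simp
  have hm: "h \<in> borel_measurable lborel01"
  proof (rule borel_measurable_euclidean_space[THEN iffD2], intro ballI)
    fix b :: 'a
    have "integrable lborel01 (\<lambda>x. h x \<bullet> b)"
      using sub(1)[OF _ wb[of b], of 1] by (simp add: integrable_lborel01_iff hb)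
    then show "(\<lambda>x. h x \<bullet> b) \<in> borel_measurable lborel01" by (rule borel_measurable_integrable)
  qed
  define f2 where "f2 t = (1 / q t) * (norm (w t))\<^sup>2" for t
  have f2int: "integrable lborel01 f2"
  proof -
    have c: "continuous_on {0..1} (\<lambda>t. sqrt (1 / q t))"
      using qpos by (intro continuous_intros qc) force
    have "compact ((\<lambda>t. sqrt (1 / q t)) ` {0..1})"
      by (rule compact_continuous_image[OF c]) simp
    from bounded_pos[THEN iffD1, OF compact_imp_bounded[OF this]]
    obtain B where B': "\<forall>x \<in> (\<lambda>t. sqrt (1 / q t)) ` {0..1}. norm x \<le> B" by blast
    have B: "\<bar>sqrt (1 / q t)\<bar> \<le> B" if "t \<in> {0..1}" for t
      using bspec[OF B' imageI[OF that]] by simp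
    have "L2 lborel01 (\<lambda>t. sqrt (1 / q t) *\<^sub>R w t)"
      by (rule L2_mult_bounded[OF wL continuous_measurable_lborel01[OF c] B]) simp
    then have "integrable lborel01 (\<lambda>t. (norm (sqrt (1 / q t) *\<^sub>R w t))\<^sup>2)" by (simp add: L2_def)
    moreover have eq: "(norm (sqrt (1 / q t) *\<^sub>R w t))\<^sup>2 = f2 t" if "t \<in> space lborel01" for t
      using qpos[of t] that by (simp add: f2_def power_mult_distrib)
    ultimately show ?thesis
      by (subst (asm) Bochner_Integration.integrable_cong[OF refl eq])
  qed
  have h2: "(norm (h x))\<^sup>2 = f2 (\<psi> x) * (1 / q (\<psi> x))" for x
    by (simp add: h_def f2_def power_mult_distrib power2_eq_square)
  have hL: "L2 lborel01 h"
    using sub(1)[OF _ f2int, of 1] hm by (simp add: L2_def h2 integrable_lborel01_iff)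
  have "inner_L2 lborel01 h h = (LINT x:{0..1}|lborel. f2 (\<psi> x) * (1 / q (\<psi> x)))"
    by (simp add: inner_L2_self h2 integral_lborel01)
  also have "\<dots> = (LINT t:{0..1}|lborel. f2 t)"
    using sub(2)[OF _ f2int, of 1] by (simp add: \<psi>1)
  also have "\<dots> = (LINT t:{0..1}|lborel. l * ((norm (curvature c t))\<^sup>2 * norm (velocity c t)))"
  proof (rule set_lebesgue_integral_cong)
    show "\<forall>t. t \<in> {0..1} \<longrightarrow> f2 t = l * ((norm (curvature c t))\<^sup>2 * norm (velocity c t))"
    proof (intro allI impI)
      fix t :: real assume t: "t \<in> {0..1}"
      have "norm (w t) = norm (velocity c t) * norm (curvature c t)"
        unfolding w_def speed_curvature_eq_dsgn[symmetric] by simp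
      then show "f2 t = l * ((norm (curvature c t))\<^sup>2 * norm (velocity c t))"
        using regular_curve_nonzero[OF reg t] by (simp add: f2_def q_def power_mult_distrib power2_eq_square)
    qed
  qed simp
  also have "\<dots> = l * bending_energy c"
    unfolding bending_energy_def by (rule set_integral_mult_right)
  finally have energy: "inner_L2 lborel01 h h = l * bending_energy c" .
  have prim: "\<theta> \<sigma> = \<theta> 0 + (LINT s:{0..\<sigma>}|lborel. h s)" if \<sigma>: "\<sigma> \<in> {0..1}" for \<sigma>
  proof (rule euclidean_eqI)
    fix b :: 'a
    have si: "set_integrable lborel {0..\<sigma>} h" "set_integrable lborel {0..\<psi> \<sigma>} w"
      using \<sigma> rng[OF \<sigma>] L2_integrable[OF finite_measure_lborel01 hL] wint by (auto intro: integrable_lborel01_subinterval)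
    have "(LINT s:{0..\<sigma>}|lborel. h s) \<bullet> b = (LINT s:{0..\<sigma>}|lborel. h s \<bullet> b)"
      by (rule set_LINT_inner(1)[OF si(1), symmetric])
    also have "\<dots> = (LINT s:{0..\<psi> \<sigma>}|lborel. w s \<bullet> b)"
      unfolding hb by (rule sub(2)[OF \<sigma> wb, symmetric])
    also have "\<dots> = (LINT s:{0..\<psi> \<sigma>}|lborel. w s) \<bullet> b"
      by (rule set_LINT_inner(1)[OF si(2)])
    also have "(LINT s:{0..\<psi> \<sigma>}|lborel. w s) = \<theta> \<sigma> - \<theta> 0"
      using tangent_primitive[OF reg rng[OF \<sigma>]] by (simp add: \<theta>_def w_def \<psi>0)
    finally show "\<theta> \<sigma> \<bullet> b = (\<theta> 0 + (LINT s:{0..\<sigma>}|lborel. h s)) \<bullet> b"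
      by (simp add: inner_add_left inner_diff_left)
  qed
  have \<theta>c: "continuous_on {0..1} \<theta>"
    unfolding \<theta>_def using rng by (intro continuous_on_compose2[OF tangent_continuous[OF reg] \<psi>c]) auto
  have chord: "c 1 - c 0 = l *\<^sub>R (LINT t:{0..1}|lborel. \<theta> t)"
  proof -
    have "((\<lambda>x. l *\<^sub>R \<theta> x) has_integral (c \<circ> \<psi>) 1 - (c \<circ> \<psi>) 0) {0..1}"
    proof (rule fundamental_theorem_of_calculus)
      fix x :: real assume x: "x \<in> {0..1}"
      have "(\<psi> has_vector_derivative 1 / q (\<psi> x)) (at x within {0..1})"
        using d\<psi>[OF x] by (auto simp: has_real_derivative_iff_has_vector_derivative intro: has_vector_derivative_at_within)
      moreover have "(c has_vector_derivative velocity c (\<psi> x)) (at (\<psi> x) within \<psi> ` {0..1})"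
        using H2_curveD(1)[OF H rng[OF x]] rng by (intro has_vector_derivative_within_subset[OF H2_curveD(1)[OF H rng[OF x]]]) auto
      ultimately have "((c \<circ> \<psi>) has_vector_derivative (1 / q (\<psi> x)) *\<^sub>R velocity c (\<psi> x)) (at x within {0..1})"
        by (rule vector_diff_chain_within)
      moreover have "(1 / q (\<psi> x)) *\<^sub>R velocity c (\<psi> x) = l *\<^sub>R \<theta> x"
        by (simp add: q_def \<theta>_def sgn_div_norm field_simps)
      ultimately show "((c \<circ> \<psi>) has_vector_derivative l *\<^sub>R \<theta> x) (at x within {0..1})" by simp
    qed simp
    from integral_unique[OF this] have "c 1 - c 0 = integral {0..1} (\<lambda>x. l *\<^sub>R \<theta> x)"
      by (simp only: o_def \<psi>0 \<psi>1)
    also have "\<dots> = l *\<^sub>R integral {0..1} \<theta>" by simp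
    also have "integral {0..1} \<theta> = (LINT t:{0..1}|lborel. \<theta> t)"
      by (rule set_LINT_eq_integral(1)[OF continuous_integrable_lborel01[OF \<theta>c], symmetric]) simp_all
    finally show ?thesis .
  qed
  show ?thesis
  proof (rule that[of \<theta> h])
    show "H1_path \<theta> h" using hL prim unfolding H1_path_def by blast
    show "inner_L2 lborel01 h h = curve_length c * bending_energy c" using energy by (simp add: l_def)
    show "arclength_param c t \<in> {0..1}" if "t \<in> {0..1}" for t using sr[OF that] by (simp add: ap)
    show "\<theta> (arclength_param c t) = sgn (velocity c t)" if "t \<in> {0..1}" for t
      using \<psi>s[OF that] by (simp add: ap \<theta>_def)
    show "norm (\<theta> x) = 1" if "x \<in> {0..1}" for x
      using regular_curve_nonzero[OF reg rng[OF that]] by (simp add: \<theta>_def norm_sgn)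
    show "\<theta> 0 = sgn (velocity c 0)" "\<theta> 1 = sgn (velocity c 1)" by (simp_all add: \<theta>_def \<psi>0 \<psi>1)
    show "c 1 - c 0 = curve_length c *\<^sub>R (LINT t:{0..1}|lborel. \<theta> t)" using chord by (simp add: l_def)
  qed
qed

lemma H1_path_Hoelder:
  assumes "H1_path \<theta> h" "s \<in> {0..1}" "t \<in> {0..1}"
  shows "norm (\<theta> t - \<theta> s) \<le> sqrt \<bar>t - s\<bar> * norm_L2 lborel01 h"
proof -
  have L: "L2 lborel01 h" using assms(1) by (simp add: H1_path_def)
  have *: "norm (\<theta> t - \<theta> s) \<le> sqrt (t - s) * norm_L2 lborel01 h"
    if "s \<in> {0..1}" "t \<in> {0..1}" "s \<le> t" for s t
  proof -
    have "\<theta> s = \<theta> 0 + (LINT s:{0..s}|lborel. h s)" "\<theta> t = \<theta> 0 + (LINT s:{0..t}|lborel. h s)"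
      using assms(1) that unfolding H1_path_def by blast+
    then have "\<theta> t - \<theta> s = (LINT s:{s..t}|lborel. h s)"
      using set_LINT_combine[OF L2_integrable[OF finite_measure_lborel01 L], of s t] that by simp
    then show ?thesis using norm_set_LINT_le[OF L, of s t] that by simp
  qed
  show ?thesis
    using *[of s t] *[of t s] assms by (cases "s \<le> t") (auto simp: norm_minus_commute)
qed

lemma H1_path_continuous:
  assumes "H1_path \<theta> h"
  shows "continuous_on {0..1} \<theta>"
proof -
  have "continuous_on {0..1} (\<lambda>t. \<theta> 0 + (LINT s:{0..t}|lborel. h s))"
    using assms unfolding H1_path_def by (intro continuous_intros primitive_continuous L2_integrable[OF finite_measure_lborel01]) blast
  then show ?thesis
    by (rule continuous_on_eq) (use assms in \<open>metis H1_path_def\<close>)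
qed

lemma H1_path_unique:
  assumes "H1_path \<theta> h" "H1_path \<theta>' h'" "\<And>t. t \<in> {0..1} \<Longrightarrow> \<theta> t = \<theta>' t"
  shows "AE t in lborel01. h t = h' t"
proof (rule density_unique_unit)
  show "integrable lborel01 h" "integrable lborel01 h'"
    using assms(1,2) L2_integrable[OF finite_measure_lborel01] unfolding H1_path_def by blast+
  fix t :: real assume t: "t \<in> {0..1}"
  then have "\<theta> t = \<theta> 0 + (LINT s:{0..t}|lborel. h s)" "\<theta>' t = \<theta>' 0 + (LINT s:{0..t}|lborel. h' s)"
    using assms(1,2) unfolding H1_path_def by blast+
  then show "(LINT s:{0..t}|lborel. h s) = (LINT s:{0..t}|lborel. h' s)"
    using assms(3)[OF t] assms(3)[of 0] by simp
qed

text \<open>The derivatives \<open>h n\<close> satisfy the convex constraint that their primitive is within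
  \<open>1 / n\<close> of \<open>\<theta>'\<close>, up to a constant; selecting almost shortest functions under these constraints gives
  the derivative of \<open>\<theta>'\<close> together with its bound.\<close>

lemma H1_path_limit:
  fixes \<theta> :: "nat \<Rightarrow> real \<Rightarrow> 'a::euclidean_space"
  assumes p: "\<And>n. H1_path (\<theta> n) (h n)" and bd: "\<And>n. inner_L2 lborel01 (h n) (h n) \<le> C"
    and lim: "uniform_limit {0..1} \<theta> \<theta>' sequentially"
  obtains h' where "H1_path \<theta>' h'" "inner_L2 lborel01 h' h' \<le> C"
proof -
  define K where "K n = {g. L2 lborel01 g \<and> (\<forall>t\<in>{0..1}. norm (\<theta>' 0 + (LINT s:{0..t}|lborel. g s) - \<theta>' t) \<le> 1 / real (Suc n))}" for n
  have Lh: "L2 lborel01 (h n)" for n using p[of n] by (simp add: H1_path_def)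
  obtain y z where y: "\<And>n. y n \<in> K n" and z: "L2 lborel01 z" "(\<lambda>n. norm_L2 lborel01 (\<lambda>x. y n x - z x)) \<longlonglongrightarrow> 0" "inner_L2 lborel01 z z \<le> C"
  proof (rule nested_convex_selection[OF finite_measure_lborel01, of K C])
    show "K n \<subseteq> K m" if "m \<le> n" for m n
    proof
      fix g assume g: "g \<in> K n"
      have "1 / real (Suc n) \<le> 1 / real (Suc m)" using that by (intro frac_le) auto
      then show "g \<in> K m" using g unfolding K_def by (blast intro: order_trans)
    qed
    show "L2 lborel01 x" if "x \<in> K n" for n x using that by (simp add: K_def)
    show "(\<lambda>t. (1/2) *\<^sub>R x t + (1/2) *\<^sub>R y t) \<in> K n" if x: "x \<in> K n" and y: "y \<in> K n" for n x y
    proof -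
      have L: "L2 lborel01 x" "L2 lborel01 y" using x y by (auto simp: K_def)
      have "norm (\<theta>' 0 + (LINT s:{0..t}|lborel. (1/2) *\<^sub>R x s + (1/2) *\<^sub>R y s) - \<theta>' t) \<le> 1 / real (Suc n)"
        if t: "t \<in> {0..1}" for t
      proof -
        have si: "set_integrable lborel {0..t} x" "set_integrable lborel {0..t} y"
          using t L L2_integrable[OF finite_measure_lborel01] by (auto intro: integrable_lborel01_subinterval)
        define X where "X = (LINT s:{0..t}|lborel. x s)"
        define Y where "Y = (LINT s:{0..t}|lborel. y s)"
        have "(LINT s:{0..t}|lborel. (1/2) *\<^sub>R x s + (1/2) *\<^sub>R y s) = (1/2) *\<^sub>R X + (1/2) *\<^sub>R Y"
          using si unfolding X_def Y_def by (subst set_integral_add) (auto)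
        then have "\<theta>' 0 + (LINT s:{0..t}|lborel. (1/2) *\<^sub>R x s + (1/2) *\<^sub>R y s) - \<theta>' t
            = (1/2) *\<^sub>R (\<theta>' 0 + X - \<theta>' t) + (1/2) *\<^sub>R (\<theta>' 0 + Y - \<theta>' t)"
          by (simp add: algebra_simps) (simp flip: scaleR_left_distrib add: add.assoc[symmetric])
        also have "norm \<dots> \<le> (1/2) * norm (\<theta>' 0 + X - \<theta>' t) + (1/2) * norm (\<theta>' 0 + Y - \<theta>' t)"
          using norm_triangle_ineq[of "(1/2) *\<^sub>R (\<theta>' 0 + X - \<theta>' t)" "(1/2) *\<^sub>R (\<theta>' 0 + Y - \<theta>' t)"] by simp
        also have "\<dots> \<le> (1/2) * (1 / real (Suc n)) + (1/2) * (1 / real (Suc n))"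
          using x y t unfolding K_def X_def Y_def by (intro add_mono mult_left_mono) auto
        also have "\<dots> = 1 / real (Suc n)" by (simp add: field_simps)
        finally show ?thesis by simp
      qed
      then show ?thesis using L2_lincomb[OF L, of "1/2" "1/2"] by (simp add: K_def)
    qed
    show "\<exists>x\<in>K n. inner_L2 lborel01 x x \<le> C" for n
    proof -
      have "0 < 1 / (2 * real (Suc n))" by simp
      from uniform_limitD[OF lim this] obtain m where m: "\<And>t. t \<in> {0..1} \<Longrightarrow> dist (\<theta> m t) (\<theta>' t) < 1 / (2 * real (Suc n))"
        unfolding eventually_sequentially by blast
      have "norm (\<theta>' 0 + (LINT s:{0..t}|lborel. h m s) - \<theta>' t) \<le> 1 / real (Suc n)" if t: "t \<in> {0..1}" for t
      proof -
        have "\<theta> m t = \<theta> m 0 + (LINT s:{0..t}|lborel. h m s)" using p[of m] t unfolding H1_path_def by blast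
        then have eq: "\<theta>' 0 + (LINT s:{0..t}|lborel. h m s) - \<theta>' t = (\<theta> m t - \<theta>' t) - (\<theta> m 0 - \<theta>' 0)" by simp
        have "norm (\<theta>' 0 + (LINT s:{0..t}|lborel. h m s) - \<theta>' t) \<le> norm (\<theta> m t - \<theta>' t) + norm (\<theta> m 0 - \<theta>' 0)"
          unfolding eq by (rule norm_triangle_ineq4)
        also have "\<dots> \<le> 1 / (2 * real (Suc n)) + 1 / (2 * real (Suc n))"
          using m[OF t] m[of 0] by (simp add: dist_norm)
        finally show ?thesis by (simp add: field_simps)
      qed
      then show ?thesis using Lh bd by (intro bexI[of _ "h m"]) (auto simp: K_def)
    qed
  qed blast
  have "\<theta>' t = \<theta>' 0 + (LINT s:{0..t}|lborel. z s)" if t: "t \<in> {0..1}" for t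
  proof -
    let ?E = "\<lambda>n. 1 / real (Suc n) + norm_L2 lborel01 (\<lambda>x. y n x - z x)"
    have "norm (\<theta>' 0 + (LINT s:{0..t}|lborel. z s) - \<theta>' t) \<le> 0"
    proof (rule LIMSEQ_le_const)
      have "?E \<longlonglongrightarrow> 0 + 0" by (intro tendsto_intros z(2) LIMSEQ_Suc[OF lim_1_over_n])
      then show "?E \<longlonglongrightarrow> 0" by simp
      show "\<exists>N. \<forall>n\<ge>N. norm (\<theta>' 0 + (LINT s:{0..t}|lborel. z s) - \<theta>' t) \<le> ?E n"
      proof (intro exI allI impI)
        fix n
        have Ly: "L2 lborel01 (y n)" using y[of n] by (simp add: K_def)
        have si: "set_integrable lborel {0..t} (y n)" "set_integrable lborel {0..t} z"
          using t Ly z(1) L2_integrable[OF finite_measure_lborel01] by (auto intro: integrable_lborel01_subinterval)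
        have "(LINT s:{0..t}|lborel. y n s - z s) = (LINT s:{0..t}|lborel. y n s) - (LINT s:{0..t}|lborel. z s)"
          by (rule set_integral_diff(2)[OF si])
        then have eq: "\<theta>' 0 + (LINT s:{0..t}|lborel. z s) - \<theta>' t
            = (\<theta>' 0 + (LINT s:{0..t}|lborel. y n s) - \<theta>' t) - (LINT s:{0..t}|lborel. y n s - z s)" by simp
        have "norm (\<theta>' 0 + (LINT s:{0..t}|lborel. z s) - \<theta>' t)
            \<le> norm (\<theta>' 0 + (LINT s:{0..t}|lborel. y n s) - \<theta>' t) + norm (LINT s:{0..t}|lborel. y n s - z s)"
          unfolding eq by (rule norm_triangle_ineq4)
        moreover have "norm (LINT s:{0..t}|lborel. y n s - z s) \<le> sqrt (t - 0) * norm_L2 lborel01 (\<lambda>s. y n s - z s)"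
          using t by (intro norm_set_LINT_le L2_diff Ly z(1)) auto
        moreover have "\<dots> \<le> 1 * norm_L2 lborel01 (\<lambda>s. y n s - z s)"
          using t by (intro mult_right_mono) auto
        moreover have "norm (\<theta>' 0 + (LINT s:{0..t}|lborel. y n s) - \<theta>' t) \<le> 1 / real (Suc n)"
          using y[of n] t unfolding K_def by blast
        ultimately show "norm (\<theta>' 0 + (LINT s:{0..t}|lborel. z s) - \<theta>' t) \<le> ?E n"
          by linarith
      qed
    qed
    then show ?thesis by (simp add: algebra_simps)
  qed
  then have "H1_path \<theta>' z" using z(1) unfolding H1_path_def by blast
  with z(3) that show ?thesis by blast
qed

section \<open>Weak convergence in H2\<close>

text \<open>The inner product of H2 is the inner product in L2 of the jets, so H2 becomes a subspace of an
  L2 space of functions with values in a triple product.\<close>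

definition jet :: "(real \<Rightarrow> 'a::euclidean_space) \<Rightarrow> real \<Rightarrow> 'a \<times> 'a \<times> 'a" where
  "jet c t = (c t, velocity c t, acceleration c t)"

lemma norm_triple_power2:
  fixes x :: "'a::euclidean_space \<times> 'b::euclidean_space \<times> 'c::euclidean_space"
  shows "(norm x)\<^sup>2 = (norm (fst x))\<^sup>2 + (norm (fst (snd x)))\<^sup>2 + (norm (snd (snd x)))\<^sup>2"
  by (cases x) (simp add: norm_Pair)

lemma L2_jet:
  assumes "H2_curve c"
  shows "L2 lborel01 (jet c)"
proof -
  have L: "L2 lborel01 c" "L2 lborel01 (velocity c)" "L2 lborel01 (acceleration c)"
    using assms by (auto intro: continuous_L2 H2_continuous H2_velocity_continuous H2_curveD)
  then have "jet c \<in> borel_measurable lborel01"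
    unfolding jet_def by (intro borel_measurable_Pair) (auto simp: L2_def)
  moreover have "integrable lborel01 (\<lambda>t. (norm (jet c t))\<^sup>2)"
    using L by (simp add: norm_triple_power2 jet_def L2_def)
  ultimately show ?thesis by (simp add: L2_def)
qed

lemma H2_inner_eq_ip:
  fixes c e :: "real \<Rightarrow> 'a::euclidean_space"
  shows "H2_inner c e = inner_L2 lborel01 (jet c) (jet e)"
  by (simp add: H2_inner_def inner_L2_def jet_def integral_lborel01 add.assoc)

lemma H2_lincomb:
  fixes c e :: "real \<Rightarrow> 'a::euclidean_space"
  assumes c: "H2_curve c" and e: "H2_curve e"
  shows "H2_curve (\<lambda>t. a *\<^sub>R c t + b *\<^sub>R e t)"
    "\<And>t. t \<in> {0..1} \<Longrightarrow> velocity (\<lambda>t. a *\<^sub>R c t + b *\<^sub>R e t) t = a *\<^sub>R velocity c t + b *\<^sub>R velocity e t"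
    "AE t in lborel01. jet (\<lambda>t. a *\<^sub>R c t + b *\<^sub>R e t) t = a *\<^sub>R jet c t + b *\<^sub>R jet e t"
proof -
  let ?g = "\<lambda>t. a *\<^sub>R c t + b *\<^sub>R e t"
  have d: "(?g has_vector_derivative a *\<^sub>R velocity c t + b *\<^sub>R velocity e t) (at t within {0..1})" if "t \<in> {0..1}" for t
    using H2_curveD(1)[OF c that] H2_curveD(1)[OF e that] by (auto intro!: derivative_eq_intros)
  have L: "L2 lborel01 (\<lambda>t. a *\<^sub>R acceleration c t + b *\<^sub>R acceleration e t)"
    by (intro L2_lincomb H2_curveD c e)
  have v: "a *\<^sub>R velocity c t + b *\<^sub>R velocity e t = a *\<^sub>R velocity c 0 + b *\<^sub>R velocity e 0
      + (LINT s:{0..t}|lborel. a *\<^sub>R acceleration c s + b *\<^sub>R acceleration e s)" if t: "t \<in> {0..1}" for t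
  proof -
    have si: "set_integrable lborel {0..t} (acceleration c)" "set_integrable lborel {0..t} (acceleration e)"
      using t c e H2_curveD(2) L2_integrable[OF finite_measure_lborel01] by (auto intro!: integrable_lborel01_subinterval)
    then have "(LINT s:{0..t}|lborel. a *\<^sub>R acceleration c s + b *\<^sub>R acceleration e s)
        = a *\<^sub>R (LINT s:{0..t}|lborel. acceleration c s) + b *\<^sub>R (LINT s:{0..t}|lborel. acceleration e s)"
      by (subst set_integral_add) auto
    then show ?thesis
      using H2_curveD(3)[OF c t] H2_curveD(3)[OF e t] by (simp add: scaleR_add_right)
  qed
  note I = H2_curveI[OF d L v]
  show "H2_curve ?g" by (rule I(1))
  show V: "velocity ?g t = a *\<^sub>R velocity c t + b *\<^sub>R velocity e t" if "t \<in> {0..1}" for t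
    by (rule I(2)) (use that in simp_all)
  have "AE t in lborel01. t \<in> {0..1}" using AE_space[of lborel01] by simp
  moreover have "AE t in lborel01. acceleration ?g t = a *\<^sub>R acceleration c t + b *\<^sub>R acceleration e t"
    by (rule I(3))
  ultimately show "AE t in lborel01. jet ?g t = a *\<^sub>R jet c t + b *\<^sub>R jet e t"
  proof eventually_elim
    case (elim t)
    then show ?case using V[of t] by (simp add: jet_def)
  qed
qed

lemma inner_L2_cong_AE:
  assumes "L2 M x" "L2 M y" "L2 M z" "AE t in M. x t = y t"
  shows "inner_L2 M x z = inner_L2 M y z"
  unfolding inner_L2_def
proof (rule integral_cong_AE)
  show "(\<lambda>t. x t \<bullet> z t) \<in> borel_measurable M" "(\<lambda>t. y t \<bullet> z t) \<in> borel_measurable M"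
    using assms by (auto simp: L2_def)
  show "AE t in M. x t \<bullet> z t = y t \<bullet> z t" using assms(4) by eventually_elim simp
qed

lemma inner_L2_self_cong_AE:
  assumes "L2 M x" "L2 M y" "AE t in M. x t = y t"
  shows "inner_L2 M x x = inner_L2 M y y"
  using inner_L2_cong_AE[OF assms(1,2,1,3)] inner_L2_cong_AE[OF assms(1,2,2,3)] by (simp add: inner_L2_commute)

lemma norm_L2_mono:
  assumes "L2 M f" "L2 M g" "\<And>x. x \<in> space M \<Longrightarrow> norm (f x) \<le> norm (g x)"
  shows "norm_L2 M f \<le> norm_L2 M g"
  unfolding norm_L2_def inner_L2_self
  using assms by (intro real_sqrt_le_mono integral_mono) (auto simp: L2_def intro: power_mono)

lemma norm_L2_bounded_le:
  fixes f :: "real \<Rightarrow> 'a::euclidean_space"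
  assumes "L2 lborel01 f" "\<And>x. x \<in> {0..1} \<Longrightarrow> norm (f x) \<le> B"
  shows "norm_L2 lborel01 f \<le> B"
proof -
  have B: "0 \<le> B" by (rule order_trans[OF norm_ge_zero assms(2)[of 0]]) simp
  have c: "L2 lborel01 (\<lambda>x. B)" by (rule L2_bounded[OF finite_measure_lborel01, where B=B]) (use B in auto)
  have "norm_L2 lborel01 f \<le> norm_L2 lborel01 (\<lambda>x. B)"
    using assms B by (intro norm_L2_mono c) auto
  also have "norm_L2 lborel01 (\<lambda>x. B) = B" using B by (simp add: norm_L2_def inner_L2_def real_sqrt_mult_self)
  finally show ?thesis .
qed

lemma L2_zero_AE:
  assumes "L2 M f" "norm_L2 M f = 0"
  shows "AE t in M. f t = 0"
proof -
  have "(LINT x|M. (norm (f x))\<^sup>2) = 0" using assms(2) by (simp add: norm_L2_def inner_L2_self)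
  then have "AE t in M. (norm (f t))\<^sup>2 = 0"
    using assms(1) by (subst (asm) integral_nonneg_eq_0_iff_AE) (auto simp: L2_def)
  then show ?thesis by eventually_elim simp
qed

lemma L2_limit_unique_AE:
  assumes "\<And>n. L2 M (x n)" "L2 M y" "L2 M z"
    and "(\<lambda>n. norm_L2 M (\<lambda>t. x n t - y t)) \<longlonglongrightarrow> 0" "(\<lambda>n. norm_L2 M (\<lambda>t. x n t - z t)) \<longlonglongrightarrow> 0"
  shows "AE t in M. y t = z t"
proof -
  have "norm_L2 M (\<lambda>t. y t - z t) \<le> 0"
  proof (rule LIMSEQ_le_const)
    show "(\<lambda>n. norm_L2 M (\<lambda>t. x n t - y t) + norm_L2 M (\<lambda>t. x n t - z t)) \<longlonglongrightarrow> 0"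
      using tendsto_add[OF assms(4,5)] by simp
    show "\<exists>N. \<forall>n\<ge>N. norm_L2 M (\<lambda>t. y t - z t) \<le> norm_L2 M (\<lambda>t. x n t - y t) + norm_L2 M (\<lambda>t. x n t - z t)"
      using norm_L2_triangle[OF assms(2,1,3)] by (auto simp: norm_L2_minus[of M y])
  qed
  then have "norm_L2 M (\<lambda>t. y t - z t) = 0" using norm_L2_nonneg[of M "\<lambda>t. y t - z t"] by linarith
  from L2_zero_AE[OF L2_diff[OF assms(2,3)] this] show ?thesis by simp
qed

text \<open>Compare \<open>\<theta> t\<close> with \<open>\<theta> s\<close> by Hoelder continuity and average over \<open>s\<close>.\<close>

lemma H1_path_sup_le:
  fixes \<theta> :: "real \<Rightarrow> 'a::euclidean_space"
  assumes p: "H1_path \<theta> h" and t: "t \<in> {0..1}"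
  shows "norm (\<theta> t) \<le> norm_L2 lborel01 \<theta> + norm_L2 lborel01 h"
proof -
  have L: "L2 lborel01 \<theta>" by (rule continuous_L2[OF H1_path_continuous[OF p]])
  have n: "integrable lborel01 (\<lambda>s. norm (\<theta> s))" using L2_integrable[OF finite_measure_lborel01 L] by simp
  have "norm (\<theta> t) \<le> norm (\<theta> s) + norm_L2 lborel01 h" if s: "s \<in> {0..1}" for s
  proof -
    have "norm (\<theta> t - \<theta> s) \<le> sqrt \<bar>t - s\<bar> * norm_L2 lborel01 h" by (rule H1_path_Hoelder[OF p s t])
    also have "\<dots> \<le> 1 * norm_L2 lborel01 h" using s t by (intro mult_right_mono) auto
    finally show ?thesis using norm_triangle_sub[of "\<theta> t" "\<theta> s"] by simp
  qed
  then have "(LINT s|lborel01. norm (\<theta> t)) \<le> (LINT s|lborel01. norm (\<theta> s) + norm_L2 lborel01 h)"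
    using n finite_measure.integrable_const[OF finite_measure_lborel01] by (intro integral_mono) auto
  also have "\<dots> = (LINT s|lborel01. norm (\<theta> s)) + norm_L2 lborel01 h"
    by (subst Bochner_Integration.integral_add[OF n finite_measure.integrable_const[OF finite_measure_lborel01]]) simp
  also have "\<dots> \<le> norm_L2 lborel01 \<theta> + norm_L2 lborel01 h" using integral_norm_le_norm_L2[OF finite_measure_lborel01 L] by simp
  finally show ?thesis by simp
qed

lemma velocity_H1_path:
  assumes "H2_curve c"
  shows "H1_path (velocity c) (acceleration c)"
  using H2_curveD(2,3)[OF assms] unfolding H1_path_def by blast

lemma curve_H1_path:
  assumes "H2_curve c"
  shows "H1_path c (velocity c)"
proof -
  have "c t = c 0 + (LINT s:{0..t}|lborel. velocity c s)" if t: "t \<in> {0..1}" for t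
  proof -
    have "(velocity c has_integral c t - c 0) {0..t}"
    proof (rule fundamental_theorem_of_calculus)
      fix x assume "x \<in> {0..t}"
      then show "(c has_vector_derivative velocity c x) (at x within {0..t})"
        using t by (intro has_vector_derivative_within_subset[OF H2_curveD(1)[OF assms]]) auto
    qed (use t in auto)
    then show ?thesis
      using t set_LINT_eq_integral(1)[OF continuous_integrable_lborel01[OF H2_velocity_continuous[OF assms]], of 0 t]
      by (simp add: integral_unique)
  qed
  then show ?thesis
    using continuous_L2[OF H2_velocity_continuous[OF assms]] unfolding H1_path_def by blast
qed

lemma norm_triple_components:
  fixes x :: "'a::real_normed_vector \<times> 'b::real_normed_vector \<times> 'c::real_normed_vector"
  shows "norm (fst x) \<le> norm x" "norm (fst (snd x)) \<le> norm x" "norm (snd (snd x)) \<le> norm x"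
  using norm_fst_le[of "fst x" "snd x"] norm_fst_le[of "fst (snd x)" "snd (snd x)"]
    norm_snd_le[of "snd (snd x)" "fst (snd x)"] norm_snd_le[of "snd x" "fst x"] by auto

lemma norm_L2_jet_components:
  assumes "H2_curve c"
  shows "norm_L2 lborel01 c \<le> norm_L2 lborel01 (jet c)" "norm_L2 lborel01 (velocity c) \<le> norm_L2 lborel01 (jet c)" "norm_L2 lborel01 (acceleration c) \<le> norm_L2 lborel01 (jet c)"
proof -
  have n: "norm (c t) \<le> norm (jet c t)" "norm (velocity c t) \<le> norm (jet c t)"
    "norm (acceleration c t) \<le> norm (jet c t)" for t
    using norm_triple_components[of "jet c t"] by (simp_all add: jet_def)
  show "norm_L2 lborel01 c \<le> norm_L2 lborel01 (jet c)"
    by (rule norm_L2_mono[OF continuous_L2[OF H2_continuous[OF assms]] L2_jet[OF assms] n(1)])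
  show "norm_L2 lborel01 (velocity c) \<le> norm_L2 lborel01 (jet c)"
    by (rule norm_L2_mono[OF continuous_L2[OF H2_velocity_continuous[OF assms]] L2_jet[OF assms] n(2)])
  show "norm_L2 lborel01 (acceleration c) \<le> norm_L2 lborel01 (jet c)"
    by (rule norm_L2_mono[OF H2_curveD(2)[OF assms] L2_jet[OF assms] n(3)])
qed

lemma velocity_sup_le:
  assumes "H2_curve c" "t \<in> {0..1}"
  shows "norm (velocity c t) \<le> 2 * norm_L2 lborel01 (jet c)"
  using H1_path_sup_le[OF velocity_H1_path[OF assms(1)] assms(2)] norm_L2_jet_components[OF assms(1)] by linarith

lemma curve_sup_le:
  assumes "H2_curve c" "t \<in> {0..1}"
  shows "norm (c t) \<le> 2 * norm_L2 lborel01 (jet c)"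
  using H1_path_sup_le[OF curve_H1_path[OF assms(1)] assms(2)] norm_L2_jet_components[OF assms(1)] by linarith

text \<open>Completeness of H2: the limit curve is built by integrating the limit of the accelerations
  twice, with the limits of the initial values.\<close>

lemma jets_closed:
  fixes e :: "nat \<Rightarrow> real \<Rightarrow> 'a::euclidean_space" and z :: "real \<Rightarrow> 'a \<times> 'a \<times> 'a"
  assumes e: "\<And>n. H2_curve (e n)" and z: "L2 lborel01 z"
    and lim: "(\<lambda>n. norm_L2 lborel01 (\<lambda>t. jet (e n) t - z t)) \<longlonglongrightarrow> 0"
  obtains c where "H2_curve c" "AE t in lborel01. z t = jet c t"
proof -
  note J = L2_jet[OF e]
  have diffs: "norm_L2 lborel01 (jet (\<lambda>t. e m t - e n t)) = norm_L2 lborel01 (\<lambda>t. jet (e m) t - jet (e n) t)" for m n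
  proof -
    have "AE t in lborel01. jet (\<lambda>t. e m t - e n t) t = jet (e m) t - jet (e n) t"
      using H2_lincomb(3)[OF e[of m] e[of n], of 1 "-1"] by simp
    moreover have "H2_curve (\<lambda>t. e m t - e n t)"
      using H2_lincomb(1)[OF e[of m] e[of n], of 1 "-1"] by simp
    ultimately show ?thesis
      unfolding norm_L2_def by (intro arg_cong[of _ _ sqrt] inner_L2_self_cong_AE L2_jet L2_diff e)
  qed
  have cau: "\<exists>N. \<forall>m\<ge>N. \<forall>n\<ge>N. 2 * norm_L2 lborel01 (jet (\<lambda>t. e m t - e n t)) < r" if r: "r > 0" for r
  proof -
    obtain N where N: "\<And>n. n \<ge> N \<Longrightarrow> norm_L2 lborel01 (\<lambda>t. jet (e n) t - z t) < r / 4"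
      using order_tendstoD(2)[OF lim, of "r/4"] r by (auto simp: eventually_sequentially)
    have "2 * norm_L2 lborel01 (jet (\<lambda>t. e m t - e n t)) < r" if "m \<ge> N" "n \<ge> N" for m n
      using norm_L2_triangle[OF J[of m] z J[of n]] N[OF that(1)] N[OF that(2)] norm_L2_minus[of lborel01 z "jet (e n)"]
      unfolding diffs by linarith
    then show ?thesis by blast
  qed
  have H: "H2_curve (\<lambda>t. e m t - e n t)" for m n
    using H2_lincomb(1)[OF e[of m] e[of n], of 1 "-1"] by simp
  have vel: "velocity (\<lambda>t. e m t - e n t) 0 = velocity (e m) 0 - velocity (e n) 0" for m n
    using H2_lincomb(2)[OF e[of m] e[of n], of 0 1 "-1"] by simp
  have C0: "norm (e m 0 - e n 0) \<le> 2 * norm_L2 lborel01 (jet (\<lambda>t. e m t - e n t))" for m n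
    using curve_sup_le[OF H, of 0 m n] by simp
  have V0: "norm (velocity (e m) 0 - velocity (e n) 0) \<le> 2 * norm_L2 lborel01 (jet (\<lambda>t. e m t - e n t))" for m n
    using velocity_sup_le[OF H, of 0 m n] by (simp add: vel)
  have "Cauchy (\<lambda>n. e n 0)" "Cauchy (\<lambda>n. velocity (e n) 0)"
    unfolding Cauchy_def dist_norm using cau C0 V0 by (meson order_le_less_trans)+
  then obtain c0 v0 where c0: "(\<lambda>n. e n 0) \<longlonglongrightarrow> c0" and v0: "(\<lambda>n. velocity (e n) 0) \<longlonglongrightarrow> v0"
    using Cauchy_convergent convergent_def by metis
  define h where "h t = snd (snd (z t))" for t
  have hL: "L2 lborel01 h"
  proof (rule L2_dominated[OF z])
    have "continuous_on UNIV (\<lambda>x :: 'a \<times> 'a \<times> 'a. snd (snd x))" by (intro continuous_intros)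
    from borel_measurable_continuous_on[OF this L2_measurable[OF z]]
    show "h \<in> borel_measurable lborel01" by (simp add: h_def[abs_def])
    show "norm (h t) \<le> 1 * norm (z t)" for t
      using norm_snd_le[of "snd (z t)" "fst (z t)"] norm_snd_le[of "snd (snd (z t))" "fst (snd (z t))"] by (simp add: h_def)
  qed
  have hint: "integrable lborel01 h" by (rule L2_integrable[OF finite_measure_lborel01 hL])
  define v where "v t = v0 + (LINT s:{0..t}|lborel. h s)" for t
  have v00: "v 0 = v0" by (simp add: v_def set_LINT_singleton)
  have vc: "continuous_on {0..1} v"
    unfolding v_def by (intro continuous_intros primitive_continuous hint)
  define c where "c t = c0 + integral {0..t} v" for t
  have d: "(c has_vector_derivative v t) (at t within {0..1})" if "t \<in> {0..1}" for t
    unfolding c_def using integral_has_vector_derivative[OF vc that] by (auto intro!: derivative_eq_intros)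
  have vv: "v t = v 0 + (LINT s:{0..t}|lborel. h s)" if "t \<in> {0..1}" for t
    by (simp only: v00) (simp add: v_def)
  have I1: "H2_curve c" by (rule H2_curveI(1)[OF d hL vv])
  have I2: "velocity c t = v t" if "t \<in> {0..1}" for t
    by (rule H2_curveI(2)[OF d hL vv]) (use that in simp_all)
  have I3: "AE t in lborel01. acceleration c t = h t" by (rule H2_curveI(3)[OF d hL vv])
  define E where "E n = norm (velocity (e n) 0 - v0) + norm_L2 lborel01 (\<lambda>t. acceleration (e n) t - h t)" for n
  have a: "norm_L2 lborel01 (\<lambda>t. acceleration (e n) t - h t) \<le> norm_L2 lborel01 (\<lambda>t. jet (e n) t - z t)" for n
  proof (rule norm_L2_mono)
    show "norm (acceleration (e n) t - h t) \<le> norm (jet (e n) t - z t)" for t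
      using norm_triple_components(3)[of "jet (e n) t - z t"] by (simp add: h_def jet_def minus_prod_def)
  qed (intro L2_diff H2_curveD e hL J z)+
  have a0: "(\<lambda>n. norm_L2 lborel01 (\<lambda>t. acceleration (e n) t - h t)) \<longlonglongrightarrow> 0"
    by (rule tendsto_sandwich[OF _ _ tendsto_const lim]) (auto intro!: always_eventually a)
  have E0: "E \<longlonglongrightarrow> 0"
    unfolding E_def using tendsto_add[OF tendsto_norm[OF tendsto_diff[OF v0 tendsto_const[of v0]]] a0] by simp
  have Ev: "norm (velocity (e n) t - v t) \<le> E n" if t: "t \<in> {0..1}" for n t
  proof -
    have si: "set_integrable lborel {0..t} (acceleration (e n))" "set_integrable lborel {0..t} h"
      using t hint L2_integrable[OF finite_measure_lborel01 H2_curveD(2)[OF e]] by (auto intro: integrable_lborel01_subinterval)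
    have eq: "velocity (e n) t - v t = (velocity (e n) 0 - v0) + (LINT s:{0..t}|lborel. acceleration (e n) s - h s)"
      using H2_curveD(3)[OF e t, of n] set_integral_diff(2)[OF si] by (simp add: v_def)
    have "norm (LINT s:{0..t}|lborel. acceleration (e n) s - h s) \<le> sqrt (t - 0) * norm_L2 lborel01 (\<lambda>t. acceleration (e n) t - h t)"
      using t by (intro norm_set_LINT_le L2_diff H2_curveD e hL) auto
    also have "\<dots> \<le> 1 * norm_L2 lborel01 (\<lambda>t. acceleration (e n) t - h t)"
      using t by (intro mult_right_mono) auto
    finally show ?thesis
      unfolding eq E_def using norm_triangle_ineq[of "velocity (e n) 0 - v0" "LINT s:{0..t}|lborel. acceleration (e n) s - h s"] by linarith
  qed
  have Ec: "norm (e n t - c t) \<le> norm (e n 0 - c0) + E n" if t: "t \<in> {0..1}" for n t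
  proof -
    note vec = H2_velocity_continuous[OF e[of n]]
    have si: "set_integrable lborel {0..t} (velocity (e n))" "set_integrable lborel {0..t} v"
      using t vec vc by (auto intro!: integrable_lborel01_subinterval continuous_integrable_lborel01)
    have "c t = c0 + (LINT s:{0..t}|lborel. v s)"
      using t set_LINT_eq_integral(1)[OF continuous_integrable_lborel01[OF vc], of 0 t] by (simp add: c_def)
    moreover have "e n t = e n 0 + (LINT s:{0..t}|lborel. velocity (e n) s)"
      using curve_H1_path[OF e[of n]] t unfolding H1_path_def by blast
    ultimately have eq: "e n t - c t = (e n 0 - c0) + (LINT s:{0..t}|lborel. velocity (e n) s - v s)"
      using set_integral_diff(2)[OF si] by simp
    have L: "L2 lborel01 (\<lambda>s. velocity (e n) s - v s)" by (intro L2_diff continuous_L2 vec vc)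
    have "norm (LINT s:{0..t}|lborel. velocity (e n) s - v s) \<le> sqrt (t - 0) * norm_L2 lborel01 (\<lambda>s. velocity (e n) s - v s)"
      using t by (intro norm_set_LINT_le L) auto
    also have "\<dots> \<le> 1 * norm_L2 lborel01 (\<lambda>s. velocity (e n) s - v s)"
      using t by (intro mult_right_mono) auto
    also have "\<dots> \<le> E n" using norm_L2_bounded_le[OF L Ev] by simp
    finally show ?thesis
      unfolding eq using norm_triangle_ineq[of "e n 0 - c0" "LINT s:{0..t}|lborel. velocity (e n) s - v s"] by linarith
  qed
  have e00: "(\<lambda>n. norm (e n 0 - c0) + E n) \<longlonglongrightarrow> 0"
    using tendsto_add[OF tendsto_norm[OF tendsto_diff[OF c0 tendsto_const[of c0]]] E0] by simp
  have Lc: "L2 lborel01 c" by (intro continuous_L2 H2_continuous I1)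
  have Lv: "L2 lborel01 v" by (rule continuous_L2[OF vc])
  have zm: "L2 lborel01 (\<lambda>t. fst (z t))" "L2 lborel01 (\<lambda>t. fst (snd (z t)))"
  proof -
    have c1: "continuous_on UNIV (\<lambda>x :: 'a \<times> 'a \<times> 'a. fst x)" and c2: "continuous_on UNIV (\<lambda>x :: 'a \<times> 'a \<times> 'a. fst (snd x))"
      by (intro continuous_intros)+
    have n: "norm (fst (z t)) \<le> 1 * norm (z t)" "norm (fst (snd (z t))) \<le> 1 * norm (z t)" for t
      using norm_fst_le[of "fst (z t)" "snd (z t)"] norm_snd_le[of "snd (z t)" "fst (z t)"]
        norm_fst_le[of "fst (snd (z t))" "snd (snd (z t))"] by simp_all
    show "L2 lborel01 (\<lambda>t. fst (z t))" "L2 lborel01 (\<lambda>t. fst (snd (z t)))"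
      using borel_measurable_continuous_on[OF c1 L2_measurable[OF z]]
        borel_measurable_continuous_on[OF c2 L2_measurable[OF z]] n
      by (auto intro!: L2_dominated[OF z, where B=1])
  qed
  have 1: "AE t in lborel01. fst (z t) = c t"
  proof (rule L2_limit_unique_AE[of lborel01 e])
    show "L2 lborel01 (e n)" for n by (intro continuous_L2 H2_continuous e)
    show "(\<lambda>n. norm_L2 lborel01 (\<lambda>t. e n t - fst (z t))) \<longlonglongrightarrow> 0"
    proof (rule tendsto_sandwich[OF _ _ tendsto_const lim]; intro always_eventually allI)
      fix n
      show "norm_L2 lborel01 (\<lambda>t. e n t - fst (z t)) \<le> norm_L2 lborel01 (\<lambda>t. jet (e n) t - z t)"
      proof (rule norm_L2_mono)
        show "norm (e n t - fst (z t)) \<le> norm (jet (e n) t - z t)" for t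
          using norm_triple_components(1)[of "jet (e n) t - z t"] by (simp add: jet_def minus_prod_def)
      qed (intro L2_diff continuous_L2 H2_continuous e zm J z)+
    qed simp
    show "(\<lambda>n. norm_L2 lborel01 (\<lambda>t. e n t - c t)) \<longlonglongrightarrow> 0"
    proof (rule tendsto_sandwich[OF _ _ tendsto_const e00]; intro always_eventually allI)
      show "norm_L2 lborel01 (\<lambda>t. e n t - c t) \<le> norm (e n 0 - c0) + E n" for n
        by (rule norm_L2_bounded_le[OF L2_diff[OF continuous_L2[OF H2_continuous[OF e]] Lc] Ec])
    qed simp
  qed (fact zm Lc)+
  have 2: "AE t in lborel01. fst (snd (z t)) = v t"
  proof (rule L2_limit_unique_AE[of lborel01 "\<lambda>n. velocity (e n)"])
    show "L2 lborel01 (velocity (e n))" for n by (intro continuous_L2 H2_velocity_continuous e)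
    show "(\<lambda>n. norm_L2 lborel01 (\<lambda>t. velocity (e n) t - fst (snd (z t)))) \<longlonglongrightarrow> 0"
    proof (rule tendsto_sandwich[OF _ _ tendsto_const lim]; intro always_eventually allI)
      fix n
      show "norm_L2 lborel01 (\<lambda>t. velocity (e n) t - fst (snd (z t))) \<le> norm_L2 lborel01 (\<lambda>t. jet (e n) t - z t)"
      proof (rule norm_L2_mono)
        show "norm (velocity (e n) t - fst (snd (z t))) \<le> norm (jet (e n) t - z t)" for t
          using norm_triple_components(2)[of "jet (e n) t - z t"] by (simp add: jet_def minus_prod_def)
      qed (intro L2_diff continuous_L2 H2_velocity_continuous e zm J z)+
    qed simp
    show "(\<lambda>n. norm_L2 lborel01 (\<lambda>t. velocity (e n) t - v t)) \<longlonglongrightarrow> 0"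
    proof (rule tendsto_sandwich[OF _ _ tendsto_const E0]; intro always_eventually allI)
      show "norm_L2 lborel01 (\<lambda>t. velocity (e n) t - v t) \<le> E n" for n
        by (rule norm_L2_bounded_le[OF L2_diff[OF continuous_L2[OF H2_velocity_continuous[OF e]] Lv] Ev])
    qed simp
  qed (fact zm Lv)+
  have "AE t in lborel01. t \<in> {0..1}" using AE_space[of lborel01] by simp
  with I3 1 2 have "AE t in lborel01. z t = jet c t"
  proof eventually_elim
    case (elim t)
    then show ?case using I2[of t] by (simp add: jet_def h_def prod_eq_iff)
  qed
  with I1 that show ?thesis by blast
qed

lemma weak_H2_bounded:
  fixes F :: "nat \<Rightarrow> real \<Rightarrow> 'a::euclidean_space"
  assumes w: "weakly_converges_H2 F f"
  shows "\<exists>B. \<forall>n. norm_L2 lborel01 (jet (F n)) \<le> B"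
proof -
  have F: "H2_curve (F n)" for n using w by (simp add: weakly_converges_H2_def)
  define V where "V = {z. L2 lborel01 z \<and> (\<exists>e :: real \<Rightarrow> 'a. H2_curve e \<and> (AE t in lborel01. z t = jet e t))}"
  show ?thesis
  proof (rule uniform_boundedness[OF finite_measure_lborel01, of V])
    show "L2 lborel01 x" if "x \<in> V" for x using that by (simp add: V_def)
    show "(\<lambda>t. a *\<^sub>R x t + b *\<^sub>R y t) \<in> V" if x: "x \<in> V" and y: "y \<in> V" for x y a b
    proof -
      obtain c e :: "real \<Rightarrow> 'a" where c: "H2_curve c" "AE t in lborel01. x t = jet c t"
        and e: "H2_curve e" "AE t in lborel01. y t = jet e t" using x y by (auto simp: V_def)
      have "AE t in lborel01. a *\<^sub>R x t + b *\<^sub>R y t = jet (\<lambda>t. a *\<^sub>R c t + b *\<^sub>R e t) t"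
        using c(2) e(2) H2_lincomb(3)[OF c(1) e(1), of a b] by eventually_elim simp
      then show ?thesis
        using x y L2_lincomb[of lborel01 x y a b] H2_lincomb(1)[OF c(1) e(1), of a b] by (auto simp: V_def)
    qed
    show "z \<in> V" if y: "\<And>n. y n \<in> V" and z: "L2 lborel01 z" and l: "(\<lambda>n::nat. norm_L2 lborel01 (\<lambda>x. y n x - z x)) \<longlonglongrightarrow> 0" for y z
    proof -
      have "\<forall>n. \<exists>e :: real \<Rightarrow> 'a. H2_curve e \<and> (AE t in lborel01. y n t = jet e t)" using y by (simp add: V_def)
      then obtain e :: "nat \<Rightarrow> real \<Rightarrow> 'a" where e: "\<And>n. H2_curve (e n)" and ye: "\<And>n. AE t in lborel01. y n t = jet (e n) t"
        by metis
      have yL: "L2 lborel01 (y n)" for n using y[of n] by (simp add: V_def)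
      have "norm_L2 lborel01 (\<lambda>x. y n x - z x) = norm_L2 lborel01 (\<lambda>x. jet (e n) x - z x)" for n
      proof -
        have "AE t in lborel01. y n t - z t = jet (e n) t - z t" using ye[of n] by eventually_elim simp
        then show ?thesis
          unfolding norm_L2_def by (intro arg_cong[of _ _ sqrt] inner_L2_self_cong_AE L2_diff yL z L2_jet e)
      qed
      with l have "(\<lambda>n. norm_L2 lborel01 (\<lambda>x. jet (e n) x - z x)) \<longlonglongrightarrow> 0" by simp
      from jets_closed[OF e z this] z show ?thesis unfolding V_def by blast
    qed
    show "jet (F n) \<in> V" for n using L2_jet[OF F] F by (auto simp: V_def)
    show "\<exists>B. \<forall>n. \<bar>inner_L2 lborel01 (jet (F n)) z\<bar> \<le> B" if zV: "z \<in> V" for z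
    proof -
      obtain e :: "real \<Rightarrow> 'a" where e: "H2_curve e" "AE t in lborel01. z t = jet e t" using zV by (auto simp: V_def)
      have zL: "L2 lborel01 z" using zV by (simp add: V_def)
      have "inner_L2 lborel01 (jet (F n)) z = H2_inner (F n) e" for n
        using inner_L2_cong_AE[OF zL L2_jet[OF e(1)] L2_jet[OF F[of n]] e(2)] by (simp add: H2_inner_eq_ip inner_L2_commute)
      moreover have "Bseq (\<lambda>n. H2_inner (F n) e)"
        using w e(1) unfolding weakly_converges_H2_def by (intro convergent_imp_Bseq convergentI) blast
      ultimately show ?thesis unfolding Bseq_def by auto
    qed
  qed
qed

text \<open>The velocity at \<open>t\<close> in the direction \<open>b\<close> is a bounded functional on H2. If the differences
  \<open>u n = F n - f\<close> had value at least \<open>\<eta>\<close> for infinitely many \<open>n\<close>, these would lie in the convex set \<open>K\<close>,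
  whose elements have squared norm at least some \<open>r > 0\<close>. An element \<open>e\<close> of \<open>K\<close> of almost least norm has
  inner product at least \<open>r / 2\<close> with all elements of \<open>K\<close> of bounded norm, in contradiction to
  the weak convergence of \<open>u n\<close> to zero.\<close>

lemma weak_H2_functional:
  fixes F :: "nat \<Rightarrow> real \<Rightarrow> 'a::euclidean_space"
  assumes w: "weakly_converges_H2 F f" and t: "t \<in> {0..1}" and b: "norm b = 1" and \<eta>: "\<eta> > 0"
  shows "\<forall>\<^sub>F n in sequentially. (velocity (F n) t - velocity f t) \<bullet> b < \<eta>"
proof (rule ccontr)
  assume neg: "\<not> ?thesis"
  have F: "H2_curve (F n)" and f: "H2_curve f" for n using w by (auto simp: weakly_converges_H2_def)
  define u where "u n t = F n t - f t" for n t
  have u: "H2_curve (u n)" for n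
    unfolding u_def using H2_lincomb(1)[OF F f, of 1 _ "-1"] by simp
  have uv: "velocity (u n) t = velocity (F n) t - velocity f t" for n
    unfolding u_def using H2_lincomb(2)[OF F f t, of 1 _ "-1"] by simp
  have uj: "AE t in lborel01. jet (u n) t = jet (F n) t - jet f t" for n
    unfolding u_def using H2_lincomb(3)[OF F f, of 1 _ "-1"] by simp
  obtain B where B: "\<And>n. norm_L2 lborel01 (jet (F n)) \<le> B" using weak_H2_bounded[OF w] by blast
  define M where "M = B + norm_L2 lborel01 (jet f)"
  have uM: "norm_L2 lborel01 (jet (u n)) \<le> M" for n
  proof -
    have "norm_L2 lborel01 (jet (u n)) = norm_L2 lborel01 (\<lambda>t. jet (F n) t - jet f t)"
      unfolding norm_L2_def by (intro arg_cong[of _ _ sqrt] inner_L2_self_cong_AE L2_diff L2_jet u F f uj)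
    also have "\<dots> = norm_L2 lborel01 (\<lambda>t. jet f t - jet (F n) t)" by (rule norm_L2_minus)
    also have "\<dots> \<le> norm_L2 lborel01 (jet f) + norm_L2 lborel01 (jet (F n))"
      using norm_L2_add[OF L2_jet[OF f] L2_scale[OF L2_jet[OF F[of n]], of "-1"]] norm_L2_scale[of lborel01 "-1" "jet (F n)"] by simp
    finally show ?thesis using B[of n] by (simp add: M_def)
  qed
  have un0: "(\<lambda>n. inner_L2 lborel01 (jet (u n)) (jet e)) \<longlonglongrightarrow> 0" if e: "H2_curve e" for e
  proof -
    have "inner_L2 lborel01 (jet (u n)) (jet e) = H2_inner (F n) e - H2_inner f e" for n
    proof -
      have "inner_L2 lborel01 (jet (u n)) (jet e) = inner_L2 lborel01 (\<lambda>t. jet (F n) t - jet f t) (jet e)"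
        by (intro inner_L2_cong_AE L2_diff L2_jet u F f e uj)
      also have "\<dots> = inner_L2 lborel01 (jet (F n)) (jet e) - inner_L2 lborel01 (jet f) (jet e)"
        using inner_L2_lincomb[OF L2_jet[OF F[of n]] L2_jet[OF f] L2_jet[OF e], of 1 "-1"] by simp
      finally show ?thesis by (simp add: H2_inner_eq_ip)
    qed
    moreover have "(\<lambda>n. H2_inner (F n) e - H2_inner f e) \<longlonglongrightarrow> H2_inner f e - H2_inner f e"
      using w e unfolding weakly_converges_H2_def by (intro tendsto_intros) blast
    ultimately show ?thesis by simp
  qed
  define K where "K = {e. H2_curve e \<and> \<eta> \<le> velocity e t \<bullet> b}"
  define N where "N e = inner_L2 lborel01 (jet e) (jet e)" for e :: "real \<Rightarrow> 'a"
  have Klow: "\<eta>\<^sup>2 / 4 \<le> N e" if e: "e \<in> K" for e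
  proof -
    have "\<eta> \<le> norm (velocity e t) * norm b" using e norm_cauchy_schwarz[of "velocity e t" b] by (simp add: K_def)
    also have "\<dots> \<le> 2 * norm_L2 lborel01 (jet e)" using velocity_sup_le[OF _ t, of e] e b by (simp add: K_def)
    finally have "\<eta>\<^sup>2 \<le> (2 * norm_L2 lborel01 (jet e))\<^sup>2" using \<eta> by (intro power_mono) auto
    then show ?thesis by (simp add: N_def norm_L2_power2 power_mult_distrib)
  qed
  define r where "r = (INF e\<in>K. N e)"
  have bb: "bdd_below (N ` K)" using Klow by (intro bdd_belowI2[of _ "\<eta>\<^sup>2 / 4"]) auto
  have inf: "\<exists>\<^sub>F n in sequentially. u n \<in> K"
    using neg u by (simp add: not_eventually K_def uv not_less)
  then obtain n0 where n0: "u n0 \<in> K" by (meson frequently_ex)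
  have rpos: "r > 0"
  proof -
    have "\<eta>\<^sup>2 / 4 \<le> r" unfolding r_def using n0 Klow by (intro cINF_greatest) auto
    then show ?thesis using \<eta> by (smt (verit) divide_pos_pos zero_less_power)
  qed
  \<comment> \<open>the step from \<open>e\<close> towards \<open>u n\<close>: small enough that the second order terms of the squared norm cost at most \<open>r\<close>\<close>
  define s where "s = min (1/2) (r / (r + 1 + M\<^sup>2))"
  have den: "r + 1 + M\<^sup>2 > 0" using rpos by (simp add: add_pos_nonneg)
  have s: "0 < s" "s \<le> 1/2" "s * (r + 1 + M\<^sup>2) \<le> r"
  proof -
    show "0 < s" using rpos den by (simp add: s_def)
    show "s \<le> 1/2" unfolding s_def by (rule min.cobounded1)
    have "s \<le> r / (r + 1 + M\<^sup>2)" by (simp add: s_def)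
    then show "s * (r + 1 + M\<^sup>2) \<le> r" using den by (simp add: pos_le_divide_eq)
  qed
  have "\<exists>e\<in>K. N e < r + s\<^sup>2"
    using cInf_lessD[of "N ` K" "r + s\<^sup>2"] n0 s(1) unfolding r_def by auto
  then obtain e where e: "e \<in> K" "N e < r + s\<^sup>2" by blast
  have eH: "H2_curve e" using e by (simp add: K_def)
  have low: "r / 2 \<le> inner_L2 lborel01 (jet (u n)) (jet e)" if n: "u n \<in> K" for n
  proof -
    let ?g = "\<lambda>x. (1 - s) *\<^sub>R e x + s *\<^sub>R u n x"
    define A C P where "A = N e" "C = N (u n)" "P = inner_L2 lborel01 (jet e) (jet (u n))"
    have "velocity ?g t \<bullet> b = (1 - s) * (velocity e t \<bullet> b) + s * (velocity (u n) t \<bullet> b)"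
      using H2_lincomb(2)[OF eH u t] by (simp add: inner_add_left)
    also have "\<dots> \<ge> (1 - s) * \<eta> + s * \<eta>"
      using e(1) n s by (intro add_mono mult_left_mono) (auto simp: K_def)
    also have "(1 - s) * \<eta> + s * \<eta> = \<eta>" by (simp add: algebra_simps)
    finally have "?g \<in> K" unfolding K_def using H2_lincomb(1)[OF eH u] by blast
    then have "r \<le> N ?g" unfolding r_def by (intro cINF_lower bb)
    also have "N ?g = inner_L2 lborel01 (\<lambda>x. (1 - s) *\<^sub>R jet e x + s *\<^sub>R jet (u n) x) (\<lambda>x. (1 - s) *\<^sub>R jet e x + s *\<^sub>R jet (u n) x)"
      unfolding N_def by (intro inner_L2_self_cong_AE L2_jet L2_lincomb H2_lincomb eH u)
    also have "\<dots> = (1 - s)\<^sup>2 * A + 2 * (1 - s) * s * P + s\<^sup>2 * C"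
      unfolding A_C_P_def N_def by (rule inner_L2_square_lincomb) (intro L2_jet eH u)+
    finally have 1: "r \<le> (1 - s)\<^sup>2 * A + 2 * (1 - s) * s * P + s\<^sup>2 * C" .
    have C: "C \<le> M\<^sup>2"
      using power_mono[OF uM[of n] norm_L2_nonneg, of 2] by (simp add: A_C_P_def N_def norm_L2_power2)
    have "(1 - s)\<^sup>2 * A \<le> (1 - s)\<^sup>2 * (r + s\<^sup>2)"
      using e(2) by (intro mult_left_mono) (auto simp: A_C_P_def)
    moreover have "(1 - s)\<^sup>2 * s\<^sup>2 \<le> 1 * s\<^sup>2"
      using s by (intro mult_right_mono power_le_one) auto
    moreover have "s\<^sup>2 * C \<le> s\<^sup>2 * M\<^sup>2" using C by (intro mult_left_mono) auto
    ultimately have "r \<le> (1 - s)\<^sup>2 * r + s\<^sup>2 + 2 * (1 - s) * s * P + s\<^sup>2 * M\<^sup>2"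
      using 1 by (simp add: distrib_left)
    then have "s * (2 * r) \<le> s * (s * (r + 1 + M\<^sup>2) + 2 * (1 - s) * P)"
      by (simp add: power2_eq_square algebra_simps)
    then have "2 * r \<le> s * (r + 1 + M\<^sup>2) + 2 * (1 - s) * P"
      using s(1) by (simp add: mult_le_cancel_left_pos del: distrib_left_numeral)
    then have "r \<le> 2 * (1 - s) * P" using s(3) by linarith
    moreover have "2 * (1 - s) * P \<le> 2 * P"
    proof -
      have "P \<ge> 0"
      proof (rule ccontr)
        assume "\<not> 0 \<le> P"
        then have "2 * (1 - s) * P \<le> 0" using s(2) by (intro mult_nonneg_nonpos) auto
        then show False using \<open>r \<le> 2 * (1 - s) * P\<close> rpos by linarith
      qed
      then show ?thesis using s by (intro mult_right_mono) auto
    qed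
    ultimately show ?thesis by (simp add: A_C_P_def inner_L2_commute)
  qed
  have ev: "\<forall>\<^sub>F n in sequentially. inner_L2 lborel01 (jet (u n)) (jet e) < r / 2"
    using un0[OF eH] rpos by (intro order_tendstoD(2)) auto
  have "\<exists>\<^sub>F n in sequentially. u n \<in> K \<and> inner_L2 lborel01 (jet (u n)) (jet e) < r / 2"
    by (rule frequently_rev_mp[OF inf]) (rule eventually_mono[OF ev], simp)
  from frequently_ex[OF this] obtain n where "u n \<in> K" "inner_L2 lborel01 (jet (u n)) (jet e) < r / 2" by blast
  with low[of n] show False by linarith
qed

lemma weak_H2_velocity_tendsto:
  fixes F :: "nat \<Rightarrow> real \<Rightarrow> 'a::euclidean_space"
  assumes w: "weakly_converges_H2 F f" and t: "t \<in> {0..1}"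
  shows "(\<lambda>n. velocity (F n) t) \<longlonglongrightarrow> velocity f t"
proof (rule tendsto_componentwise_iff[THEN iffD2], intro ballI)
  fix b :: 'a assume b: "b \<in> Basis"
  then have n: "norm b = 1" "norm (- b) = 1" by auto
  show "(\<lambda>n. velocity (F n) t \<bullet> b) \<longlonglongrightarrow> velocity f t \<bullet> b"
  proof (rule tendstoI)
    fix \<eta> :: real assume \<eta>: "\<eta> > 0"
    show "\<forall>\<^sub>F n in sequentially. dist (velocity (F n) t \<bullet> b) (velocity f t \<bullet> b) < \<eta>"
      using weak_H2_functional[OF w t n(1) \<eta>] weak_H2_functional[OF w t n(2) \<eta>]
      by eventually_elim (simp add: dist_real_def inner_diff_left abs_less_iff)
  qed
qed

lemma weak_H2_velocity_bounded:
  assumes "weakly_converges_H2 F f"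
  obtains B where "\<And>n t. t \<in> {0..1} \<Longrightarrow> norm (velocity (F n) t) \<le> B"
proof -
  obtain B where B: "\<And>n. norm_L2 lborel01 (jet (F n)) \<le> B" using weak_H2_bounded[OF assms] by blast
  have "norm (velocity (F n) t) \<le> 2 * B" if "t \<in> {0..1}" for n t
    using velocity_sup_le[OF _ that, of "F n"] assms B[of n] by (force simp: weakly_converges_H2_def)
  then show ?thesis using that by blast
qed

section \<open>Vertex positions with prescribed differences\<close>

text \<open>By induction on the edges, keeping \<open>p\<close> fixed on the edges treated so far. The differences
  of \<open>P n - p\<close> tend to zero within each component of the graph formed by these edges. If a new edge
  joins two vertices of one component, the condition for it holds in the limit; otherwise
  \<open>p\<close> is shifted by a constant on the component of one end.\<close>

lemma converging_differences_potential:
  fixes P :: "nat \<Rightarrow> 'v \<Rightarrow> 'a::real_normed_vector"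
  assumes "finite S" "\<And>i. i \<in> S \<Longrightarrow> (\<lambda>n. P n (b i) - P n (a i)) \<longlonglongrightarrow> w i"
  shows "\<exists>p. \<forall>i\<in>S. p (b i) - p (a i) = w i"
  using assms
proof (induction S)
  case empty
  show ?case by simp
next
  case (insert j S)
  then obtain p where p: "\<And>i. i \<in> S \<Longrightarrow> p (b i) - p (a i) = w i" by blast
  define Q where "Q n v = P n v - p v" for n v
  have Qdiff: "Q n x - Q n y = (P n x - P n y) - (p x - p y)" for n x y
    by (simp add: Q_def)
  \<comment> \<open>the reflexive transitive closure of \<open>E\<close> is the relation of lying in the same component\<close>
  define E where "E = {(a i, b i) | i. i \<in> S} \<union> {(b i, a i) | i. i \<in> S}"
  have QE: "(\<lambda>n. Q n y - Q n x) \<longlonglongrightarrow> 0" if "(x, y) \<in> E" for x y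
  proof -
    have "\<exists>i\<in>S. x = a i \<and> y = b i \<or> x = b i \<and> y = a i"
      using that by (auto simp: E_def)
    then obtain i where i: "i \<in> S" and xy: "x = a i \<and> y = b i \<or> x = b i \<and> y = a i"
      by blast
    have l: "(\<lambda>n. P n (b i) - P n (a i)) \<longlonglongrightarrow> p (b i) - p (a i)" using insert.prems[of i] i p[OF i] by simp
    from xy show ?thesis
    proof (elim disjE conjE)
      assume "x = a i" "y = b i"
      then show ?thesis using tendsto_diff[OF l tendsto_const[of "p (b i) - p (a i)"]] by (simp add: Qdiff)
    next
      assume "x = b i" "y = a i"
      then show ?thesis
        using tendsto_minus[OF tendsto_diff[OF l tendsto_const[of "p (b i) - p (a i)"]]] by (simp add: Qdiff algebra_simps)
    qed
  qed
  have Qc: "(\<lambda>n. Q n y - Q n x) \<longlonglongrightarrow> 0" if "(x, y) \<in> E\<^sup>*" for x y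
    using that
  proof (induction rule: rtrancl_induct)
    case base show ?case by simp
  next
    case (step y z)
    from tendsto_add[OF QE[OF step(2)] step(3)] show ?case by simp
  qed
  show ?case
  proof (cases "(a j, b j) \<in> E\<^sup>*")
    case True
    have "(\<lambda>n. P n (b j) - P n (a j)) \<longlonglongrightarrow> p (b j) - p (a j)"
      using tendsto_add[OF Qc[OF True] tendsto_const[of "p (b j) - p (a j)"]] by (simp add: Qdiff)
    moreover have "(\<lambda>n. P n (b j) - P n (a j)) \<longlonglongrightarrow> w j" using insert.prems[of j] by simp
    ultimately have "p (b j) - p (a j) = w j" by (rule LIMSEQ_unique)
    then show ?thesis using p by blast
  next
    case False
    define C where "C = {v. (b j, v) \<in> E\<^sup>*}"
    have "sym E" by (auto simp: E_def sym_def)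
    then have sE: "sym (E\<^sup>*)" by (rule sym_rtrancl)
    have aj: "a j \<notin> C" using False sE by (auto simp: C_def dest: symD)
    have bj: "b j \<in> C" by (simp add: C_def)
    have inv: "a i \<in> C \<longleftrightarrow> b i \<in> C" if "i \<in> S" for i
    proof -
      have "(a i, b i) \<in> E" "(b i, a i) \<in> E" using that by (auto simp: E_def)
      then show ?thesis by (auto simp: C_def intro: rtrancl_into_rtrancl)
    qed
    define p' where "p' v = p v + (if v \<in> C then w j - (p (b j) - p (a j)) else 0)" for v
    have "p' (b i) - p' (a i) = w i" if "i \<in> insert j S" for i
      using that p aj bj inv by (cases "i = j") (auto simp: p'_def)
    then show ?thesis by blast
  qed
qed

section \<open>Gluing curves along a graph\<close>

text \<open>The function on classes induced by a function on points that is constant on classes.\<close>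

definition glue :: "(point \<Rightarrow> 'a) \<Rightarrow> point set \<Rightarrow> 'a" where
  "glue g X = g (SOME x. x \<in> X)"

lemma glue_proj:
  assumes R: "N_graph N R" and g: "\<And>x y. (x, y) \<in> R \<Longrightarrow> g x = g y" and x: "x \<in> intervals {1..N}"
  shows "glue g (proj R x) = g x"
proof -
  have "(x, x) \<in> R" using R x by (auto simp: N_graph_def equiv_def refl_on_def)
  then have "x \<in> proj R x" by (simp add: proj_def)
  then have "(SOME y. y \<in> proj R x) \<in> proj R x" by (rule someI[of "\<lambda>y. y \<in> proj R x"])
  then have "(x, SOME y. y \<in> proj R x) \<in> R" by (simp add: proj_def)
  from g[OF this] show ?thesis unfolding glue_def by simp
qed

lemma topspace_graph_topology:
  "topspace (graph_topology N R) = intervals {1..N} // R"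
proof
  show "topspace (graph_topology N R) \<subseteq> intervals {1..N} // R"
    using openin_graph_topology[of N R "topspace (graph_topology N R)"] openin_topspace[of "graph_topology N R"] by blast
  have "{x \<in> intervals {1..N}. proj R x \<in> intervals {1..N} // R} = intervals {1..N}"
    by (auto simp: proj_def quotient_def)
  then have "openin (graph_topology N R) (intervals {1..N} // R)"
    by (simp add: openin_graph_topology)
  then show "intervals {1..N} // R \<subseteq> topspace (graph_topology N R)" by (rule openin_subset)
qed

lemma continuous_map_graph:
  fixes \<Gamma> :: "point set \<Rightarrow> 'a::topological_space"
  assumes "continuous_on (intervals {1..N}) (\<lambda>x. \<Gamma> (proj R x))"
  shows "continuous_map (graph_topology N R) euclidean \<Gamma>"
proof -
  have q: "proj R x \<in> topspace (graph_topology N R)" if "x \<in> intervals {1..N}" for x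
    using quotientI[OF that, of R] by (simp only: topspace_graph_topology proj_def)
  have "openin (graph_topology N R) {X \<in> topspace (graph_topology N R). \<Gamma> X \<in> W}" if W: "open W" for W
  proof -
    have eq: "{x \<in> intervals {1..N}. proj R x \<in> {X \<in> topspace (graph_topology N R). \<Gamma> X \<in> W}}
        = intervals {1..N} \<inter> (\<lambda>x. \<Gamma> (proj R x)) -` W"
      using q by blast
    have "{X \<in> topspace (graph_topology N R). \<Gamma> X \<in> W} \<subseteq> intervals {1..N} // R"
      unfolding topspace_graph_topology by blast
    moreover have "openin (top_of_set (intervals {1..N})) (intervals {1..N} \<inter> (\<lambda>x. \<Gamma> (proj R x)) -` W)"
      by (rule continuous_openin_preimage_gen[OF assms W])
    ultimately show ?thesis unfolding openin_graph_topology eq by blast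
  qed
  then show ?thesis unfolding continuous_map_def open_openin[symmetric] by auto
qed

lemma ends_in_intervals: "i \<in> {1..N} \<Longrightarrow> t \<in> {0..1} \<Longrightarrow> (t, i) \<in> intervals {1..N}"
  by (simp add: intervals_def)

lemma glue_curves:
  fixes \<kappa> :: "nat \<Rightarrow> real \<Rightarrow> 'a::euclidean_space" and P :: "point set \<Rightarrow> 'a"
  assumes R: "N_graph N R"
    and c: "\<And>i. i \<in> {1..N} \<Longrightarrow> continuous_on {0..1} (\<kappa> i)"
    and e0: "\<And>i. i \<in> {1..N} \<Longrightarrow> \<kappa> i 0 = P (proj R (0, i))"
    and e1: "\<And>i. i \<in> {1..N} \<Longrightarrow> \<kappa> i 1 = P (proj R (1, i))"
  shows "\<exists>\<Gamma>. (\<forall>i\<in>{1..N}. \<forall>t\<in>{0..1}. edge_curve R \<Gamma> i t = \<kappa> i t) \<and>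
    (\<forall>S. continuous_map (subgraph_topology N R S) euclidean \<Gamma>)"
proof -
  define g where "g x = \<kappa> (snd x) (fst x)" for x :: point
  have eq: "equiv (intervals {1..N}) R" using R by (simp add: N_graph_def)
  have gend: "g x = P (proj R x)" if "x \<in> interval_ends {1..N}" for x
    using that e0 e1 by (auto simp: interval_ends_def g_def)
  have gR: "g x = g y" if "(x, y) \<in> R" for x y
  proof (cases "x = y")
    case False
    then have "x \<in> interval_ends {1..N}" "y \<in> interval_ends {1..N}" using R that by (auto simp: N_graph_def)
    moreover have "proj R x = proj R y" using equiv_class_eq[OF eq that] by (simp add: proj_def)
    ultimately show ?thesis by (simp add: gend)
  qed simp
  have gc: "continuous_on (intervals {1..N}) g"
  proof -
    have "continuous_on (\<Union>i\<in>{1..N}. {0..1} \<times> {i}) g"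
    proof (rule continuous_on_closed_Union)
      fix i assume i: "i \<in> {1..N}"
      show "closed ({0..1::real} \<times> {i})" by (intro closed_Times) auto
      have "continuous_on ({0..1} \<times> {i}) (\<lambda>x. \<kappa> i (fst x))"
        by (rule continuous_on_compose2[OF c[OF i]]) (auto intro!: continuous_intros)
      then show "continuous_on ({0..1} \<times> {i}) g"
        by (rule continuous_on_eq) (auto simp: g_def)
    qed simp
    moreover have "(\<Union>i\<in>{1..N}. {0..1::real} \<times> {i}) = intervals {1..N}" by (auto simp: intervals_def)
    ultimately show ?thesis by simp
  qed
  have gp: "glue g (proj R x) = g x" if "x \<in> intervals {1..N}" for x
    by (rule glue_proj[OF R _ that]) (rule gR)
  have "continuous_on (intervals {1..N}) (\<lambda>x. glue g (proj R x))"
    using gc by (rule continuous_on_eq) (simp add: gp)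
  note cm = continuous_map_graph[OF this]
  show ?thesis
  proof (intro exI[of _ "glue g"] conjI ballI allI)
    show "edge_curve R (glue g) i t = \<kappa> i t" if "i \<in> {1..N}" "t \<in> {0..1}" for i t
      unfolding edge_curve_def using gp[OF ends_in_intervals[OF that]] by (simp add: g_def)
    show "continuous_map (subgraph_topology N R S) euclidean (glue g)" for S
      unfolding subgraph_topology_def by (rule continuous_map_from_subtopology[OF cm])
  qed
qed

lemma velocity_cong:
  assumes agree: "\<forall>t\<in>{0..1}. c t = e t" and t: "t \<in> {0..1}"
  shows "velocity c t = velocity e t"
proof -
  have "(c has_vector_derivative y) (at t within {0..1}) \<longleftrightarrow> (e has_vector_derivative y) (at t within {0..1})" for y
  proof
    assume c: "(c has_vector_derivative y) (at t within {0..1})"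
    show "(e has_vector_derivative y) (at t within {0..1})"
      by (rule has_vector_derivative_transform[OF t _ c]) (use agree in auto)
  next
    assume e: "(e has_vector_derivative y) (at t within {0..1})"
    show "(c has_vector_derivative y) (at t within {0..1})"
      by (rule has_vector_derivative_transform[OF t _ e]) (use agree in auto)
  qed
  then show ?thesis by (simp add: velocity_def vector_derivative_def)
qed

lemma differentiable_cong_unit:
  fixes c e :: "real \<Rightarrow> 'a::real_normed_vector"
  assumes agree: "\<forall>t\<in>{0..1}. c t = e t" and t: "t \<in> {0..1}"
  shows "c differentiable (at t within {0..1}) \<longleftrightarrow> e differentiable (at t within {0..1})"
proof -
  have "(c has_derivative D) (at t within {0..1}) \<longleftrightarrow> (e has_derivative D) (at t within {0..1})" for D
  proof
    assume c: "(c has_derivative D) (at t within {0..1})"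
    show "(e has_derivative D) (at t within {0..1})"
      by (rule has_derivative_transform[OF t _ c]) (use agree in auto)
  next
    assume e: "(e has_derivative D) (at t within {0..1})"
    show "(c has_derivative D) (at t within {0..1})"
      by (rule has_derivative_transform[OF t _ e]) (use agree in auto)
  qed
  then show ?thesis by (simp add: differentiable_def)
qed

context
  fixes c e :: "real \<Rightarrow> 'a::euclidean_space"
  assumes agree: "\<forall>t\<in>{0..1}. c t = e t"
begin

lemma weak_second_deriv_cong: "weak_second_deriv c = weak_second_deriv e"
proof
  fix h
  have 0: "velocity c 0 = velocity e 0" by (rule velocity_cong[OF agree]) auto
  have "(\<forall>t\<in>{0..1}. velocity c t = velocity c 0 + (LINT s:{0..t}|lborel. h s))
      \<longleftrightarrow> (\<forall>t\<in>{0..1}. velocity e t = velocity e 0 + (LINT s:{0..t}|lborel. h s))"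
    unfolding 0 by (rule ball_cong[OF refl]) (simp only: velocity_cong[OF agree])
  then show "weak_second_deriv c h = weak_second_deriv e h"
    unfolding weak_second_deriv_def by (rule arg_cong)
qed

lemma acceleration_cong: "acceleration c = acceleration e"
  by (simp add: acceleration_def weak_second_deriv_cong)

lemma H2_curve_cong: "H2_curve c \<longleftrightarrow> H2_curve e"
proof -
  have "(\<forall>t\<in>{0..1}. c differentiable (at t within {0..1})) \<longleftrightarrow> (\<forall>t\<in>{0..1}. e differentiable (at t within {0..1}))"
    by (rule ball_cong[OF refl differentiable_cong_unit[OF agree]])
  then show ?thesis by (simp only: H2_curve_def weak_second_deriv_cong)
qed

lemma singular_curve_cong: "singular_curve c \<longleftrightarrow> singular_curve e"
  unfolding singular_curve_def constant_on_def by (intro ex_cong1 ball_cong) (simp_all add: agree)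

lemma regular_curve_cong: "regular_curve c \<longleftrightarrow> regular_curve e"
proof -
  have "(\<forall>t\<in>{0..1}. velocity c t \<noteq> 0) \<longleftrightarrow> (\<forall>t\<in>{0..1}. velocity e t \<noteq> 0)"
    by (rule ball_cong[OF refl]) (simp only: velocity_cong[OF agree])
  then show ?thesis by (simp only: regular_curve_def H2_curve_cong)
qed

lemma straight_curve_cong: "straight_curve c \<longleftrightarrow> straight_curve e"
proof -
  have "path_image c = path_image e" unfolding path_image_def using agree by (intro image_cong) auto
  then show ?thesis using agree by (simp add: straight_curve_def)
qed

lemma curve_length_cong: "curve_length c = curve_length e"
  unfolding curve_length_def
  by (rule set_lebesgue_integral_cong) (simp_all add: velocity_cong[OF agree] del: atLeastAtMost_iff)

lemma bending_energy_cong: "bending_energy c = bending_energy e"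
  unfolding bending_energy_def
  by (rule set_lebesgue_integral_cong)
    (simp_all add: velocity_cong[OF agree] acceleration_cong curvature_def del: atLeastAtMost_iff)

lemma outer_tangent_cong: "z \<in> {0, 1} \<Longrightarrow> outer_tangent z c = outer_tangent z e"
proof -
  assume "z \<in> {0, 1}"
  then have "velocity c (real z) = velocity e (real z)" by (intro velocity_cong[OF agree]) auto
  then show ?thesis by (simp add: outer_tangent_def)
qed

end

section \<open>Segments and singular curves\<close>

lemma line_H2:
  fixes p d :: "'a::euclidean_space"
  shows "H2_curve (\<lambda>t. p + t *\<^sub>R d)" "t \<in> {0..1} \<Longrightarrow> velocity (\<lambda>t. p + t *\<^sub>R d) t = d"
    "AE t in lborel01. acceleration (\<lambda>t. p + t *\<^sub>R d) t = 0"
proof -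
  have d: "((\<lambda>t. p + t *\<^sub>R d) has_vector_derivative d) (at t within {0..1})" for t
    by (auto intro!: derivative_eq_intros)
  have h: "L2 lborel01 (\<lambda>t. 0 :: 'a)" by (intro continuous_L2 continuous_intros)
  have v: "d = d + (LINT s:{0..t}|lborel. (0::'a))" for t :: real by (simp add: set_lebesgue_integral_def)
  show "H2_curve (\<lambda>t. p + t *\<^sub>R d)" by (rule H2_curveI(1)[OF d h v])
  show "t \<in> {0..1} \<Longrightarrow> velocity (\<lambda>t. p + t *\<^sub>R d) t = d" by (rule H2_curveI(2)[OF d h v])
  show "AE t in lborel01. acceleration (\<lambda>t. p + t *\<^sub>R d) t = 0" by (rule H2_curveI(3)[OF d h v])
qed

lemma line_bending_energy:
  fixes p d :: "'a::euclidean_space"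
  shows "bending_energy (\<lambda>t. p + t *\<^sub>R d) = 0"
proof -
  have "AE t in lborel01. (norm (curvature (\<lambda>t. p + t *\<^sub>R d) t))\<^sup>2 * norm (velocity (\<lambda>t. p + t *\<^sub>R d) t) = 0"
    using line_H2(3)[of p d] by eventually_elim (simp add: curvature_def)
  then show ?thesis unfolding bending_energy_def integral_lborel01[symmetric] by (rule integral_eq_zero_AE)
qed

lemma line_length:
  fixes p d :: "'a::euclidean_space"
  shows "curve_length (\<lambda>t. p + t *\<^sub>R d) = norm d"
proof -
  have "curve_length (\<lambda>t. p + t *\<^sub>R d) = (LINT t|lborel01. norm d)"
    unfolding curve_length_def integral_lborel01[symmetric]
    by (rule Bochner_Integration.integral_cong) (simp_all add: line_H2 del: atLeastAtMost_iff)
  then show ?thesis by simp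
qed

lemma line_singular_iff:
  fixes p d :: "'a::euclidean_space"
  shows "singular_curve (\<lambda>t. p + t *\<^sub>R d) \<longleftrightarrow> d = 0"
proof
  assume "singular_curve (\<lambda>t. p + t *\<^sub>R d)"
  then obtain y where y: "\<And>t. t \<in> {0..1} \<Longrightarrow> p + t *\<^sub>R d = y" by (auto simp: singular_curve_def constant_on_def)
  show "d = 0" using y[of 0] y[of 1] by simp
qed (auto simp: singular_curve_def constant_on_def)

lemma line_regular: "d \<noteq> 0 \<Longrightarrow> regular_curve (\<lambda>t. p + t *\<^sub>R (d::'a::euclidean_space))"
  by (simp add: regular_curve_def line_H2 del: atLeastAtMost_iff)

lemma line_straight: "straight_curve (\<lambda>t. p + t *\<^sub>R (d::'a::euclidean_space))"
proof -
  have "p + t *\<^sub>R d = (1 - t) *\<^sub>R p + t *\<^sub>R (p + d)" for t by (simp add: algebra_simps)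
  then show ?thesis unfolding straight_curve_def path_image_def closed_segment_image_interval by auto
qed

lemma singular_velocity:
  assumes "singular_curve c" "t \<in> {0..1}"
  shows "velocity c t = 0"
proof -
  obtain y where y: "\<forall>t\<in>{0..1}. c t = y" using assms by (auto simp: singular_curve_def constant_on_def)
  have "velocity c t = velocity (\<lambda>_. y) t" by (rule velocity_cong[OF y assms(2)])
  also have "\<dots> = 0" by (rule velocity_eqI[OF has_vector_derivative_const assms(2)])
  finally show ?thesis .
qed

lemma singular_energy:
  assumes "singular_curve c"
  shows "bending_energy c = 0" "curve_length c = 0"
proof -
  have "bending_energy c = (LINT t:{0..1::real}|lborel. 0)"
    unfolding bending_energy_def
    by (rule set_lebesgue_integral_cong) (simp_all add: singular_velocity[OF assms] del: atLeastAtMost_iff)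
  then show "bending_energy c = 0" by (simp add: set_lebesgue_integral_def)
  have "curve_length c = (LINT t:{0..1::real}|lborel. 0)"
    unfolding curve_length_def
    by (rule set_lebesgue_integral_cong) (simp_all add: singular_velocity[OF assms] del: atLeastAtMost_iff)
  then show "curve_length c = 0" by (simp add: set_lebesgue_integral_def)
qed

lemma singular_not_regular: "regular_curve c \<Longrightarrow> \<not> singular_curve c"
  using singular_velocity[of c 0] by (auto simp: regular_curve_def)

lemma network_energy_eq_sum:
  "network_energy N R \<Gamma> = (\<Sum>i\<in>{1..N}. bending_energy (edge_curve R \<Gamma> i) + curve_length (edge_curve R \<Gamma> i))"
  unfolding network_energy_def
  by (rule sum.mono_neutral_left) (auto simp: Sing_def singular_energy)

lemma edge_curve_ends:
  "edge_curve R \<Gamma> i 0 = \<Gamma> (proj R (0, i))" "edge_curve R \<Gamma> i 1 = \<Gamma> (proj R (1, i))"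
  by (simp_all add: edge_curve_def)

text \<open>A curve in the segment from \<open>c 0\<close> to \<open>c 1\<close> has velocity parallel to the segment, since
  its components in all orthogonal directions are constant; at the initial point the velocity
  cannot point out of the segment.\<close>

lemma straight_regular_tangent:
  fixes c :: "real \<Rightarrow> 'a::euclidean_space"
  assumes st: "straight_curve c" and reg: "regular_curve c"
  shows "c 1 \<noteq> c 0" "sgn (velocity c 0) = sgn (c 1 - c 0)"
proof -
  have H: "H2_curve c" and v0: "velocity c 0 \<noteq> 0" using reg by (auto simp: regular_curve_def)
  have "\<exists>u. 0 \<le> u \<and> c t = c 0 + u *\<^sub>R (c 1 - c 0)" if t: "t \<in> {0..1}" for t
  proof -
    have "c t \<in> closed_segment (c 0) (c 1)" using st t by (auto simp: straight_curve_def path_image_def)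
    then obtain u where "0 \<le> u" "c t = (1 - u) *\<^sub>R c 0 + u *\<^sub>R c 1" by (auto simp: closed_segment_def)
    then show ?thesis by (intro exI[of _ u]) (simp add: algebra_simps)
  qed
  then have "\<forall>t\<in>{0..1}. \<exists>u. 0 \<le> u \<and> c t = c 0 + u *\<^sub>R (c 1 - c 0)" by blast
  from bchoice[OF this] obtain u where "\<forall>t\<in>{0..1}. 0 \<le> u t \<and> c t = c 0 + u t *\<^sub>R (c 1 - c 0)" by blast
  then have u: "\<And>t. t \<in> {0..1} \<Longrightarrow> 0 \<le> u t" "\<And>t. t \<in> {0..1} \<Longrightarrow> c t = c 0 + u t *\<^sub>R (c 1 - c 0)" by blast+
  define d where "d = c 1 - c 0"
  show ne: "c 1 \<noteq> c 0"
  proof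
    assume e: "c 1 = c 0"
    have "c t = c 0" if "t \<in> {0..1}" for t using u(2)[OF that] unfolding e by simp
    then have "singular_curve c" unfolding singular_curve_def constant_on_def by blast
    then show False using singular_not_regular[OF reg] by simp
  qed
  define v where "v = velocity c 0"
  have dd: "d \<bullet> d > 0" using ne by (simp add: d_def)
  have deriv: "((\<lambda>t. c t \<bullet> w) has_real_derivative v \<bullet> w) (at 0 within {0..1})" for w
    using bounded_linear.has_vector_derivative[OF bounded_linear_inner_left H2_curveD(1)[OF H, of 0], of w]
    by (simp add: v_def has_real_derivative_iff_has_vector_derivative)
  have orth: "v \<bullet> w = 0" if w: "d \<bullet> w = 0" for w
  proof -
    have e: "c t \<bullet> w = c 0 \<bullet> w" if "t \<in> {0..1}" for t
      using arg_cong[OF u(2)[OF that], of "\<lambda>x. x \<bullet> w"] w by (simp add: d_def[symmetric] inner_add_left)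
    have "((\<lambda>t. c t \<bullet> w) has_vector_derivative v \<bullet> w) (at 0 within {0..1})"
      using deriv by (simp add: has_real_derivative_iff_has_vector_derivative)
    note cw = this
    have "((\<lambda>t. c 0 \<bullet> w) has_vector_derivative v \<bullet> w) (at 0 within {0..1})"
      by (rule has_vector_derivative_transform[OF _ e[symmetric] cw]) simp_all
    then have "velocity (\<lambda>t. c 0 \<bullet> w) 0 = v \<bullet> w" by (rule velocity_eqI) simp
    moreover have "velocity (\<lambda>t. c 0 \<bullet> w) 0 = 0" by (rule velocity_eqI[OF has_vector_derivative_const]) simp
    ultimately show ?thesis by simp
  qed
  define l where "l = (v \<bullet> d) / (d \<bullet> d)"
  have "d \<bullet> (v - l *\<^sub>R d) = 0" using dd by (simp add: inner_diff_right l_def inner_commute)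
  with orth[OF this] have "(v - l *\<^sub>R d) \<bullet> (v - l *\<^sub>R d) = 0" by (simp only: inner_diff_left inner_scaleR_left)
  then have vl: "v = l *\<^sub>R d" by simp
  have "0 \<le> v \<bullet> d"
  proof (rule ccontr)
    assume "\<not> 0 \<le> v \<bullet> d"
    then obtain r where r: "r > 0" "\<And>h. h > 0 \<Longrightarrow> h \<in> {0..1} \<Longrightarrow> h < r \<Longrightarrow> c h \<bullet> d < c 0 \<bullet> d"
      using has_real_derivative_neg_dec_right[OF deriv[of d]] by auto
    define h where "h = min (r/2) 1"
    have h: "h > 0" "h \<in> {0..1}" "h < r" using r(1) by (auto simp: h_def min_def)
    have "c h \<bullet> d = c 0 \<bullet> d + u h * (d \<bullet> d)"
      using arg_cong[OF u(2)[OF h(2)], of "\<lambda>x. x \<bullet> d"] by (simp only: d_def inner_add_left inner_scaleR_left)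
    moreover have "0 \<le> u h * (d \<bullet> d)" by (intro mult_nonneg_nonneg u(1) h(2)) simp
    ultimately show False using r(2)[OF h] by linarith
  qed
  then have "0 \<le> l" using dd by (simp add: l_def)
  moreover have "l \<noteq> 0" using vl v0 by (auto simp: v_def)
  ultimately have "sgn v = sgn d" using vl by (simp add: sgn_scaleR)
  then show "sgn (velocity c 0) = sgn (c 1 - c 0)" by (simp add: v_def d_def)
qed

section \<open>Stratified straight subgraphs\<close>

lemma finite_intervals_subset: "S \<subseteq> {1..N::nat} \<Longrightarrow> finite S"
  by (rule finite_subset) auto

lemma networkI:
  assumes "continuous_map (subgraph_topology N R S) euclidean \<Gamma>"
    "\<And>i. i \<in> S \<Longrightarrow> singular_curve (edge_curve R \<Gamma> i) \<or> regular_curve (edge_curve R \<Gamma> i)"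
  shows "network N R S \<Gamma>"
  using assms by (simp add: network_def)

lemma line_outer_tangent:
  fixes p d :: "'a::euclidean_space"
  assumes "z \<in> {0, 1}"
  shows "outer_tangent z (\<lambda>t. p + t *\<^sub>R d) = (-1) ^ z *\<^sub>R sgn d"
proof -
  have "velocity (\<lambda>t. p + t *\<^sub>R d) (real z) = d" by (rule line_H2(2)) (use assms in auto)
  then show ?thesis by (simp only: outer_tangent_def)
qed

text \<open>The linear maps with vertex positions \<open>P\<close> realize one stratum, whose singular edges are those with
  \<open>s i = 0\<close>. The condition on all nonempty subsets makes it possible to repeat this with the remaining edges.\<close>

lemma stratified_straightI:
  fixes \<tau> D :: "nat \<Rightarrow> nat \<Rightarrow> real ^ 'd"
  assumes R: "N_graph N R" and "S \<subseteq> {1..N}"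
    and "\<And>i. i \<in> S \<Longrightarrow> norm (\<tau> 0 i) = 1 \<and> \<tau> 0 i = - \<tau> 1 i"
    and "\<And>p. p \<in> junctions R S \<Longrightarrow>
      \<exists>Q. rotation_matrix Q \<and> (\<forall>(z, i) \<in> junction_fibre R S p. \<tau> z i = Q *v D z i)"
    and "\<And>S'. S' \<subseteq> S \<Longrightarrow> S' \<noteq> {} \<Longrightarrow> \<exists>(P :: point set \<Rightarrow> real ^ 'd) s.
      (\<forall>i\<in>S'. 0 \<le> s i \<and> P (proj R (1, i)) - P (proj R (0, i)) = s i *\<^sub>R \<tau> 0 i) \<and> (\<exists>i\<in>S'. s i \<noteq> 0)"
  shows "stratified_straight_with N R S D \<tau>"
  using finite_intervals_subset[OF assms(2)] assms(2-5)
proof (induction S rule: finite_psubset_induct)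
  case (psubset S)
  note SN = psubset.prems(1) and \<tau> = psubset.prems(2) and rot = psubset.prems(3) and pot = psubset.prems(4)
  show ?case
  proof (cases "S = {}")
    case True
    then show ?thesis
      unfolding stratified_straight_with_def by (intro exI[of _ 0] exI[of _ "\<lambda>_. {}"]) auto
  next
    case False
    from pot[OF order_refl False] obtain P s where
      s0: "\<And>i. i \<in> S \<Longrightarrow> 0 \<le> s i" and P: "\<And>i. i \<in> S \<Longrightarrow> P (proj R (1, i)) - P (proj R (0, i)) = s i *\<^sub>R \<tau> 0 i"
      and sne: "\<exists>i\<in>S. s i \<noteq> (0::real)" by blast
    define \<kappa> where "\<kappa> i t = P (proj R (0, i)) + t *\<^sub>R (P (proj R (1, i)) - P (proj R (0, i)))" for i t
    have kc: "continuous_on {0..1} (\<kappa> i)" if "i \<in> {1..N}" for i unfolding \<kappa>_def by (intro continuous_intros)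
    have k0: "\<kappa> i 0 = P (proj R (0, i))" if "i \<in> {1..N}" for i by (simp add: \<kappa>_def)
    have k1: "\<kappa> i 1 = P (proj R (1, i))" if "i \<in> {1..N}" for i by (simp add: \<kappa>_def)
    obtain \<Gamma> where edge: "\<And>i t. i \<in> {1..N} \<Longrightarrow> t \<in> {0..1} \<Longrightarrow> edge_curve R \<Gamma> i t = \<kappa> i t"
      and cm: "\<And>S. continuous_map (subgraph_topology N R S) euclidean \<Gamma>"
      using glue_curves[OF R kc k0 k1] by blast
    have E: "\<forall>t\<in>{0..1}. edge_curve R \<Gamma> i t = P (proj R (0, i)) + t *\<^sub>R (s i *\<^sub>R \<tau> 0 i)" if "i \<in> S" for i
    proof
      fix t :: real assume t: "t \<in> {0..1}"
      have "i \<in> {1..N}" using that SN by blast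
      from edge[OF this t] show "edge_curve R \<Gamma> i t = P (proj R (0, i)) + t *\<^sub>R (s i *\<^sub>R \<tau> 0 i)"
        unfolding \<kappa>_def P[OF that] .
    qed
    have \<tau>ne: "\<tau> 0 i \<noteq> 0" if "i \<in> S" for i using \<tau>[OF that] by auto
    have sing: "singular_curve (edge_curve R \<Gamma> i) \<longleftrightarrow> s i = 0" if "i \<in> S" for i
      unfolding singular_curve_cong[OF E[OF that]] line_singular_iff using \<tau>ne[OF that] by simp
    have reg: "regular_curve (edge_curve R \<Gamma> i)" if "i \<in> S" "s i \<noteq> 0" for i
      unfolding regular_curve_cong[OF E[OF that(1)]] using \<tau>ne[OF that(1)] that(2) by (intro line_regular) simp
    define S1 where "S1 = Sing R S \<Gamma>"
    have S1: "S1 = {i \<in> S. s i = 0}" using sing by (auto simp: S1_def Sing_def)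
    have sub: "S1 \<subset> S" using sne by (auto simp: S1)
    have net: "network N R S \<Gamma>" using cm sing reg by (intro networkI) auto
    have straight: "straight_curve (edge_curve R \<Gamma> i)" if "i \<in> S" for i
      unfolding straight_curve_cong[OF E[OF that]] by (rule line_straight)
    have tan: "tangents R S \<Gamma> \<tau>"
      unfolding tangents_def S1_def[symmetric]
    proof (intro conjI ballI)
      fix i z assume i: "i \<in> S - S1" and z: "z \<in> {0, 1::nat}"
      then have iS: "i \<in> S" and si: "s i > 0" using s0[of i] by (auto simp: S1)
      have "sgn (s i *\<^sub>R \<tau> 0 i) = \<tau> 0 i"
        using si conjunct1[OF \<tau>[OF iS]] by (simp add: sgn_div_norm)
      moreover have "outer_tangent z (edge_curve R \<Gamma> i) = (-1) ^ z *\<^sub>R sgn (s i *\<^sub>R \<tau> 0 i)"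
        unfolding outer_tangent_cong[OF E[OF iS] z] by (rule line_outer_tangent[OF z])
      ultimately show "\<tau> z i = outer_tangent z (edge_curve R \<Gamma> i)"
        using z conjunct2[OF \<tau>[OF iS]] by auto
    next
      fix i assume "i \<in> S1"
      then show "norm (\<tau> 0 i) = 1" "\<tau> 0 i = - \<tau> 1 i" using \<tau>[of i] by (auto simp: S1)
    qed
    have ang: "angle_condition_with R S D \<Gamma> \<tau>"
      unfolding angle_condition_with_def using tan rot by blast
    have "stratified_straight_with N R S1 D \<tau>"
    proof (rule psubset.IH[OF sub])
      show "S1 \<subseteq> {1..N}" using sub SN by blast
      show "norm (\<tau> 0 i) = 1 \<and> \<tau> 0 i = - \<tau> 1 i" if "i \<in> S1" for i using \<tau> that sub by blast
      show "\<exists>Q. rotation_matrix Q \<and> (\<forall>(z, i) \<in> junction_fibre R S1 p. \<tau> z i = Q *v D z i)" if "p \<in> junctions R S1" for p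
      proof -
        have "p \<in> junctions R S" using that sub by (auto simp: junctions_def interval_ends_def)
        moreover have "junction_fibre R S1 p \<subseteq> junction_fibre R S p" using sub by (auto simp: junction_fibre_def)
        ultimately show ?thesis using rot[of p] by blast
      qed
      show "\<exists>(P :: point set \<Rightarrow> real ^ 'd) s.
        (\<forall>i\<in>S'. 0 \<le> s i \<and> P (proj R (1, i)) - P (proj R (0, i)) = s i *\<^sub>R \<tau> 0 i) \<and> (\<exists>i\<in>S'. s i \<noteq> 0)"
        if "S' \<subseteq> S1" "S' \<noteq> {}" for S'
        using pot[of S'] that sub by blast
    qed
    then obtain q H \<Sigma> where H: "H 0 = S1" "H q = {}" and lvl: "\<forall>j<q. H (Suc j) \<subset> H j \<and>
           network N R (H j) (\<Sigma> j) \<and> angle_condition_with R (H j) D (\<Sigma> j) \<tau> \<and>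
           (\<forall>i \<in> H j - Sing R (H j) (\<Sigma> j). straight_curve (edge_curve R (\<Sigma> j) i)) \<and>
           H (Suc j) = Sing R (H j) (\<Sigma> j)"
      unfolding stratified_straight_with_def by blast
    show ?thesis
      unfolding stratified_straight_with_def
    proof (intro exI[of _ "Suc q"] exI[of _ "case_nat S H"] exI[of _ "case_nat \<Gamma> \<Sigma>"] conjI allI impI)
      fix j assume j: "j < Suc q"
      show "case_nat S H (Suc j) \<subset> case_nat S H j" using j lvl sub by (cases j) (auto simp: H)
      show "network N R (case_nat S H j) (case_nat \<Gamma> \<Sigma> j)" using j lvl net by (cases j) auto
      show "angle_condition_with R (case_nat S H j) D (case_nat \<Gamma> \<Sigma> j) \<tau>" using j lvl ang by (cases j) auto
      show "\<forall>i\<in>case_nat S H j - Sing R (case_nat S H j) (case_nat \<Gamma> \<Sigma> j). straight_curve (edge_curve R (case_nat \<Gamma> \<Sigma> j) i)"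
        using j lvl straight by (cases j) auto
      show "case_nat S H (Suc j) = Sing R (case_nat S H j) (case_nat \<Gamma> \<Sigma> j)"
        using j lvl by (cases j) (auto simp: H S1_def)
    qed (simp_all add: H)
  qed
qed

lemma stratified_straightE:
  assumes "stratified_straight_with N R S D \<tau>" "S \<noteq> {}"
  obtains \<Sigma> where "Sing R S \<Sigma> \<subset> S" "network N R S \<Sigma>" "tangents R S \<Sigma> \<tau>"
    "\<And>i. i \<in> S - Sing R S \<Sigma> \<Longrightarrow> straight_curve (edge_curve R \<Sigma> i)"
    "stratified_straight_with N R (Sing R S \<Sigma>) D \<tau>"
proof -
  obtain q H \<Sigma> where H: "H 0 = S" "H q = {}" and lvl: "\<And>j. j < q \<Longrightarrow> H (Suc j) \<subset> H j \<and>
         network N R (H j) (\<Sigma> j) \<and> angle_condition_with R (H j) D (\<Sigma> j) \<tau> \<and>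
         (\<forall>i \<in> H j - Sing R (H j) (\<Sigma> j). straight_curve (edge_curve R (\<Sigma> j) i)) \<and>
         H (Suc j) = Sing R (H j) (\<Sigma> j)"
    using assms(1) unfolding stratified_straight_with_def by blast
  obtain q' where q: "q = Suc q'" using H assms(2) by (cases q) auto
  have 0: "H 1 \<subset> S" "network N R S (\<Sigma> 0)" "angle_condition_with R S D (\<Sigma> 0) \<tau>"
    "\<forall>i \<in> S - H 1. straight_curve (edge_curve R (\<Sigma> 0) i)" "H 1 = Sing R S (\<Sigma> 0)"
    using lvl[of 0] by (auto simp: q H)
  have "stratified_straight_with N R (H 1) D \<tau>"
    unfolding stratified_straight_with_def
  proof (intro exI[of _ q'] exI[of _ "\<lambda>j. H (Suc j)"] exI[of _ "\<lambda>j. \<Sigma> (Suc j)"] conjI[of "H (Suc 0) = H 1"] conjI[of "H (Suc q') = {}"] allI impI)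
    show "H (Suc q') = {}" using H(2) q by simp
    fix j assume "j < q'"
    then have "Suc j < q" using q by simp
    then show "H (Suc (Suc j)) \<subset> H (Suc j) \<and>
         network N R (H (Suc j)) (\<Sigma> (Suc j)) \<and> angle_condition_with R (H (Suc j)) D (\<Sigma> (Suc j)) \<tau> \<and>
         (\<forall>i \<in> H (Suc j) - Sing R (H (Suc j)) (\<Sigma> (Suc j)). straight_curve (edge_curve R (\<Sigma> (Suc j)) i)) \<and>
         H (Suc (Suc j)) = Sing R (H (Suc j)) (\<Sigma> (Suc j))"
      by (rule lvl)
  qed simp
  then show ?thesis
    using that[of "\<Sigma> 0"] 0 unfolding angle_condition_with_def by auto
qed

section \<open>Perturbations of class C2\<close>

text \<open>Closeness in C2 is stronger than what weak convergence in H2 needs, but it is transitive,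
  controls the energy of regular curves and is easily checked for the perturbations used
  below.\<close>

definition C2_close :: "real \<Rightarrow> (real \<Rightarrow> 'a::euclidean_space) \<Rightarrow> (real \<Rightarrow> 'a) \<Rightarrow> bool" where
  "C2_close \<epsilon> c e \<longleftrightarrow> (\<exists>q q1 q2. continuous_on {0..1} q2 \<and> (\<forall>t\<in>{0..1}. e t = c t + q t \<and>
     (q has_vector_derivative q1 t) (at t within {0..1}) \<and>
     (q1 has_vector_derivative q2 t) (at t within {0..1}) \<and>
     norm (q t) \<le> \<epsilon> \<and> norm (q1 t) \<le> \<epsilon> \<and> norm (q2 t) \<le> \<epsilon>))"

lemma C2_close_refl: "0 \<le> \<epsilon> \<Longrightarrow> C2_close \<epsilon> c c"
  unfolding C2_close_def
  by (intro exI[of _ "\<lambda>_. 0"]) (auto intro!: derivative_eq_intros)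

lemma C2_close_trans:
  assumes "C2_close \<delta> c e" "C2_close \<epsilon> e f"
  shows "C2_close (\<delta> + \<epsilon>) c f"
proof -
  obtain p p1 p2 where p: "continuous_on {0..1} p2" "\<And>t. t \<in> {0..1} \<Longrightarrow> e t = c t + p t \<and>
     (p has_vector_derivative p1 t) (at t within {0..1}) \<and> (p1 has_vector_derivative p2 t) (at t within {0..1}) \<and>
     norm (p t) \<le> \<delta> \<and> norm (p1 t) \<le> \<delta> \<and> norm (p2 t) \<le> \<delta>"
    using assms(1) unfolding C2_close_def by blast
  obtain q q1 q2 where q: "continuous_on {0..1} q2" "\<And>t. t \<in> {0..1} \<Longrightarrow> f t = e t + q t \<and>
     (q has_vector_derivative q1 t) (at t within {0..1}) \<and> (q1 has_vector_derivative q2 t) (at t within {0..1}) \<and>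
     norm (q t) \<le> \<epsilon> \<and> norm (q1 t) \<le> \<epsilon> \<and> norm (q2 t) \<le> \<epsilon>"
    using assms(2) unfolding C2_close_def by blast
  show ?thesis
    unfolding C2_close_def
  proof (rule exI[of _ "\<lambda>t. p t + q t"], rule exI[of _ "\<lambda>t. p1 t + q1 t"],
      rule exI[of _ "\<lambda>t. p2 t + q2 t"], intro conjI ballI)
    show "continuous_on {0..1} (\<lambda>t. p2 t + q2 t)" using p(1) q(1) by (intro continuous_intros)
    fix t :: real assume t: "t \<in> {0..1}"
    note P = p(2)[OF t] and Q = q(2)[OF t]
    show "f t = c t + (p t + q t)" using P Q by simp
    show "((\<lambda>t. p t + q t) has_vector_derivative p1 t + q1 t) (at t within {0..1})"
      "((\<lambda>t. p1 t + q1 t) has_vector_derivative p2 t + q2 t) (at t within {0..1})"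
      using P Q by (simp_all add: has_vector_derivative_add)
    show "norm (p t + q t) \<le> \<delta> + \<epsilon>" "norm (p1 t + q1 t) \<le> \<delta> + \<epsilon>" "norm (p2 t + q2 t) \<le> \<delta> + \<epsilon>"
      using P Q by (simp_all add: norm_triangle_mono)
  qed
qed

lemma C2_closeD:
  fixes c e :: "real \<Rightarrow> 'a::euclidean_space"
  assumes H: "H2_curve c" and close: "C2_close \<epsilon> c e"
  shows "\<exists>q q1 q2. H2_curve e \<and> (\<forall>t\<in>{0..1}. e t = c t + q t \<and> velocity e t = velocity c t + q1 t \<and>
      norm (q t) \<le> \<epsilon> \<and> norm (q1 t) \<le> \<epsilon> \<and> norm (q2 t) \<le> \<epsilon>) \<and>
    (AE t in lborel01. acceleration e t = acceleration c t + q2 t) \<and>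
    continuous_on {0..1} q \<and> continuous_on {0..1} q1 \<and> continuous_on {0..1} q2"
proof -
  obtain q q1 q2 where q: "continuous_on {0..1} q2" "\<And>t. t \<in> {0..1} \<Longrightarrow> e t = c t + q t \<and>
     (q has_vector_derivative q1 t) (at t within {0..1}) \<and> (q1 has_vector_derivative q2 t) (at t within {0..1}) \<and>
     norm (q t) \<le> \<epsilon> \<and> norm (q1 t) \<le> \<epsilon> \<and> norm (q2 t) \<le> \<epsilon>"
    using close unfolding C2_close_def by blast
  have e: "\<forall>t\<in>{0..1}. e t = c t + q t" using q(2) by blast
  have d: "((\<lambda>t. c t + q t) has_vector_derivative velocity c t + q1 t) (at t within {0..1})" if "t \<in> {0..1}" for t
    using H2_curveD(1)[OF H that] q(2)[OF that] by (blast intro: has_vector_derivative_add)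
  have L: "L2 lborel01 (\<lambda>t. acceleration c t + q2 t)"
    by (intro L2_add H2_curveD(2)[OF H] continuous_L2 q(1))
  have v: "velocity c t + q1 t = velocity c 0 + q1 0 + (LINT s:{0..t}|lborel. acceleration c s + q2 s)" if t: "t \<in> {0..1}" for t
  proof -
    have si: "set_integrable lborel {0..t} (acceleration c)" "set_integrable lborel {0..t} q2"
      using t L2_integrable[OF finite_measure_lborel01 H2_curveD(2)[OF H]] continuous_integrable_lborel01[OF q(1)]
      by (auto intro: integrable_lborel01_subinterval)
    have "(q2 has_integral q1 t - q1 0) {0..t}"
    proof (rule fundamental_theorem_of_calculus)
      fix x assume x: "x \<in> {0..t}"
      have "x \<in> {0..1}" "{0..t} \<subseteq> {0..1}" using x t by auto
      then show "(q1 has_vector_derivative q2 x) (at x within {0..t})"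
        using q(2)[of x] has_vector_derivative_within_subset by blast
    qed (use t in auto)
    then have "(LINT s:{0..t}|lborel. q2 s) = q1 t - q1 0"
      using t set_LINT_eq_integral(1)[OF continuous_integrable_lborel01[OF q(1)], of 0 t] by (simp add: integral_unique)
    then show ?thesis
      using H2_curveD(3)[OF H t] set_integral_add(2)[OF si] by (simp add: algebra_simps)
  qed
  have dc: "continuous_on {0..1} q" "continuous_on {0..1} q1"
    unfolding continuous_on_eq_continuous_within using q(2) has_vector_derivative_continuous by blast+
  have eH: "H2_curve e" unfolding H2_curve_cong[OF e] by (rule H2_curveI(1)[OF d L v])
  have ev: "velocity e t = velocity c t + q1 t" if "t \<in> {0..1}" for t
    unfolding velocity_cong[OF e that] by (rule H2_curveI(2)[OF d L v]) (use that in simp_all)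
  have ea: "AE t in lborel01. acceleration e t = acceleration c t + q2 t"
    unfolding acceleration_cong[OF e] by (rule H2_curveI(3)[OF d L v])
  have all: "\<forall>t\<in>{0..1}. e t = c t + q t \<and> velocity e t = velocity c t + q1 t \<and>
      norm (q t) \<le> \<epsilon> \<and> norm (q1 t) \<le> \<epsilon> \<and> norm (q2 t) \<le> \<epsilon>"
    using q(2) ev by blast
  show ?thesis
    by (rule exI[of _ q], rule exI[of _ q1], rule exI[of _ q2]) (use eH ea all q(1) dc in blast)
qed

lemma integral_lborel01_tendsto:
  fixes f :: "nat \<Rightarrow> real \<Rightarrow> 'a::euclidean_space"
  assumes f: "\<And>n. f n \<in> borel_measurable lborel01" and g: "g \<in> borel_measurable lborel01"
    and lim: "\<And>t. t \<in> {0..1} \<Longrightarrow> (\<lambda>n. f n t) \<longlonglongrightarrow> g t"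
    and B: "\<And>n t. t \<in> {0..1} \<Longrightarrow> norm (f n t) \<le> B"
  shows "(\<lambda>n. LINT t|lborel01. f n t) \<longlonglongrightarrow> (LINT t|lborel01. g t)"
proof (rule integral_dominated_convergence[where w="\<lambda>_. B"])
  show "integrable lborel01 (\<lambda>_. B)" by (rule finite_measure.integrable_const[OF finite_measure_lborel01])
  show "AE t in lborel01. (\<lambda>n. f n t) \<longlonglongrightarrow> g t" using lim by (intro AE_I2) simp
  show "AE t in lborel01. norm (f n t) \<le> B" for n using B by (intro AE_I2) simp
qed (fact f g)+

lemma bending_energy_eq_dsgn:
  "bending_energy c = (LINT t|lborel01. (norm (dsgn (velocity c t) (acceleration c t)))\<^sup>2 / norm (velocity c t))"
proof -
  have "(norm (curvature c t))\<^sup>2 * norm (velocity c t)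
      = (norm (dsgn (velocity c t) (acceleration c t)))\<^sup>2 / norm (velocity c t)" for t
    unfolding speed_curvature_eq_dsgn[symmetric]
    by (cases "velocity c t = 0") (simp_all add: power_mult_distrib power2_eq_square)
  then show ?thesis by (simp add: bending_energy_def integral_lborel01)
qed

lemma bending_density_measurable:
  assumes "regular_curve c"
  shows "(\<lambda>t. (norm (dsgn (velocity c t) (acceleration c t)))\<^sup>2 / norm (velocity c t)) \<in> borel_measurable lborel01"
proof -
  have [measurable]: "(\<lambda>t. dsgn (velocity c t) (acceleration c t)) \<in> borel_measurable lborel01"
    by (rule L2_measurable[OF tangent_derivative_L2[OF assms]])
  have [measurable]: "velocity c \<in> borel_measurable lborel01"
    using assms by (intro continuous_measurable_lborel01 H2_velocity_continuous) (simp add: regular_curve_def)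
  show ?thesis by measurable
qed

text \<open>The speeds stay away from zero, so dominated convergence applies to the formula for the
  bending energy in terms of \<open>dsgn\<close>.\<close>

lemma C2_close_energy_tendsto:
  fixes c :: "real \<Rightarrow> 'a::euclidean_space"
  assumes reg: "regular_curve c" and close: "\<And>n. C2_close (\<epsilon> n) c (e n)" and \<epsilon>: "\<epsilon> \<longlonglongrightarrow> 0"
  shows "\<forall>\<^sub>F n in sequentially. regular_curve (e n)"
    "(\<lambda>n. bending_energy (e n)) \<longlonglongrightarrow> bending_energy c"
    "(\<lambda>n. curve_length (e n)) \<longlonglongrightarrow> curve_length c"
proof -
  have H: "H2_curve c" using reg by (simp add: regular_curve_def)
  obtain \<kappa> K where \<kappa>: "0 < \<kappa>" "\<And>t. t \<in> {0..1} \<Longrightarrow> \<kappa> \<le> norm (velocity c t)"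
    and K: "\<And>t. t \<in> {0..1} \<Longrightarrow> norm (velocity c t) \<le> K"
    using regular_curve_speed_bounds[OF reg] by metis
  have "\<forall>n. \<exists>q1 q2. H2_curve (e n) \<and> (\<forall>t\<in>{0..1}. velocity (e n) t = velocity c t + q1 t \<and> norm (q1 t) \<le> \<epsilon> n \<and> norm (q2 t) \<le> \<epsilon> n)
      \<and> (AE t in lborel01. acceleration (e n) t = acceleration c t + q2 t)"
    using C2_closeD[OF H close] by blast
  from choice[OF this] obtain q1 where "\<forall>n. \<exists>q2. H2_curve (e n) \<and> (\<forall>t\<in>{0..1}. velocity (e n) t = velocity c t + q1 n t \<and> norm (q1 n t) \<le> \<epsilon> n \<and> norm (q2 t) \<le> \<epsilon> n)
      \<and> (AE t in lborel01. acceleration (e n) t = acceleration c t + q2 t)" by blast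
  from choice[OF this] obtain q2 where all: "\<forall>n. H2_curve (e n) \<and> (\<forall>t\<in>{0..1}. velocity (e n) t = velocity c t + q1 n t \<and> norm (q1 n t) \<le> \<epsilon> n \<and> norm (q2 n t) \<le> \<epsilon> n)
      \<and> (AE t in lborel01. acceleration (e n) t = acceleration c t + q2 n t)" by blast
  have eH: "\<And>n. H2_curve (e n)"
    and q: "\<And>n. \<forall>t\<in>{0..1}. velocity (e n) t = velocity c t + q1 n t \<and> norm (q1 n t) \<le> \<epsilon> n \<and> norm (q2 n t) \<le> \<epsilon> n"
    and acc: "\<And>n. AE t in lborel01. acceleration (e n) t = acceleration c t + q2 n t"
    using all by blast+
  obtain n0 where n0: "\<And>n. n \<ge> n0 \<Longrightarrow> \<epsilon> n < min (\<kappa>/2) 1"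
    using order_tendstoD(2)[OF \<epsilon>, of "min (\<kappa>/2) 1"] \<kappa>(1) by (auto simp: eventually_sequentially)
  have vlow: "\<kappa> / 2 \<le> norm (velocity (e n) t)" if "n \<ge> n0" "t \<in> {0..1}" for n t
  proof -
    have "norm (velocity c t) \<le> norm (velocity c t + q1 n t) + norm (q1 n t)"
      using norm_triangle_ineq4[of "velocity c t + q1 n t" "q1 n t"] by simp
    then show ?thesis using \<kappa>(2)[OF that(2)] n0[OF that(1)] q[of n] that(2) by fastforce
  qed
  have eR: "regular_curve (e n)" if "n \<ge> n0" for n
  proof -
    have "velocity (e n) t \<noteq> 0" if "t \<in> {0..1}" for t
      using vlow[OF \<open>n \<ge> n0\<close> that] \<kappa>(1) by auto
    then show ?thesis using eH by (simp add: regular_curve_def)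
  qed
  then show "\<forall>\<^sub>F n in sequentially. regular_curve (e n)" by (auto simp: eventually_sequentially)
  have q1l: "(\<lambda>n. q1 n t) \<longlonglongrightarrow> 0" and q2l: "(\<lambda>n. q2 n t) \<longlonglongrightarrow> 0" if "t \<in> {0..1}" for t
    using q that by (auto intro!: Lim_null_comparison[OF _ \<epsilon>] always_eventually)
  have vl: "(\<lambda>n. velocity (e n) t) \<longlonglongrightarrow> velocity c t" if "t \<in> {0..1}" for t
    using tendsto_add[OF tendsto_const[of "velocity c t"] q1l[OF that]] q that by (simp del: atLeastAtMost_iff)
  have sp: "(\<lambda>t. norm (velocity f t)) \<in> borel_measurable lborel01" if "H2_curve f" for f :: "real \<Rightarrow> 'a"
    by (intro continuous_measurable_lborel01 continuous_intros H2_velocity_continuous that)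
  have "(\<lambda>n. LINT t|lborel01. norm (velocity (e (n + n0)) t)) \<longlonglongrightarrow> (LINT t|lborel01. norm (velocity c t))"
  proof (rule integral_lborel01_tendsto[where B="K + 1"])
    fix n and t :: real assume t: "t \<in> {0..1}"
    show "(\<lambda>n. norm (velocity (e (n + n0)) t)) \<longlonglongrightarrow> norm (velocity c t)"
      using tendsto_norm[OF vl[OF t]] by (rule LIMSEQ_ignore_initial_segment)
    have "norm (velocity (e (n + n0)) t) \<le> norm (velocity c t) + norm (q1 (n + n0) t)"
      using q[of "n + n0"] t norm_triangle_ineq[of "velocity c t" "q1 (n + n0) t"] by simp
    also have "\<dots> \<le> K + 1" using K[OF t] n0[of "n + n0"] q[of "n + n0"] t by fastforce
    finally show "norm (norm (velocity (e (n + n0)) t)) \<le> K + 1" by simp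
  qed (intro sp eH H)+
  then show "(\<lambda>n. curve_length (e n)) \<longlonglongrightarrow> curve_length c"
    unfolding curve_length_def integral_lborel01[symmetric] by (rule LIMSEQ_offset)
  let ?f = "\<lambda>f t. (norm (dsgn (velocity f t) (acceleration f t)))\<^sup>2 / norm (velocity f t)"
  have aint: "integrable lborel01 (\<lambda>t. (norm (acceleration c t))\<^sup>2)" using H2_curveD(2)[OF H] by (simp add: L2_def)
  have allacc: "AE t in lborel01. \<forall>n. acceleration (e n) t = acceleration c t + q2 n t"
    using acc by (simp add: AE_all_countable)
  have sU: "AE t in lborel01. t \<in> {0..1}" using AE_space[of lborel01] by simp
  have "(\<lambda>n. LINT t|lborel01. ?f (e (n + n0)) t) \<longlonglongrightarrow> (LINT t|lborel01. ?f c t)"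
  proof (rule integral_dominated_convergence[where w="\<lambda>t. 32 / \<kappa>^3 * (2 * (norm (acceleration c t))\<^sup>2 + 2)"])
    show "?f c \<in> borel_measurable lborel01" by (rule bending_density_measurable[OF reg])
    show "?f (e (n + n0)) \<in> borel_measurable lborel01" for n by (rule bending_density_measurable[OF eR]) simp
    show "integrable lborel01 (\<lambda>t. 32 / \<kappa>^3 * (2 * (norm (acceleration c t))\<^sup>2 + 2))"
      using aint finite_measure.integrable_const[OF finite_measure_lborel01]
      by (intro integrable_mult_right Bochner_Integration.integrable_add) auto
    show "AE t in lborel01. (\<lambda>n. ?f (e (n + n0)) t) \<longlonglongrightarrow> ?f c t"
      using allacc sU
    proof eventually_elim
      case (elim t)
      have v0: "velocity c t \<noteq> 0" using regular_curve_nonzero[OF reg elim(2)] .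
      have al: "(\<lambda>n. acceleration (e n) t) \<longlonglongrightarrow> acceleration c t"
        using tendsto_add[OF tendsto_const[of "acceleration c t"] q2l[OF elim(2)]] elim(1) by simp
      have "(\<lambda>n. ?f (e n) t) \<longlonglongrightarrow> ?f c t"
        unfolding dsgn_def using v0 by (intro tendsto_intros vl elim(2) al) auto
      then show ?case by (rule LIMSEQ_ignore_initial_segment)
    qed
    show "AE t in lborel01. norm (?f (e (n + n0)) t) \<le> 32 / \<kappa>^3 * (2 * (norm (acceleration c t))\<^sup>2 + 2)" for n
      using allacc sU
    proof eventually_elim
      case (elim t)
      define m v a where "m = n + n0" "v = velocity (e m) t" "a = acceleration (e m) t"
      have vm: "\<kappa> / 2 \<le> norm v" using vlow[of m t] elim(2) by (simp add: m_v_a_def)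
      have vp: "norm v > 0" using vm \<kappa>(1) by linarith
      have "norm (q2 m t) \<le> 1" using q[of m] n0[of m] elim(2) by (fastforce simp: m_v_a_def)
      then have "norm a \<le> norm (acceleration c t) + 1"
        using norm_triangle_ineq[of "acceleration c t" "q2 m t"] elim(1) by (simp add: m_v_a_def)
      then have "(norm a)\<^sup>2 \<le> (norm (acceleration c t) + 1)\<^sup>2" by (intro power_mono) auto
      also have "\<dots> \<le> 2 * (norm (acceleration c t))\<^sup>2 + 2"
        using sum_squares_bound[of "norm (acceleration c t)" 1] by (simp add: power2_sum)
      finally have a2: "(norm a)\<^sup>2 \<le> 2 * (norm (acceleration c t))\<^sup>2 + 2" .
      have "2 / norm v \<le> 2 / (\<kappa> / 2)" using vm \<kappa>(1) by (intro frac_le) auto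
      then have "norm (dsgn v a) \<le> 4 / \<kappa> * norm a"
        using norm_dsgn_le[of v a] mult_right_mono[of "2 / norm v" "4 / \<kappa>" "norm a"] by simp
      then have "(norm (dsgn v a))\<^sup>2 \<le> (4 / \<kappa> * norm a)\<^sup>2" by (intro power_mono) auto
      then have "(norm (dsgn v a))\<^sup>2 / norm v \<le> (4 / \<kappa> * norm a)\<^sup>2 / (\<kappa> / 2)"
        using vm \<kappa>(1) by (intro frac_le) auto
      also have "\<dots> = 32 / \<kappa>^3 * (norm a)\<^sup>2"
        using \<kappa>(1) by (simp add: power_mult_distrib power_divide field_simps power2_eq_square power3_eq_cube)
      also have "\<dots> \<le> 32 / \<kappa>^3 * (2 * (norm (acceleration c t))\<^sup>2 + 2)"
        using a2 \<kappa>(1) by (intro mult_left_mono) auto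
      finally show ?case by (simp add: m_v_a_def)
    qed
  qed
  then show "(\<lambda>n. bending_energy (e n)) \<longlonglongrightarrow> bending_energy c"
    unfolding bending_energy_eq_dsgn by (rule LIMSEQ_offset)
qed

lemma C2_close_weakly_converges:
  fixes c :: "real \<Rightarrow> 'a::euclidean_space"
  assumes H: "H2_curve c" and close: "\<And>n. C2_close (\<epsilon> n) c (e n)" and \<epsilon>: "\<epsilon> \<longlonglongrightarrow> 0"
  shows "weakly_converges_H2 e c"
proof -
  have main: "H2_curve (e n) \<and> (\<forall>f. H2_curve f \<longrightarrow> \<bar>H2_inner (e n) f - H2_inner c f\<bar> \<le> 3 * \<epsilon> n * norm_L2 lborel01 (jet f))" for n
  proof -
    obtain q q1 q2 where eH: "H2_curve (e n)"
      and b: "\<forall>t\<in>{0..1}. e n t = c t + q t \<and> velocity (e n) t = velocity c t + q1 t \<and>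
        norm (q t) \<le> \<epsilon> n \<and> norm (q1 t) \<le> \<epsilon> n \<and> norm (q2 t) \<le> \<epsilon> n"
      and a: "AE t in lborel01. acceleration (e n) t = acceleration c t + q2 t"
      and ct: "continuous_on {0..1} q" "continuous_on {0..1} q1" "continuous_on {0..1} q2"
      using C2_closeD[OF H close[of n]] by blast
    define Q where "Q t = (q t, q1 t, q2 t)" for t
    have QL: "L2 lborel01 Q" unfolding Q_def by (intro continuous_L2 continuous_intros ct)
    have QB: "norm_L2 lborel01 Q \<le> 3 * \<epsilon> n"
    proof (rule norm_L2_bounded_le[OF QL])
      fix t :: real assume t: "t \<in> {0..1}"
      have "norm (Q t) \<le> norm (q t) + (norm (q1 t) + norm (q2 t))"
        unfolding Q_def using norm_Pair_le[of "q t" "(q1 t, q2 t)"] norm_Pair_le[of "q1 t" "q2 t"] by linarith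
      moreover have "norm (q t) \<le> \<epsilon> n" "norm (q1 t) \<le> \<epsilon> n" "norm (q2 t) \<le> \<epsilon> n" using b t by blast+
      ultimately show "norm (Q t) \<le> 3 * \<epsilon> n" by linarith
    qed
    have "AE t in lborel01. t \<in> {0..1}" using AE_space[of lborel01] by simp
    with a have AEj: "AE t in lborel01. jet (e n) t = jet c t + Q t"
    proof eventually_elim
      case (elim t)
      have "e n t = c t + q t" "velocity (e n) t = velocity c t + q1 t" using b elim(2) by blast+
      with elim(1) show ?case by (simp add: jet_def Q_def)
    qed
    have "\<bar>H2_inner (e n) f - H2_inner c f\<bar> \<le> 3 * \<epsilon> n * norm_L2 lborel01 (jet f)" if f: "H2_curve f" for f
    proof -
      have "inner_L2 lborel01 (jet (e n)) (jet f) = inner_L2 lborel01 (\<lambda>t. jet c t + Q t) (jet f)"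
        by (rule inner_L2_cong_AE[OF L2_jet[OF eH] L2_add[OF L2_jet[OF H] QL] L2_jet[OF f] AEj])
      also have "\<dots> = inner_L2 lborel01 (jet c) (jet f) + inner_L2 lborel01 Q (jet f)"
        using inner_L2_lincomb[OF L2_jet[OF H] QL L2_jet[OF f], of 1 1] by simp
      finally have "\<bar>H2_inner (e n) f - H2_inner c f\<bar> = \<bar>inner_L2 lborel01 Q (jet f)\<bar>" by (simp add: H2_inner_eq_ip)
      also have "\<dots> \<le> norm_L2 lborel01 Q * norm_L2 lborel01 (jet f)" by (rule inner_L2_Cauchy_Schwarz[OF QL L2_jet[OF f]])
      also have "\<dots> \<le> 3 * \<epsilon> n * norm_L2 lborel01 (jet f)" using QB by (intro mult_right_mono) auto
      finally show ?thesis .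
    qed
    with eH show ?thesis by blast
  qed
  have "(\<lambda>n. H2_inner (e n) f) \<longlonglongrightarrow> H2_inner c f" if f: "H2_curve f" for f
  proof -
    have "(\<lambda>n. 3 * \<epsilon> n * norm_L2 lborel01 (jet f)) \<longlonglongrightarrow> 3 * 0 * norm_L2 lborel01 (jet f)" by (intro tendsto_intros \<epsilon>)
    then have g0: "(\<lambda>n. 3 * \<epsilon> n * norm_L2 lborel01 (jet f)) \<longlonglongrightarrow> 0" by simp
    have "\<forall>\<^sub>F n in sequentially. norm (H2_inner (e n) f - H2_inner c f) \<le> 3 * \<epsilon> n * norm_L2 lborel01 (jet f)"
      using main f unfolding real_norm_def by (intro always_eventually allI) blast
    from Lim_null_comparison[OF this g0] have "(\<lambda>n. H2_inner (e n) f - H2_inner c f) \<longlonglongrightarrow> 0" .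
    then show ?thesis by (rule LIM_zero_cancel)
  qed
  then show ?thesis using main H unfolding weakly_converges_H2_def by blast
qed

section \<open>Recovery sequences\<close>

lemma C2_close_cong:
  assumes "\<forall>t\<in>{0..1}. e t = f t"
  shows "C2_close \<epsilon> c e \<longleftrightarrow> C2_close \<epsilon> c f"
  unfolding C2_close_def
  by (intro ex_cong1 conj_cong refl ball_cong) (use assms in auto)

lemma C2_close_mono: "C2_close \<delta> c e \<Longrightarrow> \<delta> \<le> \<epsilon> \<Longrightarrow> C2_close \<epsilon> c e"
  unfolding C2_close_def by (meson order_trans)

lemma C2_close_scaled_direction:
  fixes p d :: "'a::euclidean_space" and \<alpha> \<alpha>' \<alpha>'' :: "real \<Rightarrow> real"
  assumes \<delta>: "0 \<le> \<delta>"
    and d1: "\<And>t. (\<alpha> has_real_derivative \<alpha>' t) (at t)"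
    and d2: "\<And>t. (\<alpha>' has_real_derivative \<alpha>'' t) (at t)" and c: "continuous_on {0..1} \<alpha>''"
    and b: "\<And>t. t \<in> {0..1} \<Longrightarrow> \<bar>\<alpha> t\<bar> \<le> 6 \<and> \<bar>\<alpha>' t\<bar> \<le> 6 \<and> \<bar>\<alpha>'' t\<bar> \<le> 6"
  shows "C2_close (\<delta> * (norm p + 6 * norm d)) c (\<lambda>t. c t + \<delta> *\<^sub>R (p + \<alpha> t *\<^sub>R d))"
  unfolding C2_close_def
proof (rule exI[of _ "\<lambda>t. \<delta> *\<^sub>R (p + \<alpha> t *\<^sub>R d)"], rule exI[of _ "\<lambda>t. \<delta> *\<^sub>R (\<alpha>' t *\<^sub>R d)"],
    rule exI[of _ "\<lambda>t. \<delta> *\<^sub>R (\<alpha>'' t *\<^sub>R d)"], intro conjI ballI)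
  show "continuous_on {0..1} (\<lambda>t. \<delta> *\<^sub>R (\<alpha>'' t *\<^sub>R d))" by (intro continuous_intros c)
  fix t :: real assume t: "t \<in> {0..1}"
  show "((\<lambda>t. \<delta> *\<^sub>R (p + \<alpha> t *\<^sub>R d)) has_vector_derivative \<delta> *\<^sub>R (\<alpha>' t *\<^sub>R d)) (at t within {0..1})"
    using has_field_derivative_at_within[OF d1[of t]] by (auto intro!: derivative_eq_intros)
  show "((\<lambda>t. \<delta> *\<^sub>R (\<alpha>' t *\<^sub>R d)) has_vector_derivative \<delta> *\<^sub>R (\<alpha>'' t *\<^sub>R d)) (at t within {0..1})"
    using has_field_derivative_at_within[OF d2[of t]] by (auto intro!: derivative_eq_intros)
  have *: "norm (\<delta> *\<^sub>R (x *\<^sub>R d)) \<le> \<delta> * (norm p + 6 * norm d)" if "\<bar>x\<bar> \<le> 6" for x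
  proof -
    have "\<bar>x\<bar> * norm d \<le> norm p + 6 * norm d" using mult_right_mono[OF that norm_ge_zero[of d]] norm_ge_zero[of p] by linarith
    from mult_left_mono[OF this \<delta>] show ?thesis using \<delta> by (simp add: abs_mult mult.assoc)
  qed
  show "norm (\<delta> *\<^sub>R (\<alpha>' t *\<^sub>R d)) \<le> \<delta> * (norm p + 6 * norm d)" "norm (\<delta> *\<^sub>R (\<alpha>'' t *\<^sub>R d)) \<le> \<delta> * (norm p + 6 * norm d)"
    using * b[OF t] by blast+
  have "norm (p + \<alpha> t *\<^sub>R d) \<le> norm p + \<bar>\<alpha> t\<bar> * norm d" using norm_triangle_ineq[of p "\<alpha> t *\<^sub>R d"] by simp
  also have "\<dots> \<le> norm p + 6 * norm d" using b[OF t] by (intro add_left_mono mult_right_mono) auto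
  finally show "norm (\<delta> *\<^sub>R (p + \<alpha> t *\<^sub>R d)) \<le> \<delta> * (norm p + 6 * norm d)" using \<delta> by (simp add: mult_left_mono)
qed simp

lemma singular_H2:
  assumes "singular_curve c"
  shows "H2_curve c"
proof -
  obtain y where y: "\<forall>t\<in>{0..1}. c t = y" using assms by (auto simp: singular_curve_def constant_on_def)
  then have "\<forall>t\<in>{0..1}. c t = y + t *\<^sub>R 0" by simp
  from H2_curve_cong[OF this] line_H2(1) show ?thesis by blast
qed

lemma network_edge_H2: "network N R S \<Gamma> \<Longrightarrow> i \<in> S \<Longrightarrow> H2_curve (edge_curve R \<Gamma> i)"
  using singular_H2 by (auto simp: network_def regular_curve_def)

text \<open>Interpolation between \<open>0\<close> and \<open>1\<close>: linear on collapsed edges, which become straight segments, and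
  by a cubic with slope zero at both ends on regular edges, which keep their end tangents.\<close>

definition blend :: "bool \<Rightarrow> real \<Rightarrow> real" where
  "blend b t = (if b then t else 3 * t^2 - 2 * t^3)"

lemma blend_C2_close:
  fixes p d :: "'a::euclidean_space"
  assumes "0 \<le> \<delta>"
  shows "C2_close (\<delta> * (norm p + 6 * norm d)) c (\<lambda>t. c t + \<delta> *\<^sub>R (p + blend b t *\<^sub>R d))"
proof (cases b)
  case True
  show ?thesis
    using C2_close_scaled_direction[OF assms, of "\<lambda>t. t" "\<lambda>_. 1" "\<lambda>_. 0" p d c] True by (simp add: blend_def)
next
  case False
  show ?thesis
  proof (rule C2_close_scaled_direction[OF assms, where \<alpha>'="\<lambda>t. 6 * t - 6 * t^2" and \<alpha>''="\<lambda>t. 6 - 12 * t"])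
    show "(blend b has_real_derivative 6 * t - 6 * t\<^sup>2) (at t)" for t
      using False unfolding blend_def by (auto intro!: derivative_eq_intros)
    show "((\<lambda>t. 6 * t - 6 * t\<^sup>2) has_real_derivative 6 - 12 * t) (at t)" for t :: real
      by (auto intro!: derivative_eq_intros)
    show "continuous_on {0..1} (\<lambda>t::real. 6 - 12 * t)" by (intro continuous_intros)
    fix t :: real assume t: "t \<in> {0..1}"
    have t2: "0 \<le> t^2" "t^2 \<le> t" using t by (auto simp: power2_eq_square mult_left_le)
    have t3: "0 \<le> t^3" "t^3 \<le> t^2" using t by (auto intro: power_decreasing)
    have "t \<le> 1" "0 \<le> t" using t by auto
    with t2 t3 False show "\<bar>blend b t\<bar> \<le> 6 \<and> \<bar>6 * t - 6 * t\<^sup>2\<bar> \<le> 6 \<and> \<bar>6 - 12 * t\<bar> \<le> 6"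
      unfolding blend_def abs_le_iff by (simp; linarith)
  qed
qed

lemma blend_flat:
  fixes p d :: "'a::euclidean_space"
  assumes H: "H2_curve c" and z: "z \<in> {0, 1}"
  shows "velocity (\<lambda>t. c t + \<delta> *\<^sub>R (p + blend False t *\<^sub>R d)) z = velocity c z"
proof -
  have zi: "z \<in> {0..1}" using z by auto
  have b: "(blend False has_real_derivative 6 * z - 6 * z\<^sup>2) (at z within {0..1})"
    unfolding blend_def by (auto intro!: derivative_eq_intros)
  have "6 * z - 6 * z\<^sup>2 = 0" using z by auto
  with b have "((\<lambda>t. c t + \<delta> *\<^sub>R (p + blend False t *\<^sub>R d)) has_vector_derivative velocity c z) (at z within {0..1})"
    using H2_curveD(1)[OF H zi] by (auto intro!: derivative_eq_intros)
  then show ?thesis by (rule velocity_eqI[OF _ zi])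
qed

text \<open>The vertices move by \<open>\<delta> n\<close> times the positions in the first stratum \<open>\<Sigma>\<close>, extended by zero to the
  other vertices. On a collapsed edge this gives a segment with direction \<open>d i\<close>, which is a positive multiple of
  the virtual tangent or zero, so the same tangents serve for the new network, and the
  edges that remain collapsed are those collapsed by \<open>\<Sigma>\<close>.\<close>

lemma resolve_one_stratum:
  fixes \<tau> D :: "nat \<Rightarrow> nat \<Rightarrow> real ^ 'd" and \<Gamma> :: "point set \<Rightarrow> real ^ 'd"
  assumes R: "N_graph N R" and net: "network N R {1..N} \<Gamma>"
    and ang: "angle_condition_with R {1..N} D \<Gamma> \<tau>"
    and str: "stratified_straight_with N R (Sing R {1..N} \<Gamma>) D \<tau>"
    and ne: "Sing R {1..N} \<Gamma> \<noteq> {}" and \<epsilon>: "\<epsilon> > 0"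
  obtains \<Gamma>' where "network N R {1..N} \<Gamma>'" "angle_condition_with R {1..N} D \<Gamma>' \<tau>"
    "Sing R {1..N} \<Gamma>' \<subset> Sing R {1..N} \<Gamma>" "stratified_straight_with N R (Sing R {1..N} \<Gamma>') D \<tau>"
    "\<And>i. i \<in> {1..N} \<Longrightarrow> C2_close \<epsilon> (edge_curve R \<Gamma> i) (edge_curve R \<Gamma>' i)"
    "\<bar>network_energy N R \<Gamma>' - network_energy N R \<Gamma>\<bar> < \<epsilon>"
proof -
  define S where "S = Sing R {1..N} \<Gamma>"
  have SN: "S \<subseteq> {1..N}" by (auto simp: S_def Sing_def)
  from stratified_straightE[OF str ne] obtain \<Sigma> where sub: "Sing R S \<Sigma> \<subset> S" and \<Sigma>net: "network N R S \<Sigma>"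
    and \<Sigma>tan: "tangents R S \<Sigma> \<tau>"
    and straight: "\<And>i. i \<in> S - Sing R S \<Sigma> \<Longrightarrow> straight_curve (edge_curve R \<Sigma> i)"
    and str': "stratified_straight_with N R (Sing R S \<Sigma>) D \<tau>"
    unfolding S_def by blast
  define S1 where "S1 = Sing R S \<Sigma>"
  \<comment> \<open>\<open>\<Sigma>\<close> is meaningful only on the edges in \<open>S\<close>\<close>
  define P where "P v = (if v \<in> junctions R S then \<Sigma> v else 0)" for v
  define p where "p i = P (proj R (0, i))" for i
  define d where "d i = P (proj R (1, i)) - P (proj R (0, i))" for i
  have Pend: "P (proj R (0, i)) = edge_curve R \<Sigma> i 0" "P (proj R (1, i)) = edge_curve R \<Sigma> i 1" if "i \<in> S" for i
    using that by (auto simp: P_def junctions_def interval_ends_def edge_curve_ends)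
  have dS1: "d i = 0" if "i \<in> S1" for i
  proof -
    have "i \<in> S" "singular_curve (edge_curve R \<Sigma> i)" using that by (auto simp: S1_def Sing_def)
    then show ?thesis by (auto simp: d_def Pend singular_curve_def constant_on_def)
  qed
  have dS: "d i \<noteq> 0 \<and> sgn (d i) = \<tau> 0 i" if "i \<in> S - S1" for i
  proof -
    have reg: "regular_curve (edge_curve R \<Sigma> i)"
      using that \<Sigma>net by (auto simp: S1_def Sing_def network_def)
    note st = straight_regular_tangent[OF straight[OF that[unfolded S1_def]] reg]
    have "\<tau> 0 i = outer_tangent 0 (edge_curve R \<Sigma> i)" using \<Sigma>tan that by (auto simp: tangents_def S1_def)
    then show ?thesis using st that by (simp add: d_def Pend outer_tangent_def)
  qed
  have tan: "tangents R {1..N} \<Gamma> \<tau>" using ang by (simp add: angle_condition_with_def)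
  have \<tau>S: "norm (\<tau> 0 i) = 1" "\<tau> 0 i = - \<tau> 1 i" if "i \<in> S" for i
    using tan that by (auto simp: tangents_def S_def)
  have \<tau>R: "\<tau> z i = outer_tangent z (edge_curve R \<Gamma> i)" if "i \<in> {1..N} - S" "z \<in> {0, 1}" for i z
    using tan that by (auto simp: tangents_def S_def)
  have regE: "regular_curve (edge_curve R \<Gamma> i)" if "i \<in> {1..N} - S" for i
    using that net by (auto simp: S_def Sing_def network_def)
  have singE: "singular_curve (edge_curve R \<Gamma> i)" if "i \<in> S" for i
    using that by (auto simp: S_def Sing_def)
  note edgeH = network_edge_H2[OF net]
  define \<delta> where "\<delta> n = 1 / real (Suc n)" for n
  have \<delta>0: "\<delta> \<longlonglongrightarrow> 0" unfolding \<delta>_def by (rule LIMSEQ_Suc[OF lim_1_over_n])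
  have \<delta>pos: "\<delta> n > 0" for n by (simp add: \<delta>_def)
  define \<kappa> where "\<kappa> n i t = edge_curve R \<Gamma> i t + \<delta> n *\<^sub>R (p i + blend (i \<in> S) t *\<^sub>R d i)" for n i t
  have bl: "blend b 0 = 0" "blend b 1 = 1" for b by (simp_all add: blend_def)
  have "\<exists>G. (\<forall>i\<in>{1..N}. \<forall>t\<in>{0..1}. edge_curve R G i t = \<kappa> n i t) \<and> (\<forall>S. continuous_map (subgraph_topology N R S) euclidean G)" for n
  proof -
    have "continuous_on {0..1} (\<kappa> n i)" if "i \<in> {1..N}" for i
    proof -
      have "continuous_on {0..1} (blend (i \<in> S))"
        unfolding blend_def by (cases "i \<in> S") (auto intro!: continuous_intros)
      then show ?thesis
        unfolding \<kappa>_def using H2_continuous[OF edgeH[OF that]] by (intro continuous_intros)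
    qed
    moreover have "\<kappa> n i 0 = \<Gamma> (proj R (0, i)) + \<delta> n *\<^sub>R P (proj R (0, i))"
      "\<kappa> n i 1 = \<Gamma> (proj R (1, i)) + \<delta> n *\<^sub>R P (proj R (1, i))" for i
      by (simp_all add: \<kappa>_def bl edge_curve_ends p_def d_def)
    ultimately show ?thesis
      by (intro glue_curves[OF R, of "\<kappa> n" "\<lambda>v. \<Gamma> v + \<delta> n *\<^sub>R P v"]) blast+
  qed
  then obtain G where edge: "\<And>n i. i \<in> {1..N} \<Longrightarrow> \<forall>t\<in>{0..1}. edge_curve R (G n) i t = \<kappa> n i t"
    and cm: "\<And>n S. continuous_map (subgraph_topology N R S) euclidean (G n)" by metis
  define C where "C i = norm (p i) + 6 * norm (d i)" for i
  have close: "C2_close (\<delta> n * C i) (edge_curve R \<Gamma> i) (edge_curve R (G n) i)" if i: "i \<in> {1..N}" for n i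
    unfolding C2_close_cong[OF edge[OF i]] unfolding \<kappa>_def C_def
    by (rule blend_C2_close) (use \<delta>pos[of n] in simp)
  have \<delta>C0: "(\<lambda>n. \<delta> n * C i) \<longlonglongrightarrow> 0" for i using tendsto_mult_right[OF \<delta>0, of "C i"] by simp
  have lineE: "\<exists>y. \<forall>t\<in>{0..1}. edge_curve R (G n) i t = y + t *\<^sub>R (\<delta> n *\<^sub>R d i)" if i: "i \<in> S" for n i
  proof -
    obtain y where y: "\<And>t. t \<in> {0..1} \<Longrightarrow> edge_curve R \<Gamma> i t = y"
      using singE[OF i] by (auto simp: singular_curve_def constant_on_def)
    have "edge_curve R (G n) i t = (y + \<delta> n *\<^sub>R p i) + t *\<^sub>R (\<delta> n *\<^sub>R d i)" if t: "t \<in> {0..1}" for t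
    proof -
      have "i \<in> {1..N}" using SN i by blast
      from edge[OF this, of n] have "edge_curve R (G n) i t = \<kappa> n i t" using t by blast
      then show ?thesis
        using i by (simp add: \<kappa>_def y[OF t] blend_def scaleR_add_right)
    qed
    then show ?thesis by blast
  qed
  have en: "(\<lambda>n. bending_energy (edge_curve R (G n) i) + curve_length (edge_curve R (G n) i))
      \<longlonglongrightarrow> bending_energy (edge_curve R \<Gamma> i) + curve_length (edge_curve R \<Gamma> i)" if i: "i \<in> {1..N}" for i
  proof (cases "i \<in> S")
    case True
    have "bending_energy (edge_curve R (G n) i) + curve_length (edge_curve R (G n) i) = \<delta> n * norm (d i)" for n
    proof -
      obtain y where y: "\<forall>t\<in>{0..1}. edge_curve R (G n) i t = y + t *\<^sub>R (\<delta> n *\<^sub>R d i)"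
        using lineE[OF True] by blast
      show ?thesis
        unfolding bending_energy_cong[OF y] curve_length_cong[OF y] line_bending_energy line_length
        using \<delta>pos[of n] by simp
    qed
    then show ?thesis
      using singular_energy[OF singE[OF True]] tendsto_mult_right[OF \<delta>0, of "norm (d i)"] by simp
  next
    case False
    then have i': "i \<in> {1..N} - S" using i by blast
    show ?thesis
      using C2_close_energy_tendsto(2,3)[OF regE[OF i'] close[OF i] \<delta>C0] by (rule tendsto_add)
  qed
  have "(\<lambda>n. network_energy N R (G n)) \<longlonglongrightarrow> network_energy N R \<Gamma>"
    unfolding network_energy_eq_sum by (intro tendsto_sum en)
  from tendstoD[OF this \<epsilon>]
  have e1: "\<forall>\<^sub>F n in sequentially. \<bar>network_energy N R (G n) - network_energy N R \<Gamma>\<bar> < \<epsilon>"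
    by (simp only: dist_real_def)
  have e2: "\<forall>\<^sub>F n in sequentially. \<forall>i\<in>{1..N}. \<delta> n * C i < \<epsilon>"
    using order_tendstoD(2)[OF \<delta>C0 \<epsilon>] by (intro eventually_ball_finite) auto
  have e3: "\<forall>\<^sub>F n in sequentially. \<forall>i\<in>{1..N} - S. regular_curve (edge_curve R (G n) i)"
  proof (rule eventually_ball_finite)
    show "\<forall>i\<in>{1..N} - S. \<forall>\<^sub>F n in sequentially. regular_curve (edge_curve R (G n) i)"
    proof
      fix i assume i: "i \<in> {1..N} - S"
      then have "i \<in> {1..N}" by blast
      from C2_close_energy_tendsto(1)[OF regE[OF i] close[OF this] \<delta>C0]
      show "\<forall>\<^sub>F n in sequentially. regular_curve (edge_curve R (G n) i)" .
    qed
  qed simp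
  from eventually_happens'[OF sequentially_bot eventually_conj[OF e1 eventually_conj[OF e2 e3]]]
  obtain n where n1: "\<bar>network_energy N R (G n) - network_energy N R \<Gamma>\<bar> < \<epsilon>"
    and n2: "\<And>i. i \<in> {1..N} \<Longrightarrow> \<delta> n * C i < \<epsilon>"
    and n3: "\<And>i. i \<in> {1..N} - S \<Longrightarrow> regular_curve (edge_curve R (G n) i)" by blast
  have dnz: "\<delta> n *\<^sub>R d i \<noteq> 0" if "i \<in> S - S1" for i using dS[OF that] \<delta>pos[of n] by simp
  have singG: "singular_curve (edge_curve R (G n) i) \<longleftrightarrow> i \<in> S1" if iS: "i \<in> S" for i
  proof -
    obtain y where y: "\<forall>t\<in>{0..1}. edge_curve R (G n) i t = y + t *\<^sub>R (\<delta> n *\<^sub>R d i)"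
      using lineE[OF iS] by blast
    show ?thesis unfolding singular_curve_cong[OF y] line_singular_iff using dnz dS1 iS by auto
  qed
  have regG: "regular_curve (edge_curve R (G n) i)" if iS: "i \<in> S - S1" for i
  proof -
    have "i \<in> S" using iS by blast
    from lineE[OF this] obtain y where y: "\<forall>t\<in>{0..1}. edge_curve R (G n) i t = y + t *\<^sub>R (\<delta> n *\<^sub>R d i)"
      by blast
    show ?thesis unfolding regular_curve_cong[OF y] by (rule line_regular[OF dnz[OF iS]])
  qed
  have S1S: "S1 \<subset> S" using sub by (simp add: S1_def)
  have Sing': "Sing R {1..N} (G n) = S1"
  proof (intro equalityI subsetI)
    fix i assume "i \<in> Sing R {1..N} (G n)"
    then have i: "i \<in> {1..N}" "singular_curve (edge_curve R (G n) i)" by (auto simp: Sing_def)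
    then have "i \<in> S" using n3[of i] singular_not_regular by blast
    then show "i \<in> S1" using singG i(2) by blast
  next
    fix i assume i: "i \<in> S1"
    then have "i \<in> S" using S1S by blast
    then show "i \<in> Sing R {1..N} (G n)" using singG i SN by (auto simp: Sing_def)
  qed
  have net': "network N R {1..N} (G n)"
  proof (rule networkI[OF cm])
    fix i assume "i \<in> {1..N}"
    then show "singular_curve (edge_curve R (G n) i) \<or> regular_curve (edge_curve R (G n) i)"
      using n3[of i] regG[of i] singG[of i] by blast
  qed
  have tan': "tangents R {1..N} (G n) \<tau>"
    unfolding tangents_def Sing'
  proof (intro conjI ballI)
    fix i z assume i: "i \<in> {1..N} - S1" and z: "z \<in> {0, 1::nat}"
    then have iN: "i \<in> {1..N}" by blast
    show "\<tau> z i = outer_tangent z (edge_curve R (G n) i)"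
    proof (cases "i \<in> S")
      case True
      obtain y where y: "\<forall>t\<in>{0..1}. edge_curve R (G n) i t = y + t *\<^sub>R (\<delta> n *\<^sub>R d i)"
        using lineE[OF True] by blast
      have "outer_tangent z (edge_curve R (G n) i) = (-1) ^ z *\<^sub>R sgn (\<delta> n *\<^sub>R d i)"
        unfolding outer_tangent_cong[OF y z] by (rule line_outer_tangent[OF z])
      also have "sgn (\<delta> n *\<^sub>R d i) = \<tau> 0 i" using dS[of i] i True \<delta>pos[of n] by (simp add: sgn_scaleR)
      finally show ?thesis using \<tau>S(2)[OF True] z by auto
    next
      case False
      have iS: "i \<in> {1..N} - S" using i False by blast
      have "velocity (\<kappa> n i) (real z) = velocity (edge_curve R \<Gamma> i) (real z)"
        unfolding \<kappa>_def using blend_flat[OF edgeH[OF iN], of "real z" "\<delta> n" "p i" "d i"] z False by auto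
      then have "outer_tangent z (edge_curve R (G n) i) = outer_tangent z (edge_curve R \<Gamma> i)"
        unfolding outer_tangent_cong[OF edge[OF iN] z] by (simp add: outer_tangent_def)
      then show ?thesis using \<tau>R[OF iS z] by simp
    qed
  next
    fix i assume "i \<in> S1"
    then have "i \<in> S" using S1S by blast
    then show "norm (\<tau> 0 i) = 1" "\<tau> 0 i = - \<tau> 1 i" by (rule \<tau>S)+
  qed
  show ?thesis
  proof
    show "network N R {1..N} (G n)" by (rule net')
    show "angle_condition_with R {1..N} D (G n) \<tau>"
      using ang tan' by (simp add: angle_condition_with_def)
    show "Sing R {1..N} (G n) \<subset> Sing R {1..N} \<Gamma>" unfolding Sing' using S1S by (simp only: S_def)
    show "stratified_straight_with N R (Sing R {1..N} (G n)) D \<tau>" unfolding Sing' using str' by (simp only: S1_def)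
    show "C2_close \<epsilon> (edge_curve R \<Gamma> i) (edge_curve R (G n) i)" if "i \<in> {1..N}" for i
      by (rule C2_close_mono[OF close[OF that]]) (use n2[OF that] in simp)
  qed (rule n1)
qed

text \<open>Each stratum is resolved at its own scale, chosen after the previous ones: once an edge
  has become regular, later perturbations are arbitrarily small compared with its length.\<close>

lemma degenerate_approximation:
  fixes \<tau> D :: "nat \<Rightarrow> nat \<Rightarrow> real ^ 'd" and \<Gamma> :: "point set \<Rightarrow> real ^ 'd"
  assumes R: "N_graph N R" and "network N R {1..N} \<Gamma>" "angle_condition_with R {1..N} D \<Gamma> \<tau>"
    "stratified_straight_with N R (Sing R {1..N} \<Gamma>) D \<tau>" "\<epsilon> > 0"
  shows "\<exists>\<Gamma>' \<in> C_Reg N R D. (\<forall>i\<in>{1..N}. C2_close \<epsilon> (edge_curve R \<Gamma> i) (edge_curve R \<Gamma>' i)) \<and>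
    \<bar>network_energy N R \<Gamma>' - network_energy N R \<Gamma>\<bar> < \<epsilon>"
  using assms(2-5)
proof (induction "card (Sing R {1..N} \<Gamma>)" arbitrary: \<Gamma> \<epsilon> rule: less_induct)
  case less
  show ?case
  proof (cases "Sing R {1..N} \<Gamma> = {}")
    case True
    then have "\<Gamma> \<in> C_Reg N R D" using less.prems by (auto simp: C_Reg_def angle_condition_def)
    then show ?thesis using less.prems(4) by (intro bexI[of _ \<Gamma>]) (auto intro: C2_close_refl)
  next
    case False
    have e2: "\<epsilon> / 2 > 0" using less.prems(4) by simp
    obtain \<Gamma>' where 1: "network N R {1..N} \<Gamma>'" "angle_condition_with R {1..N} D \<Gamma>' \<tau>"
      "Sing R {1..N} \<Gamma>' \<subset> Sing R {1..N} \<Gamma>" "stratified_straight_with N R (Sing R {1..N} \<Gamma>') D \<tau>"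
      and c1: "\<And>i. i \<in> {1..N} \<Longrightarrow> C2_close (\<epsilon>/2) (edge_curve R \<Gamma> i) (edge_curve R \<Gamma>' i)"
      and E1: "\<bar>network_energy N R \<Gamma>' - network_energy N R \<Gamma>\<bar> < \<epsilon>/2"
      using resolve_one_stratum[OF R less.prems(1-3) False e2] by blast
    have "finite (Sing R {1..N} \<Gamma>)" by (simp add: Sing_def)
    then have "card (Sing R {1..N} \<Gamma>') < card (Sing R {1..N} \<Gamma>)" using 1(3) by (rule psubset_card_mono)
    from less.hyps[OF this 1(1,2,4) e2] obtain \<Gamma>'' where 2: "\<Gamma>'' \<in> C_Reg N R D"
      and c2: "\<And>i. i \<in> {1..N} \<Longrightarrow> C2_close (\<epsilon>/2) (edge_curve R \<Gamma>' i) (edge_curve R \<Gamma>'' i)"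
      and E2: "\<bar>network_energy N R \<Gamma>'' - network_energy N R \<Gamma>'\<bar> < \<epsilon>/2" by blast
    have "C2_close \<epsilon> (edge_curve R \<Gamma> i) (edge_curve R \<Gamma>'' i)" if "i \<in> {1..N}" for i
      using C2_close_trans[OF c1[OF that] c2[OF that]] by simp
    moreover have "\<bar>network_energy N R \<Gamma>'' - network_energy N R \<Gamma>\<bar> < \<epsilon>" using E1 E2 by linarith
    ultimately show ?thesis using 2 by blast
  qed
qed

lemma identity_reparametrization: "reparametrization (\<lambda>t. t)"
proof -
  have "(\<lambda>t::real. 0 + t *\<^sub>R 1) = (\<lambda>t. t)" by auto
  then show ?thesis using line_H2(1)[of 0 "1::real"] line_H2(2)[of _ 0 "1::real"]
    by (auto simp: reparametrization_def)
qed

lemma recovery_sequence: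
  fixes D :: "nat \<Rightarrow> nat \<Rightarrow> real ^ 'd"
  assumes R: "N_graph N R" and \<Gamma>: "\<Gamma> \<in> C_Deg N R D"
  obtains \<Gamma>s where "\<And>n. \<Gamma>s n \<in> C_Reg N R D" "weakly_converges_network N R \<Gamma>s \<Gamma>"
    "(\<lambda>n. network_energy N R (\<Gamma>s n)) \<longlonglongrightarrow> network_energy N R \<Gamma>"
proof -
  obtain \<tau> where d: "network N R {1..N} \<Gamma>" "angle_condition_with R {1..N} D \<Gamma> \<tau>"
    "stratified_straight_with N R (Sing R {1..N} \<Gamma>) D \<tau>" using \<Gamma> by (auto simp: C_Deg_def)
  define \<epsilon> where "\<epsilon> n = 1 / real (Suc n)" for n
  have \<epsilon>0: "\<epsilon> \<longlonglongrightarrow> 0" unfolding \<epsilon>_def by (rule LIMSEQ_Suc[OF lim_1_over_n])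
  have "\<forall>n. \<exists>\<Gamma>' \<in> C_Reg N R D. (\<forall>i\<in>{1..N}. C2_close (\<epsilon> n) (edge_curve R \<Gamma> i) (edge_curve R \<Gamma>' i)) \<and>
    \<bar>network_energy N R \<Gamma>' - network_energy N R \<Gamma>\<bar> < \<epsilon> n"
    by (intro allI degenerate_approximation[OF R d]) (simp add: \<epsilon>_def)
  then obtain \<Gamma>s where reg: "\<And>n. \<Gamma>s n \<in> C_Reg N R D"
    and close: "\<And>n i. i \<in> {1..N} \<Longrightarrow> C2_close (\<epsilon> n) (edge_curve R \<Gamma> i) (edge_curve R (\<Gamma>s n) i)"
    and E: "\<And>n. \<bar>network_energy N R (\<Gamma>s n) - network_energy N R \<Gamma>\<bar> < \<epsilon> n" by metis
  have "weakly_converges_network N R \<Gamma>s \<Gamma>"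
    unfolding weakly_converges_network_def
  proof
    fix i assume i: "i \<in> {1..N}"
    have "weakly_converges_H2 (\<lambda>n. edge_curve R (\<Gamma>s n) i) (edge_curve R \<Gamma> i)"
      by (rule C2_close_weakly_converges[OF network_edge_H2[OF d(1) i] close[OF i] \<epsilon>0])
    then show "\<exists>\<phi>. (\<forall>n. reparametrization (\<phi> n)) \<and>
        weakly_converges_H2 (\<lambda>n. edge_curve R (\<Gamma>s n) i \<circ> \<phi> n) (edge_curve R \<Gamma> i)"
      using identity_reparametrization by (intro exI[of _ "\<lambda>_ t. t"]) (simp add: o_def)
  qed
  moreover have "(\<lambda>n. network_energy N R (\<Gamma>s n)) \<longlonglongrightarrow> network_energy N R \<Gamma>"
    using E by (intro LIM_zero_cancel[OF Lim_null_comparison[OF _ \<epsilon>0]]) (auto intro!: always_eventually less_imp_le)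
  ultimately show ?thesis using reg that by blast
qed

section \<open>Limits of arclength data\<close>

definition is_indicatrix :: "(real \<Rightarrow> 'a::euclidean_space) \<Rightarrow> (real \<Rightarrow> 'a) \<Rightarrow> bool" where
  "is_indicatrix c \<theta> \<longleftrightarrow> (\<exists>h. H1_path \<theta> h \<and> inner_L2 lborel01 h h = curve_length c * bending_energy c) \<and>
     (\<forall>t\<in>{0..1}. arclength_param c t \<in> {0..1} \<and> \<theta> (arclength_param c t) = sgn (velocity c t)) \<and>
     (\<forall>x\<in>{0..1}. norm (\<theta> x) = 1) \<and> \<theta> 0 = sgn (velocity c 0) \<and> \<theta> 1 = sgn (velocity c 1) \<and>
     c 1 - c 0 = curve_length c *\<^sub>R (LINT t:{0..1}|lborel. \<theta> t)"

text \<open>A choice is harmless: the values on the unit interval are determined by the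
  condition on \<open>arclength_param c\<close>, which is onto.\<close>

definition indicatrix :: "(real \<Rightarrow> 'a::euclidean_space) \<Rightarrow> real \<Rightarrow> 'a" where
  "indicatrix c = (SOME \<theta>. is_indicatrix c \<theta>)"

lemma indicatrix:
  assumes "regular_curve c"
  shows "is_indicatrix c (indicatrix c)"
proof (rule tangent_indicatrix_exists[OF assms])
  fix \<theta> h
  assume "H1_path \<theta> h" "inner_L2 lborel01 h h = curve_length c * bending_energy c"
    "\<And>t. t \<in> {0..1} \<Longrightarrow> arclength_param c t \<in> {0..1}"
    "\<And>t. t \<in> {0..1} \<Longrightarrow> \<theta> (arclength_param c t) = sgn (velocity c t)"
    "\<And>x. x \<in> {0..1} \<Longrightarrow> norm (\<theta> x) = 1"
    "\<theta> 0 = sgn (velocity c 0)" "\<theta> 1 = sgn (velocity c 1)"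
    "c 1 - c 0 = curve_length c *\<^sub>R (LINT t:{0..1}|lborel. \<theta> t)"
  then have "is_indicatrix c \<theta>" unfolding is_indicatrix_def by blast
  then show ?thesis unfolding indicatrix_def by (rule someI[of "is_indicatrix c"])
qed

lemma H1_path_L2: "H1_path \<theta> h \<Longrightarrow> L2 lborel01 h"
  unfolding H1_path_def by blast

lemma bending_energy_nonneg: "0 \<le> bending_energy c"
  unfolding bending_energy_def set_lebesgue_integral_def
  by (rule Bochner_Integration.integral_nonneg) simp

lemma curve_length_nonneg: "0 \<le> curve_length c"
  unfolding curve_length_def set_lebesgue_integral_def
  by (rule Bochner_Integration.integral_nonneg) simp

lemma arclength_param_onto:
  assumes reg: "regular_curve c" and x: "x \<in> {0..1}"
  obtains t where "t \<in> {0..1}" "arclength_param c t = x"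
proof -
  have "continuous_on {0..1} (\<lambda>t. norm (velocity c t))"
    using reg by (intro continuous_intros H2_velocity_continuous) (simp add: regular_curve_def)
  then have c: "continuous_on {0..1} (\<lambda>t. arclength_param c t)"
    unfolding arclength_param_def using curve_length_pos[OF reg]
    by (intro continuous_on_divide continuous_on_const primitive_continuous continuous_integrable_lborel01) auto
  have "arclength_param c 0 = 0" by (simp add: arclength_param_def set_LINT_singleton)
  moreover have "arclength_param c 1 = 1"
    using curve_length_pos[OF reg] by (simp add: arclength_param_def curve_length_def)
  ultimately have "\<exists>t. 0 \<le> t \<and> t \<le> 1 \<and> arclength_param c t = x"
    using x by (intro IVT'[OF _ _ _ c]) auto
  then show ?thesis using that by auto
qed

text \<open>The limits of length, bending energy and indicatrix along a sequence of curves. Positions do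
  not enter, so that the notion is insensitive to translations of components of a network.\<close>

definition edge_limit :: "(nat \<Rightarrow> real \<Rightarrow> 'a::euclidean_space) \<Rightarrow> real \<Rightarrow> real \<Rightarrow> (real \<Rightarrow> 'a) \<Rightarrow> bool" where
  "edge_limit c l \<beta> \<theta> \<longleftrightarrow> (\<forall>n. regular_curve (c n)) \<and> (\<lambda>n. curve_length (c n)) \<longlonglongrightarrow> l \<and>
     (\<lambda>n. bending_energy (c n)) \<longlonglongrightarrow> \<beta> \<and> uniform_limit {0..1} (\<lambda>n. indicatrix (c n)) \<theta> sequentially"

lemma edge_limit_subseq:
  assumes "edge_limit c l \<beta> \<theta>" "strict_mono r"
  shows "edge_limit (\<lambda>n. c (r n)) l \<beta> \<theta>"
proof -
  have "filterlim r sequentially sequentially" by (rule filterlim_subseq[OF assms(2)])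
  with assms(1) show ?thesis
    unfolding edge_limit_def by (auto intro: filterlim_compose)
qed

lemma edge_compactness:
  fixes c :: "nat \<Rightarrow> real \<Rightarrow> 'a::euclidean_space"
  assumes reg: "\<And>n. regular_curve (c n)" and l: "\<And>n. curve_length (c n) \<le> C" and b: "\<And>n. bending_energy (c n) \<le> C"
  obtains r l \<beta> \<theta> where "strict_mono r" "edge_limit (\<lambda>n. c (r n)) l \<beta> \<theta>"
proof -
  note I = indicatrix[OF reg]
  have C0: "0 \<le> C" using l[of 0] curve_length_pos[OF reg[of 0]] by linarith
  have Hoelder: "norm (indicatrix (c n) x - indicatrix (c n) y) \<le> sqrt \<bar>x - y\<bar> * C" if "x \<in> {0..1}" "y \<in> {0..1}" for n x y
  proof -
    obtain h where h: "H1_path (indicatrix (c n)) h" "inner_L2 lborel01 h h = curve_length (c n) * bending_energy (c n)"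
      using I[of n] unfolding is_indicatrix_def by blast
    have "inner_L2 lborel01 h h \<le> C * C"
      unfolding h(2) using l b C0 bending_energy_nonneg by (intro mult_mono) auto
    then have "norm_L2 lborel01 h \<le> C" using C0 by (simp add: norm_L2_def real_le_lsqrt power2_eq_square)
    then have "sqrt \<bar>x - y\<bar> * norm_L2 lborel01 h \<le> sqrt \<bar>x - y\<bar> * C" by (intro mult_left_mono) auto
    then show ?thesis using H1_path_Hoelder[OF h(1) that(2,1)] by linarith
  qed
  have "\<exists>\<theta> k. strict_mono (k :: nat \<Rightarrow> nat) \<and>
    (\<forall>e>0. \<exists>N. \<forall>n x. n \<ge> N \<and> x \<in> {0..1} \<longrightarrow> norm (indicatrix (c (k n)) x - \<theta> x) < e)"
  proof (rule Arzela_Ascoli[of "{0..1::real}" "\<lambda>n. indicatrix (c n)" 1])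
    show "norm (indicatrix (c n) x) \<le> 1" if "x \<in> {0..1}" for n x
      using I[of n] that unfolding is_indicatrix_def by simp
    fix x e :: real assume x: "x \<in> {0..1}" and e: "0 < e"
    \<comment> \<open>\<open>C\<close> may be zero\<close>
    define d where "d = (e / (C + 1))\<^sup>2"
    have Cp: "C + 1 > 0" using C0 by linarith
    have d: "d > 0" using e Cp by (simp add: d_def)
    have "norm (indicatrix (c n) x - indicatrix (c n) y) < e" if y: "y \<in> {0..1}" "norm (x - y) < d" for n y
    proof -
      have "sqrt \<bar>x - y\<bar> < sqrt d" using y(2) by simp
      also have "sqrt d = e / (C + 1)" using e Cp by (simp add: d_def)
      finally have "sqrt \<bar>x - y\<bar> * C \<le> e / (C + 1) * C" using C0 by (intro mult_right_mono) auto
      also have "\<dots> < e" using e Cp by (simp add: field_simps)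
      finally show ?thesis using Hoelder[OF x y(1), of n] by linarith
    qed
    then show "\<exists>d>0. \<forall>n y. y \<in> {0..1} \<and> norm (x - y) < d \<longrightarrow> norm (indicatrix (c n) x - indicatrix (c n) y) < e"
      using d by blast
  next
    fix g and k :: "nat \<Rightarrow> nat"
    assume "strict_mono k"
      "\<And>e. 0 < e \<Longrightarrow> \<exists>N. \<forall>n x. n \<ge> N \<and> x \<in> {0..1} \<longrightarrow> norm (indicatrix (c (k n)) x - g x) < e"
    then show ?thesis by blast
  qed simp
  then obtain \<theta> k where k: "strict_mono (k :: nat \<Rightarrow> nat)"
    and u: "\<And>e. 0 < e \<Longrightarrow> \<exists>N. \<forall>n x. n \<ge> N \<and> x \<in> {0..1} \<longrightarrow> norm (indicatrix (c (k n)) x - \<theta> x) < e"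
    by blast
  have ul: "uniform_limit {0..1} (\<lambda>n. indicatrix (c (k n))) \<theta> sequentially"
  proof (rule uniform_limitI)
    fix e :: real assume "0 < e"
    from u[OF this] show "\<forall>\<^sub>F n in sequentially. \<forall>x\<in>{0..1}. dist (indicatrix (c (k n)) x) (\<theta> x) < e"
      unfolding eventually_sequentially dist_norm by blast
  qed
  have lb: "norm (curve_length (c n)) \<le> C" "norm (bending_energy (c n)) \<le> C" for n
    using l[of n] b[of n] curve_length_nonneg[of "c n"] bending_energy_nonneg[of "c n"] by simp_all
  have "bounded (range (\<lambda>n. curve_length (c (k n))))"
    using lb(1) by (intro boundedI[of _ C]) auto
  from bounded_imp_convergent_subsequence[OF this] obtain l' k1 where k1: "strict_mono k1"
    and l': "(\<lambda>n. curve_length (c (k (k1 n)))) \<longlonglongrightarrow> l'" by (auto simp: o_def)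
  have "bounded (range (\<lambda>n. bending_energy (c (k (k1 n)))))"
    using lb(2) by (intro boundedI[of _ C]) auto
  from bounded_imp_convergent_subsequence[OF this] obtain \<beta> k2 where k2: "strict_mono k2"
    and \<beta>: "(\<lambda>n. bending_energy (c (k (k1 (k2 n))))) \<longlonglongrightarrow> \<beta>" by (auto simp: o_def)
  have k12: "strict_mono (\<lambda>n. k1 (k2 n))" using strict_mono_o[OF k1 k2] by (simp add: o_def)
  have "strict_mono (\<lambda>n. k (k1 (k2 n)))" using strict_mono_o[OF k k12] by (simp add: o_def)
  moreover have "edge_limit (\<lambda>n. c (k (k1 (k2 n)))) l' \<beta> \<theta>"
    unfolding edge_limit_def
  proof (intro conjI allI reg \<beta>)
    show "(\<lambda>n. curve_length (c (k (k1 (k2 n))))) \<longlonglongrightarrow> l'"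
      using filterlim_compose[OF l' filterlim_subseq[OF k2]] .
    show "uniform_limit {0..1} (\<lambda>n. indicatrix (c (k (k1 (k2 n))))) \<theta> sequentially"
      using filterlim_compose[OF ul filterlim_subseq[OF k12]] .
  qed
  ultimately show ?thesis by (rule that)
qed

text \<open>The bound is obtained with an arbitrarily small error from a tail of the sequence; the
  derivative of \<open>\<theta>\<close> does not depend on the error, up to null sets.\<close>

lemma edge_limit_H1:
  fixes c :: "nat \<Rightarrow> real \<Rightarrow> 'a::euclidean_space"
  assumes lim: "edge_limit c l \<beta> \<theta>"
  obtains h where "H1_path \<theta> h" "inner_L2 lborel01 h h \<le> l * \<beta>"
proof -
  have reg: "regular_curve (c n)" for n using lim by (simp add: edge_limit_def)
  have ul: "uniform_limit {0..1} (\<lambda>n. indicatrix (c n)) \<theta> sequentially" using lim by (simp add: edge_limit_def)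
  have "\<forall>n. \<exists>h. H1_path (indicatrix (c n)) h \<and> inner_L2 lborel01 h h = curve_length (c n) * bending_energy (c n)"
    using indicatrix[OF reg] unfolding is_indicatrix_def by blast
  then obtain h where h: "\<And>n. H1_path (indicatrix (c n)) (h n)"
    and hE: "\<And>n. inner_L2 lborel01 (h n) (h n) = curve_length (c n) * bending_energy (c n)" by metis
  have lE: "(\<lambda>n. inner_L2 lborel01 (h n) (h n)) \<longlonglongrightarrow> l * \<beta>"
    unfolding hE using lim unfolding edge_limit_def by (intro tendsto_mult) blast+
  have ex: "\<exists>h'. H1_path \<theta> h' \<and> inner_L2 lborel01 h' h' \<le> l * \<beta> + e" if e: "e > 0" for e
  proof -
    have "\<forall>\<^sub>F n in sequentially. inner_L2 lborel01 (h n) (h n) < l * \<beta> + e"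
      using lE e by (intro order_tendstoD(2)) auto
    then obtain n0 where n0: "\<And>n. n \<ge> n0 \<Longrightarrow> inner_L2 lborel01 (h n) (h n) < l * \<beta> + e" by (auto simp: eventually_sequentially)
    have ul': "uniform_limit {0..1} (\<lambda>n. indicatrix (c (n + n0))) \<theta> sequentially"
      using filterlim_compose[OF ul filterlim_add_const_nat_at_top] .
    obtain h' where "H1_path \<theta> h'" "inner_L2 lborel01 h' h' \<le> l * \<beta> + e"
      by (rule H1_path_limit[OF h[of "_ + n0"] _ ul']) (use n0 in \<open>auto intro: less_imp_le\<close>)
    then show ?thesis by blast
  qed
  obtain h' where h': "H1_path \<theta> h'" using ex[of 1] by auto
  have "inner_L2 lborel01 h' h' \<le> l * \<beta>"
  proof (rule field_le_epsilon)
    fix e :: real assume "e > 0"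
    then obtain g where g: "H1_path \<theta> g" "inner_L2 lborel01 g g \<le> l * \<beta> + e" using ex by blast
    have "AE t in lborel01. h' t = g t" by (rule H1_path_unique[OF h' g(1)]) simp
    then have "inner_L2 lborel01 h' h' = inner_L2 lborel01 g g" by (intro inner_L2_self_cong_AE H1_path_L2[OF h'] H1_path_L2[OF g(1)])
    then show "inner_L2 lborel01 h' h' \<le> l * \<beta> + e" using g(2) by simp
  qed
  with h' show ?thesis by (rule that)
qed

lemma edge_limit_norm:
  assumes lim: "edge_limit c l \<beta> \<theta>" and x: "x \<in> {0..1}"
  shows "norm (\<theta> x) = 1"
proof -
  have "norm (indicatrix (c n) x) = 1" for n
    using indicatrix[of "c n"] lim x by (simp add: edge_limit_def is_indicatrix_def)
  moreover have "(\<lambda>n. norm (indicatrix (c n) x)) \<longlonglongrightarrow> norm (\<theta> x)"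
    using lim x unfolding edge_limit_def by (intro tendsto_norm tendsto_uniform_limitI[where S="{0..1}"]) auto
  ultimately show ?thesis by (simp add: LIMSEQ_const_iff)
qed

lemma edge_limit_continuous:
  assumes "edge_limit c l \<beta> \<theta>"
  shows "continuous_on {0..1} \<theta>"
proof -
  obtain h where "H1_path \<theta> h" using edge_limit_H1[OF assms] by blast
  then show ?thesis by (rule H1_path_continuous)
qed

lemma edge_limit_collapsed:
  assumes lim: "edge_limit c 0 \<beta> \<theta>" and x: "x \<in> {0..1}"
  shows "\<theta> x = \<theta> 0"
proof -
  obtain h where h: "H1_path \<theta> h" "inner_L2 lborel01 h h \<le> 0 * \<beta>" using edge_limit_H1[OF lim] by blast
  have "inner_L2 lborel01 h h = 0" using h(2) inner_L2_self_nonneg[of lborel01 h] by linarith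
  then have "norm_L2 lborel01 h = 0" by (simp add: norm_L2_def)
  then show ?thesis using H1_path_Hoelder[OF h(1), of 0 x] x by simp
qed

lemma edge_limit_mean:
  fixes c :: "nat \<Rightarrow> real \<Rightarrow> 'a::euclidean_space"
  assumes lim: "edge_limit c l \<beta> \<theta>"
  shows "(\<lambda>n. LINT t:{0..1}|lborel. indicatrix (c n) t) \<longlonglongrightarrow> (LINT t:{0..1}|lborel. \<theta> t)"
  unfolding integral_lborel01[symmetric]
proof (rule integral_lborel01_tendsto[where B=1])
  have I: "is_indicatrix (c n) (indicatrix (c n))" for n
    using lim by (intro indicatrix) (simp add: edge_limit_def)
  show "indicatrix (c n) \<in> borel_measurable lborel01" for n
  proof -
    obtain h where "H1_path (indicatrix (c n)) h" using I[of n] unfolding is_indicatrix_def by blast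
    then show ?thesis by (intro continuous_measurable_lborel01 H1_path_continuous)
  qed
  show "\<theta> \<in> borel_measurable lborel01" by (rule continuous_measurable_lborel01[OF edge_limit_continuous[OF lim]])
  show "(\<lambda>n. indicatrix (c n) t) \<longlonglongrightarrow> \<theta> t" if "t \<in> {0..1}" for t
    using lim that unfolding edge_limit_def by (intro tendsto_uniform_limitI[where S="{0..1}"]) auto
  show "norm (indicatrix (c n) t) \<le> 1" if "t \<in> {0..1}" for n t
    using I[of n] that by (simp add: is_indicatrix_def)
qed

lemma edge_limit_chord:
  assumes lim: "edge_limit c l \<beta> \<theta>"
  shows "(\<lambda>n. c n 1 - c n 0) \<longlonglongrightarrow> l *\<^sub>R (LINT t:{0..1}|lborel. \<theta> t)"
proof -
  have "c n 1 - c n 0 = curve_length (c n) *\<^sub>R (LINT t:{0..1}|lborel. indicatrix (c n) t)" for n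
    using indicatrix[of "c n"] lim by (simp add: edge_limit_def is_indicatrix_def)
  then show ?thesis
    using lim edge_limit_mean[OF lim] by (simp add: edge_limit_def tendsto_scaleR)
qed

text \<open>The outer tangents of a curve with indicatrix \<open>\<theta>\<close>; for a constant \<open>\<theta>\<close> they are opposite, as
  virtual tangents must be.\<close>

definition end_tangent :: "(real \<Rightarrow> 'a::real_vector) \<Rightarrow> nat \<Rightarrow> 'a" where
  "end_tangent \<theta> z = (if z = 0 then \<theta> 0 else - \<theta> 1)"

lemma end_tangent_indicatrix:
  assumes "is_indicatrix c \<theta>" "z \<in> {0, 1}"
  shows "outer_tangent z c = end_tangent \<theta> z"
  using assms by (auto simp: is_indicatrix_def outer_tangent_def end_tangent_def)

lemma edge_limit_end_tangent:
  assumes lim: "edge_limit c l \<beta> \<theta>" and z: "z \<in> {0, 1}"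
  shows "(\<lambda>n. outer_tangent z (c n)) \<longlonglongrightarrow> end_tangent \<theta> z"
proof -
  have "outer_tangent z (c n) = end_tangent (indicatrix (c n)) z" for n
    using lim by (intro end_tangent_indicatrix[OF indicatrix z]) (simp add: edge_limit_def)
  moreover have "(\<lambda>n. indicatrix (c n) x) \<longlonglongrightarrow> \<theta> x" if "x \<in> {0..1}" for x
    using lim that unfolding edge_limit_def by (intro tendsto_uniform_limitI[where S="{0..1}"]) auto
  ultimately show ?thesis
    using tendsto_minus[of "\<lambda>n. indicatrix (c n) 1" "\<theta> 1"] by (simp add: end_tangent_def)
qed

section \<open>Compactness of regular networks\<close>

lemma common_subsequence:
  assumes "finite I"
    and ex: "\<And>i r. i \<in> I \<Longrightarrow> strict_mono (r :: nat \<Rightarrow> nat) \<Longrightarrow> \<exists>s :: nat \<Rightarrow> nat. strict_mono s \<and> Q i (\<lambda>n. r (s n))"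
    and sub: "\<And>i r s. i \<in> I \<Longrightarrow> Q i r \<Longrightarrow> strict_mono (s :: nat \<Rightarrow> nat) \<Longrightarrow> Q i (\<lambda>n. r (s n))"
  shows "\<exists>r :: nat \<Rightarrow> nat. strict_mono r \<and> (\<forall>i\<in>I. Q i r)"
  using assms
proof (induction I)
  case empty
  show ?case by (intro exI[of _ "\<lambda>n. n"]) (auto simp: strict_mono_def)
next
  case (insert j I)
  have "\<exists>r :: nat \<Rightarrow> nat. strict_mono r \<and> (\<forall>i\<in>I. Q i r)"
    by (rule insert.IH) (use insert.prems in blast)+
  then obtain r :: "nat \<Rightarrow> nat" where r: "strict_mono r" "\<And>i. i \<in> I \<Longrightarrow> Q i r" by blast
  obtain s :: "nat \<Rightarrow> nat" where s: "strict_mono s" "Q j (\<lambda>n. r (s n))" using insert.prems(1)[of j r] r(1) by blast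
  have "strict_mono (\<lambda>n. r (s n))" using strict_mono_o[OF r(1) s(1)] by (simp add: o_def)
  moreover have "Q i (\<lambda>n. r (s n))" if "i \<in> insert j I" for i
    using that s insert.prems(2)[of i r s] r(2) by blast
  ultimately show ?case by blast
qed

lemma rotation_matrices_compact:
  fixes Q :: "nat \<Rightarrow> real ^ 'd ^ 'd"
  assumes rot: "\<And>n. rotation_matrix (Q n)"
  obtains r Q' where "strict_mono r" "(\<lambda>n. Q (r n)) \<longlonglongrightarrow> Q'" "rotation_matrix Q'"
proof -
  have rows: "norm (Q n $ i) = 1" "i \<noteq> j \<Longrightarrow> Q n $ i \<bullet> Q n $ j = 0" for n i j
    using rot[of n] unfolding rotation_matrix_def orthogonal_matrix_orthonormal_rows
    by (auto simp: row_def orthogonal_def)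
  have "norm (Q n) \<le> real CARD('d)" for n
  proof -
    have "norm (Q n) \<le> (\<Sum>i\<in>UNIV. norm (Q n $ i))" unfolding norm_vec_def by (rule L2_set_le_sum) simp
    then show ?thesis by (simp add: rows)
  qed
  then have "bounded (range Q)" by (intro boundedI) auto
  from bounded_imp_convergent_subsequence[OF this] obtain Q' r where r: "strict_mono r"
    and Q': "(\<lambda>n. Q (r n)) \<longlonglongrightarrow> Q'" by (auto simp: o_def)
  have rl: "(\<lambda>n. Q (r n) $ i) \<longlonglongrightarrow> Q' $ i" for i by (intro tendsto_intros Q')
  have "norm (Q' $ i) = 1" for i
    using tendsto_norm[OF rl[of i]] by (simp add: rows LIMSEQ_const_iff)
  moreover have "Q' $ i \<bullet> Q' $ j = 0" if "i \<noteq> j" for i j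
    using tendsto_inner[OF rl[of i] rl[of j]] by (simp add: rows that LIMSEQ_const_iff)
  ultimately have "orthogonal_matrix Q'"
    unfolding orthogonal_matrix_orthonormal_rows by (auto simp: row_def orthogonal_def)
  moreover have "det Q' = 1"
  proof -
    have "(\<lambda>n. det (Q (r n))) \<longlonglongrightarrow> det Q'" unfolding det_def by (intro tendsto_intros Q')
    then show ?thesis using rot by (simp add: rotation_matrix_def LIMSEQ_const_iff)
  qed
  ultimately have "rotation_matrix Q'" by (simp add: rotation_matrix_def)
  with r Q' show ?thesis by (rule that)
qed

lemma tendsto_matrix_vector_mult_left:
  fixes Q :: "nat \<Rightarrow> real ^ 'n ^ 'm"
  assumes "Q \<longlonglongrightarrow> Q'"
  shows "(\<lambda>n. Q n *v x) \<longlonglongrightarrow> Q' *v x"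
  unfolding matrix_vector_mult_def by (intro tendsto_vec_lambda tendsto_intros assms)

lemma C_RegD:
  assumes "\<Gamma> \<in> C_Reg N R D" "i \<in> {1..N}"
  shows "regular_curve (edge_curve R \<Gamma> i)"
  using assms by (auto simp: C_Reg_def network_def Sing_def)

lemma C_Reg_angles:
  assumes "\<Gamma> \<in> C_Reg N R D" "p \<in> junctions R {1..N}"
  obtains Q where "rotation_matrix Q" "\<And>z i. (z, i) \<in> junction_fibre R {1..N} p \<Longrightarrow> outer_tangent z (edge_curve R \<Gamma> i) = Q *v D z i"
proof -
  obtain \<tau> where \<tau>: "angle_condition_with R {1..N} D \<Gamma> \<tau>" and S: "Sing R {1..N} \<Gamma> = {}"
    using assms(1) by (auto simp: C_Reg_def angle_condition_def)
  obtain Q where Q: "rotation_matrix Q" "\<And>z i. (z, i) \<in> junction_fibre R {1..N} p \<Longrightarrow> \<tau> z i = Q *v D z i"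
    using \<tau> assms(2) unfolding angle_condition_with_def by blast
  have "\<tau> z i = outer_tangent z (edge_curve R \<Gamma> i)" if "(z, i) \<in> junction_fibre R {1..N} p" for z i
    using \<tau> S that by (auto simp: angle_condition_with_def tangents_def junction_fibre_def)
  with Q show ?thesis by (metis that)
qed

lemma limit_rotation:
  fixes D :: "nat \<Rightarrow> nat \<Rightarrow> real ^ 'd"
  assumes reg: "\<And>n. \<Gamma>s n \<in> C_Reg N R D"
    and lim: "\<And>i. i \<in> {1..N} \<Longrightarrow> edge_limit (\<lambda>n. edge_curve R (\<Gamma>s n) i) (l i) (\<beta> i) (\<theta> i)"
    and p: "p \<in> junctions R {1..N}"
  shows "\<exists>Q. rotation_matrix Q \<and> (\<forall>(z, i) \<in> junction_fibre R {1..N} p. end_tangent (\<theta> i) z = Q *v D z i)"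
proof -
  have "\<forall>n. \<exists>Q. rotation_matrix Q \<and> (\<forall>z i. (z, i) \<in> junction_fibre R {1..N} p \<longrightarrow> outer_tangent z (edge_curve R (\<Gamma>s n) i) = Q *v D z i)"
    using C_Reg_angles[OF reg p] by blast
  then obtain Q where Q: "\<And>n. rotation_matrix (Q n)"
    and QD: "\<And>n z i. (z, i) \<in> junction_fibre R {1..N} p \<Longrightarrow> outer_tangent z (edge_curve R (\<Gamma>s n) i) = Q n *v D z i" by metis
  obtain r Q' where r: "strict_mono r" and Q': "(\<lambda>n. Q (r n)) \<longlonglongrightarrow> Q'" and rot: "rotation_matrix Q'"
    by (rule rotation_matrices_compact[OF Q])
  have "end_tangent (\<theta> i) z = Q' *v D z i" if zi: "(z, i) \<in> junction_fibre R {1..N} p" for z i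
  proof (rule LIMSEQ_unique)
    have i: "i \<in> {1..N}" and z: "z \<in> {0, 1}" using zi by (auto simp: junction_fibre_def)
    show "(\<lambda>n. outer_tangent z (edge_curve R (\<Gamma>s (r n)) i)) \<longlonglongrightarrow> end_tangent (\<theta> i) z"
      by (rule edge_limit_end_tangent[OF edge_limit_subseq[OF lim[OF i] r] z])
    show "(\<lambda>n. outer_tangent z (edge_curve R (\<Gamma>s (r n)) i)) \<longlonglongrightarrow> Q' *v D z i"
      unfolding QD[OF zi] by (rule tendsto_matrix_vector_mult_left[OF Q'])
  qed
  with rot show ?thesis by blast
qed

text \<open>The lengths are normalized by their sum over \<open>S\<close>, so that their limits \<open>s'\<close> along a
  subsequence sum to one and cannot all vanish. A collapsed edge has a constant limit indicatrix,
  so its normalized chord tends to \<open>s' i\<close> times the virtual tangent.\<close>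

lemma limit_potential:
  fixes D :: "nat \<Rightarrow> nat \<Rightarrow> real ^ 'd"
  assumes reg: "\<And>n. \<Gamma>s n \<in> C_Reg N R D"
    and lim: "\<And>i. i \<in> {1..N} \<Longrightarrow> edge_limit (\<lambda>n. edge_curve R (\<Gamma>s n) i) (l i) (\<beta> i) (\<theta> i)"
    and S: "S \<subseteq> {i \<in> {1..N}. l i = 0}" "S \<noteq> {}"
  shows "\<exists>(P :: point set \<Rightarrow> real ^ 'd) s.
      (\<forall>i\<in>S. 0 \<le> s i \<and> P (proj R (1, i)) - P (proj R (0, i)) = s i *\<^sub>R end_tangent (\<theta> i) 0) \<and> (\<exists>i\<in>S. s i \<noteq> 0)"
proof -
  define len where "len n i = curve_length (edge_curve R (\<Gamma>s n) i)" for n i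
  have fin: "finite S" using S(1) by (rule finite_subset) auto
  have lp: "len n i > 0" if "i \<in> S" for n i
    unfolding len_def using S that by (intro curve_length_pos C_RegD[OF reg]) auto
  define L where "L n = (\<Sum>i\<in>S. len n i)" for n
  have Lp: "L n > 0" for n unfolding L_def using fin S(2) lp by (intro sum_pos) auto
  define s where "s n i = len n i / L n" for n i
  have s01: "0 \<le> s n i \<and> s n i \<le> 1" if i: "i \<in> S" for n i
  proof -
    have "len n i \<le> L n" unfolding L_def using fin i lp by (intro member_le_sum) (auto intro: less_imp_le)
    then show ?thesis using Lp[of n] lp[OF i, of n] by (simp add: s_def)
  qed
  have s1: "(\<Sum>i\<in>S. s n i) = 1" for n
    unfolding s_def sum_divide_distrib[symmetric] L_def[symmetric] using Lp[of n] by simp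
  have "\<exists>r :: nat \<Rightarrow> nat. strict_mono r \<and> (\<forall>i\<in>S. convergent (\<lambda>n. s (r n) i))"
  proof (rule common_subsequence[OF fin])
    fix i and r :: "nat \<Rightarrow> nat" assume i: "i \<in> S"
    have "bounded (range (\<lambda>n. s (r n) i))" by (rule boundedI[of _ 1]) (use s01[OF i] in auto)
    from bounded_imp_convergent_subsequence[OF this]
    show "\<exists>s' :: nat \<Rightarrow> nat. strict_mono s' \<and> convergent (\<lambda>n. s (r (s' n)) i)"
      by (auto simp: o_def convergent_def)
  next
    fix i and r s' :: "nat \<Rightarrow> nat" assume "convergent (\<lambda>n. s (r n) i)" "strict_mono s'"
    then show "convergent (\<lambda>n. s (r (s' n)) i)"
      unfolding convergent_def using filterlim_compose[OF _ filterlim_subseq] by blast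
  qed
  then obtain r :: "nat \<Rightarrow> nat" where r: "strict_mono r" and "\<forall>i\<in>S. \<exists>x. (\<lambda>n. s (r n) i) \<longlonglongrightarrow> x"
    unfolding convergent_def by blast
  then obtain s' where s': "\<And>i. i \<in> S \<Longrightarrow> (\<lambda>n. s (r n) i) \<longlonglongrightarrow> s' i" by metis
  have s'0: "0 \<le> s' i" if "i \<in> S" for i
    using s'[OF that] s01[OF that] by (intro LIMSEQ_le_const[OF s'[OF that]]) auto
  have "(\<lambda>n. \<Sum>i\<in>S. s (r n) i) \<longlonglongrightarrow> (\<Sum>i\<in>S. s' i)" by (intro tendsto_sum s')
  then have "(\<Sum>i\<in>S. s' i) = 1" by (simp add: s1 LIMSEQ_const_iff)
  then have ne: "\<exists>i\<in>S. s' i \<noteq> 0" by (metis sum.neutral zero_neq_one)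
  define P where "P n v = (1 / L (r n)) *\<^sub>R \<Gamma>s (r n) v" for n v
  have "(\<lambda>n. P n (proj R (1, i)) - P n (proj R (0, i))) \<longlonglongrightarrow> s' i *\<^sub>R end_tangent (\<theta> i) 0" if i: "i \<in> S" for i
  proof -
    have iN: "i \<in> {1..N}" and l0: "l i = 0" using i S by auto
    let ?c = "\<lambda>n. edge_curve R (\<Gamma>s (r n)) i"
    have el: "edge_limit ?c 0 (\<beta> i) (\<theta> i)" using edge_limit_subseq[OF lim[OF iN] r] l0 by simp
    have "P n (proj R (1, i)) - P n (proj R (0, i)) = s (r n) i *\<^sub>R (LINT t:{0..1}|lborel. indicatrix (?c n) t)" for n
    proof -
      have "?c n 1 - ?c n 0 = len (r n) i *\<^sub>R (LINT t:{0..1}|lborel. indicatrix (?c n) t)"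
        using indicatrix[OF C_RegD[OF reg iN, of "r n"]] by (simp add: is_indicatrix_def len_def)
      then show ?thesis
        unfolding P_def s_def scaleR_diff_right[symmetric] edge_curve_ends by simp
    qed
    moreover have "(LINT t:{0..1}|lborel. \<theta> i t) = \<theta> i 0"
    proof -
      have "(LINT t:{0..1}|lborel. \<theta> i t) = (LINT t|lborel01. \<theta> i 0)"
        unfolding integral_lborel01[symmetric]
        by (rule Bochner_Integration.integral_cong[OF refl]) (rule edge_limit_collapsed[OF el], simp)
      then show ?thesis by simp
    qed
    ultimately show ?thesis
      using tendsto_scaleR[OF s'[OF i] edge_limit_mean[OF el]] by (simp add: end_tangent_def)
  qed
  from converging_differences_potential[where P=P and b="\<lambda>i. proj R (1, i)" and a="\<lambda>i. proj R (0, i)"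
      and w="\<lambda>i. s' i *\<^sub>R end_tangent (\<theta> i) 0", OF fin this]
  obtain p where "\<forall>i\<in>S. p (proj R (1, i)) - p (proj R (0, i)) = s' i *\<^sub>R end_tangent (\<theta> i) 0" by blast
  with s'0 ne show ?thesis by blast
qed

text \<open>The bending energy of a regular edge of \<open>\<Gamma>\<close> is determined by the derivative of \<open>\<theta> i\<close>, for
  which the bound \<open>l i * \<beta> i\<close> is known; collapsed edges lose their energy in the limit.\<close>

lemma limit_network:
  fixes D :: "nat \<Rightarrow> nat \<Rightarrow> real ^ 'd"
  assumes R: "N_graph N R" and reg: "\<And>n. \<Gamma>s n \<in> C_Reg N R D"
    and lim: "\<And>i. i \<in> {1..N} \<Longrightarrow> edge_limit (\<lambda>n. edge_curve R (\<Gamma>s n) i) (l i) (\<beta> i) (\<theta> i)"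
    and net: "network N R {1..N} \<Gamma>" and sing: "Sing R {1..N} \<Gamma> = {i \<in> {1..N}. l i = 0}"
    and len: "\<And>i. i \<in> {1..N} \<Longrightarrow> l i \<noteq> 0 \<Longrightarrow> curve_length (edge_curve R \<Gamma> i) = l i"
    and ind: "\<And>i x. i \<in> {1..N} \<Longrightarrow> l i \<noteq> 0 \<Longrightarrow> x \<in> {0..1} \<Longrightarrow> indicatrix (edge_curve R \<Gamma> i) x = \<theta> i x"
  shows "\<Gamma> \<in> C_Deg N R D" "network_energy N R \<Gamma> \<le> (\<Sum>i\<in>{1..N}. \<beta> i + l i)"
proof -
  define S where "S = {i \<in> {1..N}. l i = 0}"
  define \<tau> where "\<tau> z i = end_tangent (\<theta> i) z" for z i
  have regE: "regular_curve (edge_curve R \<Gamma> i)" if "i \<in> {1..N}" "l i \<noteq> 0" for i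
  proof -
    have "i \<notin> Sing R {1..N} \<Gamma>" unfolding sing using that by blast
    then show ?thesis using net that by (auto simp: network_def Sing_def)
  qed
  have \<tau>S: "norm (\<tau> 0 i) = 1 \<and> \<tau> 0 i = - \<tau> 1 i" if "i \<in> S" for i
  proof -
    have i: "i \<in> {1..N}" and l0: "l i = 0" using that by (auto simp: S_def)
    have el: "edge_limit (\<lambda>n. edge_curve R (\<Gamma>s n) i) 0 (\<beta> i) (\<theta> i)" using lim[OF i] l0 by simp
    show ?thesis using edge_limit_norm[OF el, of 0] edge_limit_collapsed[OF el, of 1] by (simp add: \<tau>_def end_tangent_def)
  qed
  have rot: "\<exists>Q. rotation_matrix Q \<and> (\<forall>(z, i) \<in> junction_fibre R {1..N} p. \<tau> z i = Q *v D z i)" if "p \<in> junctions R {1..N}" for p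
    unfolding \<tau>_def by (rule limit_rotation[OF reg lim that])
  have tan: "tangents R {1..N} \<Gamma> \<tau>"
    unfolding tangents_def sing
  proof (intro conjI ballI)
    fix i z assume i: "i \<in> {1..N} - {i \<in> {1..N}. l i = 0}" and z: "z \<in> {0, 1::nat}"
    then have iN: "i \<in> {1..N}" and l0: "l i \<noteq> 0" by auto
    have "outer_tangent z (edge_curve R \<Gamma> i) = end_tangent (indicatrix (edge_curve R \<Gamma> i)) z"
      by (rule end_tangent_indicatrix[OF indicatrix[OF regE[OF iN l0]] z])
    then show "\<tau> z i = outer_tangent z (edge_curve R \<Gamma> i)"
      using ind[OF iN l0, of 0] ind[OF iN l0, of 1] by (simp add: \<tau>_def end_tangent_def)
  next
    fix i assume "i \<in> {i \<in> {1..N}. l i = 0}"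
    then show "norm (\<tau> 0 i) = 1" "\<tau> 0 i = - \<tau> 1 i" using \<tau>S[of i] by (auto simp: S_def)
  qed
  have ang: "angle_condition_with R {1..N} D \<Gamma> \<tau>"
    unfolding angle_condition_with_def using tan rot by blast
  have SN: "S \<subseteq> {1..N}" by (auto simp: S_def)
  have "stratified_straight_with N R S D \<tau>"
  proof (rule stratified_straightI[OF R SN \<tau>S])
    fix p assume "p \<in> junctions R S"
    then have "p \<in> junctions R {1..N}" using SN by (auto simp: junctions_def interval_ends_def)
    moreover have "junction_fibre R S p \<subseteq> junction_fibre R {1..N} p" using SN by (auto simp: junction_fibre_def)
    ultimately show "\<exists>Q. rotation_matrix Q \<and> (\<forall>(z, i) \<in> junction_fibre R S p. \<tau> z i = Q *v D z i)"
      using rot[of p] by blast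
  next
    fix S' assume S': "S' \<subseteq> S" "S' \<noteq> {}"
    show "\<exists>(P :: point set \<Rightarrow> real ^ 'd) s.
      (\<forall>i\<in>S'. 0 \<le> s i \<and> P (proj R (1, i)) - P (proj R (0, i)) = s i *\<^sub>R \<tau> 0 i) \<and> (\<exists>i\<in>S'. s i \<noteq> 0)"
      unfolding \<tau>_def by (rule limit_potential[OF reg lim]) (use S' in \<open>simp_all add: S_def\<close>)
  qed
  then have "stratified_straight_with N R (Sing R {1..N} \<Gamma>) D \<tau>" unfolding sing S_def .
  then show "\<Gamma> \<in> C_Deg N R D" unfolding C_Deg_def using net ang by blast
  have \<beta>0: "0 \<le> \<beta> i" if "i \<in> {1..N}" for i
    using lim[OF that] unfolding edge_limit_def
    by (intro LIMSEQ_le_const[of "\<lambda>n. bending_energy (edge_curve R (\<Gamma>s n) i)"]) (auto intro: bending_energy_nonneg)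
  show "network_energy N R \<Gamma> \<le> (\<Sum>i\<in>{1..N}. \<beta> i + l i)"
    unfolding network_energy_eq_sum
  proof (rule sum_mono)
    fix i assume i: "i \<in> {1..N}"
    show "bending_energy (edge_curve R \<Gamma> i) + curve_length (edge_curve R \<Gamma> i) \<le> \<beta> i + l i"
    proof (cases "l i = 0")
      case True
      then have "singular_curve (edge_curve R \<Gamma> i)" using sing i by (auto simp: Sing_def)
      from singular_energy[OF this] show ?thesis using \<beta>0[OF i] True by simp
    next
      case False
      have r: "regular_curve (edge_curve R \<Gamma> i)" by (rule regE[OF i False])
      have lpos: "l i > 0" using curve_length_pos[OF r] len[OF i False] by simp
      obtain g where g: "H1_path (indicatrix (edge_curve R \<Gamma> i)) g"
        "inner_L2 lborel01 g g = curve_length (edge_curve R \<Gamma> i) * bending_energy (edge_curve R \<Gamma> i)"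
        using indicatrix[OF r] unfolding is_indicatrix_def by blast
      obtain h where h: "H1_path (\<theta> i) h" "inner_L2 lborel01 h h \<le> l i * \<beta> i" using edge_limit_H1[OF lim[OF i]] by blast
      have "AE t in lborel01. g t = h t" by (rule H1_path_unique[OF g(1) h(1) ind[OF i False]])
      then have "inner_L2 lborel01 g g = inner_L2 lborel01 h h" by (intro inner_L2_self_cong_AE H1_path_L2[OF g(1)] H1_path_L2[OF h(1)])
      then have "l i * bending_energy (edge_curve R \<Gamma> i) \<le> l i * \<beta> i" using g(2) h(2) len[OF i False] by simp
      then have "bending_energy (edge_curve R \<Gamma> i) \<le> \<beta> i" using lpos by simp
      then show ?thesis using len[OF i False] by simp
    qed
  qed
qed

lemma network_compactness:
  fixes D :: "nat \<Rightarrow> nat \<Rightarrow> real ^ 'd" and \<Gamma>s :: "nat \<Rightarrow> point set \<Rightarrow> real ^ 'd"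
  assumes reg: "\<And>n. \<Gamma>s n \<in> C_Reg N R D" and bd: "\<And>n. network_energy N R (\<Gamma>s n) \<le> C"
  shows "\<exists>(r :: nat \<Rightarrow> nat) l \<beta> \<theta>. strict_mono r \<and>
    (\<forall>i\<in>{1..N}. edge_limit (\<lambda>n. edge_curve R (\<Gamma>s (r n)) i) (l i) (\<beta> i) (\<theta> i))"
proof -
  have total: "bending_energy (edge_curve R (\<Gamma>s n) i) + curve_length (edge_curve R (\<Gamma>s n) i) \<le> C" if "i \<in> {1..N}" for n i
  proof -
    have "bending_energy (edge_curve R (\<Gamma>s n) i) + curve_length (edge_curve R (\<Gamma>s n) i) \<le> network_energy N R (\<Gamma>s n)"
      unfolding network_energy_eq_sum
      by (rule member_le_sum[OF that]) (auto intro: add_nonneg_nonneg bending_energy_nonneg curve_length_nonneg)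
    then show ?thesis using bd[of n] by linarith
  qed
  have lC: "curve_length (edge_curve R (\<Gamma>s n) i) \<le> C" "bending_energy (edge_curve R (\<Gamma>s n) i) \<le> C" if "i \<in> {1..N}" for n i
    using total[OF that, of n] bending_energy_nonneg[of "edge_curve R (\<Gamma>s n) i"] curve_length_nonneg[of "edge_curve R (\<Gamma>s n) i"] by linarith+
  have "\<exists>r :: nat \<Rightarrow> nat. strict_mono r \<and> (\<forall>i\<in>{1..N}. \<exists>l \<beta> \<theta>. edge_limit (\<lambda>n. edge_curve R (\<Gamma>s (r n)) i) l \<beta> \<theta>)"
  proof (rule common_subsequence)
    fix i and r :: "nat \<Rightarrow> nat" assume i: "i \<in> {1..N}"
    obtain s l \<beta> \<theta> where "strict_mono s" "edge_limit (\<lambda>n. edge_curve R (\<Gamma>s (r (s n))) i) l \<beta> \<theta>"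
      by (rule edge_compactness[of "\<lambda>n. edge_curve R (\<Gamma>s (r n)) i" C, OF C_RegD[OF reg i] lC[OF i]])
    then show "\<exists>s :: nat \<Rightarrow> nat. strict_mono s \<and> (\<exists>l \<beta> \<theta>. edge_limit (\<lambda>n. edge_curve R (\<Gamma>s (r (s n))) i) l \<beta> \<theta>)" by blast
  next
    fix i and r s :: "nat \<Rightarrow> nat"
    assume "\<exists>l \<beta> \<theta>. edge_limit (\<lambda>n. edge_curve R (\<Gamma>s (r n)) i) l \<beta> \<theta>" "strict_mono s"
    then show "\<exists>l \<beta> \<theta>. edge_limit (\<lambda>n. edge_curve R (\<Gamma>s (r (s n))) i) l \<beta> \<theta>"
      using edge_limit_subseq[of "\<lambda>n. edge_curve R (\<Gamma>s (r n)) i"] by blast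
  qed simp
  then obtain r :: "nat \<Rightarrow> nat" where r: "strict_mono r"
    and ex: "\<forall>i\<in>{1..N}. \<exists>l \<beta> \<theta>. edge_limit (\<lambda>n. edge_curve R (\<Gamma>s (r n)) i) l \<beta> \<theta>" by blast
  from bchoice[OF ex] obtain l where "\<forall>i\<in>{1..N}. \<exists>\<beta> \<theta>. edge_limit (\<lambda>n. edge_curve R (\<Gamma>s (r n)) i) (l i) \<beta> \<theta>" by blast
  from bchoice[OF this] obtain \<beta> where "\<forall>i\<in>{1..N}. \<exists>\<theta>. edge_limit (\<lambda>n. edge_curve R (\<Gamma>s (r n)) i) (l i) (\<beta> i) \<theta>" by blast
  from bchoice[OF this] obtain \<theta> where "\<forall>i\<in>{1..N}. edge_limit (\<lambda>n. edge_curve R (\<Gamma>s (r n)) i) (l i) (\<beta> i) (\<theta> i)" by blast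
  with r show ?thesis by blast
qed

lemma edge_limits_energy:
  assumes "\<And>i. i \<in> {1..N} \<Longrightarrow> edge_limit (\<lambda>n. edge_curve R (\<Gamma>s n) i) (l i) (\<beta> i) (\<theta> i)"
  shows "(\<lambda>n. network_energy N R (\<Gamma>s n)) \<longlonglongrightarrow> (\<Sum>i\<in>{1..N}. \<beta> i + l i)"
  unfolding network_energy_eq_sum
  using assms by (intro tendsto_sum tendsto_add) (auto simp: edge_limit_def)

section \<open>Lower semicontinuity\<close>

lemma set_LINT_nonneg:
  fixes f :: "real \<Rightarrow> real"
  assumes "\<And>t. t \<in> A \<Longrightarrow> 0 \<le> f t"
  shows "0 \<le> (LINT t:A|lborel. f t)"
  unfolding set_lebesgue_integral_def
  by (rule Bochner_Integration.integral_nonneg) (use assms in \<open>auto simp: indicator_def\<close>)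

lemma reparametrization_range:
  assumes \<phi>: "reparametrization \<phi>" and t: "t \<in> {0..1}"
  shows "\<phi> t \<in> {0..1}"
proof -
  have H: "H2_curve \<phi>" and e: "\<phi> 0 = 0" "\<phi> 1 = 1" and p: "\<And>t. t \<in> {0..1} \<Longrightarrow> 0 < velocity \<phi> t"
    using \<phi> by (auto simp: reparametrization_def)
  have i: "integrable lborel01 (velocity \<phi>)" by (intro continuous_integrable_lborel01 H2_velocity_continuous H)
  have path: "\<phi> s = \<phi> 0 + (LINT r:{0..s}|lborel. velocity \<phi> r)" if "s \<in> {0..1}" for s
    using curve_H1_path[OF H] that unfolding H1_path_def by blast
  have "0 \<le> (LINT r:{0..t}|lborel. velocity \<phi> r)" "0 \<le> (LINT r:{t..1}|lborel. velocity \<phi> r)"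
    by (rule set_LINT_nonneg, rule less_imp_le, rule p, use t in auto)+
  then show ?thesis
    using path[OF t] path[of 1] set_LINT_combine[OF i, of t 1] t e by auto
qed

lemma reparametrized_velocity:
  fixes c :: "real \<Rightarrow> 'a::euclidean_space"
  assumes c: "H2_curve c" and \<phi>: "reparametrization \<phi>" and t: "t \<in> {0..1}"
  shows "velocity (c \<circ> \<phi>) t = velocity \<phi> t *\<^sub>R velocity c (\<phi> t)"
proof (rule velocity_eqI[OF vector_diff_chain_within t])
  show "(\<phi> has_vector_derivative velocity \<phi> t) (at t within {0..1})"
    using \<phi> t by (intro H2_curveD(1)) (auto simp: reparametrization_def)
  show "(c has_vector_derivative velocity c (\<phi> t)) (at (\<phi> t) within \<phi> ` {0..1})"
    using reparametrization_range[OF \<phi>]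
    by (intro has_vector_derivative_within_subset[OF H2_curveD(1)[OF c reparametrization_range[OF \<phi> t]]]) auto
qed

lemma reparametrized_tangent:
  assumes "H2_curve c" "reparametrization \<phi>" "t \<in> {0..1}"
  shows "sgn (velocity (c \<circ> \<phi>) t) = sgn (velocity c (\<phi> t))"
proof -
  have "velocity \<phi> t > 0" using assms by (simp add: reparametrization_def)
  then show ?thesis by (simp add: reparametrized_velocity[OF assms] sgn_scaleR)
qed

text \<open>Both sides have the same derivative in \<open>t\<close>.\<close>

lemma reparametrized_arclength:
  assumes c: "H2_curve c" and \<phi>: "reparametrization \<phi>" and F: "H2_curve (c \<circ> \<phi>)" and t: "t \<in> {0..1}"
  shows "(LINT s:{0..t}|lborel. norm (velocity (c \<circ> \<phi>) s)) = (LINT s:{0..\<phi> t}|lborel. norm (velocity c s))"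
proof -
  have cc: "continuous_on {0..1} (\<lambda>s. norm (velocity c s))" by (intro continuous_intros H2_velocity_continuous c)
  have cF: "continuous_on {0..1} (\<lambda>s. norm (velocity (c \<circ> \<phi>) s))" by (intro continuous_intros H2_velocity_continuous F)
  have H: "H2_curve \<phi>" and e: "\<phi> 0 = 0" and p: "\<And>t. t \<in> {0..1} \<Longrightarrow> 0 < velocity \<phi> t"
    using \<phi> by (auto simp: reparametrization_def)
  define G where "G x = integral {0..x} (\<lambda>s. norm (velocity c s))" for x
  have "((\<lambda>s. norm (velocity (c \<circ> \<phi>) s)) has_integral (G \<circ> \<phi>) t - (G \<circ> \<phi>) 0) {0..t}"
  proof (rule fundamental_theorem_of_calculus)
    fix s assume s: "s \<in> {0..t}"
    then have s1: "s \<in> {0..1}" using t by auto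
    have sub: "{0..t} \<subseteq> {0..1}" using t by auto
    have "(\<phi> has_vector_derivative velocity \<phi> s) (at s within {0..t})"
      by (rule has_vector_derivative_within_subset[OF H2_curveD(1)[OF H s1] sub])
    moreover have "(G has_vector_derivative norm (velocity c (\<phi> s))) (at (\<phi> s) within \<phi> ` {0..t})"
    proof (rule has_vector_derivative_within_subset)
      show "(G has_vector_derivative norm (velocity c (\<phi> s))) (at (\<phi> s) within {0..1})"
        unfolding G_def by (rule integral_has_vector_derivative[OF cc reparametrization_range[OF \<phi> s1]])
      show "\<phi> ` {0..t} \<subseteq> {0..1}" using reparametrization_range[OF \<phi>] sub by blast
    qed
    ultimately have "((G \<circ> \<phi>) has_vector_derivative velocity \<phi> s *\<^sub>R norm (velocity c (\<phi> s))) (at s within {0..t})"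
      by (rule vector_diff_chain_within)
    moreover have "velocity \<phi> s *\<^sub>R norm (velocity c (\<phi> s)) = norm (velocity (c \<circ> \<phi>) s)"
      using p[OF s1] by (simp add: reparametrized_velocity[OF c \<phi> s1])
    ultimately show "((G \<circ> \<phi>) has_vector_derivative norm (velocity (c \<circ> \<phi>) s)) (at s within {0..t})" by simp
  qed (use t in auto)
  from integral_unique[OF this] have "integral {0..t} (\<lambda>s. norm (velocity (c \<circ> \<phi>) s)) = G (\<phi> t)"
    by (simp add: e G_def)
  moreover have "(LINT s:{0..t}|lborel. norm (velocity (c \<circ> \<phi>) s)) = integral {0..t} (\<lambda>s. norm (velocity (c \<circ> \<phi>) s))"
    using t by (intro set_LINT_eq_integral(1) continuous_integrable_lborel01 cF) auto
  moreover have "(LINT s:{0..\<phi> t}|lborel. norm (velocity c s)) = G (\<phi> t)"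
    unfolding G_def using reparametrization_range[OF \<phi> t]
    by (intro set_LINT_eq_integral(1) continuous_integrable_lborel01 cc) auto
  ultimately show ?thesis by simp
qed

lemma reparametrized_length:
  assumes "H2_curve c" "reparametrization \<phi>" "H2_curve (c \<circ> \<phi>)"
  shows "curve_length (c \<circ> \<phi>) = curve_length c"
proof -
  have "\<phi> 1 = 1" using assms(2) by (simp add: reparametrization_def)
  then show ?thesis unfolding curve_length_def using reparametrized_arclength[OF assms, of 1] by simp
qed

lemma reparametrized_arclength_param:
  assumes "H2_curve c" "reparametrization \<phi>" "H2_curve (c \<circ> \<phi>)" "t \<in> {0..1}"
  shows "arclength_param (c \<circ> \<phi>) t = arclength_param c (\<phi> t)"
  by (simp only: arclength_param_def reparametrized_arclength[OF assms] reparametrized_length[OF assms(1-3)])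

text \<open>Lengths and normalized arclengths converge by bounded convergence of the speeds. The
  indicatrix of \<open>c n\<close> at the normalized arclength of the point \<open>\<phi> n t\<close> is the unit tangent of \<open>c n \<circ> \<phi> n\<close> at \<open>t\<close>; in the
  limit \<open>\<theta>\<close> and the indicatrix of \<open>f\<close> agree at the normalized arclength of every \<open>t\<close>.\<close>

lemma weak_limit_edge:
  fixes c :: "nat \<Rightarrow> real \<Rightarrow> 'a::euclidean_space"
  assumes lim: "edge_limit c l \<beta> \<theta>" and \<phi>: "\<And>n. reparametrization (\<phi> n)"
    and w: "weakly_converges_H2 (\<lambda>n. c n \<circ> \<phi> n) f"
  shows "l = curve_length f"
    "\<And>x. regular_curve f \<Longrightarrow> x \<in> {0..1} \<Longrightarrow> indicatrix f x = \<theta> x"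
proof -
  define F where "F n = c n \<circ> \<phi> n" for n
  have reg: "regular_curve (c n)" for n using lim by (simp add: edge_limit_def)
  have cH: "H2_curve (c n)" for n using reg[of n] by (simp add: regular_curve_def)
  have FH: "H2_curve (c n \<circ> \<phi> n)" for n using w by (simp add: weakly_converges_H2_def)
  have fH: "H2_curve f" using w by (simp add: weakly_converges_H2_def)
  obtain B where B: "\<And>n t. t \<in> {0..1} \<Longrightarrow> norm (velocity (F n) t) \<le> B"
    using weak_H2_velocity_bounded[OF w] unfolding F_def by blast
  have vl: "(\<lambda>n. velocity (F n) t) \<longlonglongrightarrow> velocity f t" if "t \<in> {0..1}" for t
    unfolding F_def by (rule weak_H2_velocity_tendsto[OF w that])
  have prim: "(\<lambda>n. LINT s:{0..t}|lborel. norm (velocity (F n) s)) \<longlonglongrightarrow> (LINT s:{0..t}|lborel. norm (velocity f s))"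
    if t: "t \<in> {0..1}" for t
  proof -
    have restrict: "(LINT s:{0..t}|lborel. g s) = (LINT s|lborel01. indicator {0..t} s *\<^sub>R g s)" for g :: "real \<Rightarrow> real"
      using t by (intro set_LINT_lborel01) auto
    have ind: "(\<lambda>s. indicator {0..t} s :: real) \<in> borel_measurable lborel01"
      by (auto simp: lborel01_def intro!: measurable_restrict_space1)
    have m: "(\<lambda>s. indicator {0..t} s *\<^sub>R norm (velocity g s)) \<in> borel_measurable lborel01" if "H2_curve g" for g :: "real \<Rightarrow> 'a"
    proof -
      have "(\<lambda>s. norm (velocity g s)) \<in> borel_measurable lborel01"
        by (intro continuous_measurable_lborel01 continuous_intros H2_velocity_continuous that)
      then show ?thesis using ind by (intro borel_measurable_scaleR)
    qed
    show ?thesis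
      unfolding restrict
    proof (rule integral_lborel01_tendsto[where B=B])
      show "(\<lambda>s. indicator {0..t} s *\<^sub>R norm (velocity (F n) s)) \<in> borel_measurable lborel01" for n
        unfolding F_def by (rule m[OF FH])
      show "(\<lambda>s. indicator {0..t} s *\<^sub>R norm (velocity f s)) \<in> borel_measurable lborel01" by (rule m[OF fH])
      fix s :: real assume s: "s \<in> {0..1}"
      show "(\<lambda>n. indicator {0..t} s *\<^sub>R norm (velocity (F n) s)) \<longlonglongrightarrow> indicator {0..t} s *\<^sub>R norm (velocity f s)"
        by (intro tendsto_intros vl[OF s])
      show "norm (indicator {0..t} s *\<^sub>R norm (velocity (F n) s)) \<le> B" for n
        using B[OF s, of n] order_trans[OF norm_ge_zero B[OF s, of n]] by (simp add: indicator_def)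
    qed
  qed
  have len: "curve_length (F n) = curve_length (c n)" for n
    unfolding F_def by (rule reparametrized_length[OF cH \<phi> FH])
  have lF: "(\<lambda>n. curve_length (F n)) \<longlonglongrightarrow> curve_length f"
    unfolding curve_length_def by (rule prim) simp
  moreover have "(\<lambda>n. curve_length (F n)) \<longlonglongrightarrow> l" using lim by (simp add: len edge_limit_def)
  ultimately show "l = curve_length f" using LIMSEQ_unique by blast
  fix x :: real assume f: "regular_curve f" and x: "x \<in> {0..1}"
  obtain t where t: "t \<in> {0..1}" and tx: "arclength_param f t = x" by (rule arclength_param_onto[OF f x]) 
  have If: "is_indicatrix f (indicatrix f)" by (rule indicatrix[OF f])
  define X where "X n = arclength_param (F n) t" for n
  have Xl: "X \<longlonglongrightarrow> x"
    unfolding X_def arclength_param_def tx[symmetric]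
    using curve_length_pos[OF f] by (intro tendsto_divide prim[OF t] lF) simp
  have Xc: "X n = arclength_param (c n) (\<phi> n t)" for n
    unfolding X_def F_def by (rule reparametrized_arclength_param[OF cH \<phi> FH t])
  have Ic: "is_indicatrix (c n) (indicatrix (c n))" for n by (rule indicatrix[OF reg])
  have XU: "X n \<in> {0..1}" and IX: "indicatrix (c n) (X n) = sgn (velocity (F n) t)" for n
  proof -
    have r: "\<phi> n t \<in> {0..1}" by (rule reparametrization_range[OF \<phi> t])
    show "X n \<in> {0..1}" unfolding Xc using Ic[of n] r unfolding is_indicatrix_def by blast
    have "indicatrix (c n) (X n) = sgn (velocity (c n) (\<phi> n t))"
      unfolding Xc using Ic[of n] r unfolding is_indicatrix_def by blast
    then show "indicatrix (c n) (X n) = sgn (velocity (F n) t)"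
      unfolding F_def by (simp only: reparametrized_tangent[OF cH \<phi> t])
  qed
  have "(\<lambda>n. indicatrix (c n) (X n) - \<theta> (X n)) \<longlonglongrightarrow> 0"
  proof (rule tendstoI)
    fix e :: real assume "e > 0"
    moreover have "uniform_limit {0..1} (\<lambda>n. indicatrix (c n)) \<theta> sequentially" using lim by (simp add: edge_limit_def)
    ultimately have "\<forall>\<^sub>F n in sequentially. \<forall>x\<in>{0..1}. dist (indicatrix (c n) x) (\<theta> x) < e"
      by (rule uniform_limitD[rotated])
    then show "\<forall>\<^sub>F n in sequentially. dist (indicatrix (c n) (X n) - \<theta> (X n)) 0 < e"
    proof eventually_elim
      case (elim n)
      from bspec[OF elim XU[of n]] show ?case by (simp add: dist_norm)
    qed
  qed
  moreover have "(\<lambda>n. \<theta> (X n)) \<longlonglongrightarrow> \<theta> x"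
    by (rule continuous_on_tendsto_compose[OF edge_limit_continuous[OF lim] Xl x]) (intro always_eventually allI XU)
  ultimately have "(\<lambda>n. indicatrix (c n) (X n) - \<theta> (X n) + \<theta> (X n)) \<longlonglongrightarrow> 0 + \<theta> x" by (rule tendsto_add)
  then have 1: "(\<lambda>n. sgn (velocity (F n) t)) \<longlonglongrightarrow> \<theta> x" by (simp add: IX)
  have "(\<lambda>n. sgn (velocity (F n) t)) \<longlonglongrightarrow> sgn (velocity f t)"
    by (intro tendsto_sgn vl[OF t] regular_curve_nonzero[OF f t])
  with 1 have "\<theta> x = sgn (velocity f t)" by (rule LIMSEQ_unique)
  moreover have "indicatrix f (arclength_param f t) = sgn (velocity f t)"
    using If t unfolding is_indicatrix_def by blast
  ultimately show "indicatrix f x = \<theta> x" by (simp only: tx)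
qed

lemma network_energy_nonneg: "0 \<le> network_energy N R \<Gamma>"
  unfolding network_energy_eq_sum
  by (intro sum_nonneg add_nonneg_nonneg bending_energy_nonneg curve_length_nonneg)

lemma weakly_converges_network_subseq:
  assumes "weakly_converges_network N R \<Gamma>s \<Gamma>" "strict_mono r"
  shows "weakly_converges_network N R (\<lambda>n. \<Gamma>s (r n)) \<Gamma>"
  unfolding weakly_converges_network_def
proof
  fix i assume "i \<in> {1..N}"
  then obtain \<phi> where \<phi>: "\<And>n. reparametrization (\<phi> n)"
    and w: "weakly_converges_H2 (\<lambda>n. edge_curve R (\<Gamma>s n) i \<circ> \<phi> n) (edge_curve R \<Gamma> i)"
    using assms(1) unfolding weakly_converges_network_def by blast
  have "weakly_converges_H2 (\<lambda>n. edge_curve R (\<Gamma>s (r n)) i \<circ> \<phi> (r n)) (edge_curve R \<Gamma> i)"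
    using w unfolding weakly_converges_H2_def
    using filterlim_compose[OF _ filterlim_subseq[OF assms(2)]] by blast
  with \<phi> show "\<exists>\<phi>. (\<forall>n. reparametrization (\<phi> n)) \<and>
      weakly_converges_H2 (\<lambda>n. edge_curve R (\<Gamma>s (r n)) i \<circ> \<phi> n) (edge_curve R \<Gamma> i)"
    by (intro exI[of _ "\<lambda>n. \<phi> (r n)"]) blast
qed

lemma lower_semicontinuity:
  fixes D :: "nat \<Rightarrow> nat \<Rightarrow> real ^ 'd"
  assumes R: "N_graph N R" and reg: "\<And>n. \<Gamma>s n \<in> C_Reg N R D"
    and w: "weakly_converges_network N R \<Gamma>s \<Gamma>" and net: "network N R {1..N} \<Gamma>"
    and m: "(\<lambda>n. network_energy N R (\<Gamma>s n)) \<longlonglongrightarrow> m"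
  shows "\<Gamma> \<in> C_Deg N R D" "network_energy N R \<Gamma> \<le> m"
proof -
  have "Bseq (\<lambda>n. network_energy N R (\<Gamma>s n))" using m by (intro convergent_imp_Bseq convergentI)
  then obtain C where "\<forall>n. norm (network_energy N R (\<Gamma>s n)) \<le> C" unfolding Bseq_def by blast
  then have C: "network_energy N R (\<Gamma>s n) \<le> C" for n unfolding real_norm_def using abs_le_D1 by blast
  obtain r l \<beta> \<theta> where r: "strict_mono r"
    and limits: "\<forall>i\<in>{1..N}. edge_limit (\<lambda>n. edge_curve R (\<Gamma>s (r n)) i) (l i) (\<beta> i) (\<theta> i)"
    using network_compactness[where \<Gamma>s=\<Gamma>s, OF reg C] by blast
  have lim: "edge_limit (\<lambda>n. edge_curve R (\<Gamma>s (r n)) i) (l i) (\<beta> i) (\<theta> i)" if "i \<in> {1..N}" for i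
    by (rule bspec[OF limits that])
  have mE: "m = (\<Sum>i\<in>{1..N}. \<beta> i + l i)"
    using filterlim_compose[OF m filterlim_subseq[OF r]] edge_limits_energy[OF lim] by (rule LIMSEQ_unique)
  have E: "l i = curve_length (edge_curve R \<Gamma> i)"
    "regular_curve (edge_curve R \<Gamma> i) \<Longrightarrow> x \<in> {0..1} \<Longrightarrow> indicatrix (edge_curve R \<Gamma> i) x = \<theta> i x" if i: "i \<in> {1..N}" for i x
  proof -
    obtain \<phi> where \<phi>: "\<And>n. reparametrization (\<phi> n)"
      and w': "weakly_converges_H2 (\<lambda>n. edge_curve R (\<Gamma>s (r n)) i \<circ> \<phi> n) (edge_curve R \<Gamma> i)"
      using weakly_converges_network_subseq[OF w r] i unfolding weakly_converges_network_def by blast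
    show "l i = curve_length (edge_curve R \<Gamma> i)" by (rule weak_limit_edge(1)[OF lim[OF i] \<phi> w'])
    show "indicatrix (edge_curve R \<Gamma> i) x = \<theta> i x" if "regular_curve (edge_curve R \<Gamma> i)" "x \<in> {0..1}"
      by (rule weak_limit_edge(2)[OF lim[OF i] \<phi> w' that])
  qed
  have dich: "singular_curve (edge_curve R \<Gamma> i) \<or> regular_curve (edge_curve R \<Gamma> i)" if "i \<in> {1..N}" for i
    using net that by (simp add: network_def)
  have l0: "singular_curve (edge_curve R \<Gamma> i) \<longleftrightarrow> l i = 0" if i: "i \<in> {1..N}" for i
  proof
    assume "singular_curve (edge_curve R \<Gamma> i)"
    from singular_energy(2)[OF this] show "l i = 0" unfolding E(1)[OF i] .
  next
    assume "l i = 0"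
    then have "\<not> regular_curve (edge_curve R \<Gamma> i)"
      using curve_length_pos[of "edge_curve R \<Gamma> i"] unfolding E(1)[OF i] by auto
    then show "singular_curve (edge_curve R \<Gamma> i)" using dich[OF i] by blast
  qed
  have sing: "Sing R {1..N} \<Gamma> = {i \<in> {1..N}. l i = 0}" using l0 by (auto simp: Sing_def)
  have len: "curve_length (edge_curve R \<Gamma> i) = l i" if "i \<in> {1..N}" "l i \<noteq> 0" for i using E(1)[OF that(1)] by simp
  have ind: "indicatrix (edge_curve R \<Gamma> i) x = \<theta> i x" if "i \<in> {1..N}" "l i \<noteq> 0" "x \<in> {0..1}" for i x
    using E(2)[OF that(1) _ that(3)] dich[OF that(1)] l0[OF that(1)] that(2) by blast
  show "\<Gamma> \<in> C_Deg N R D" by (rule limit_network(1)[OF R reg lim net sing len ind])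
  show "network_energy N R \<Gamma> \<le> m" unfolding mE by (rule limit_network(2)[OF R reg lim net sing len ind])
qed

section \<open>Existence of limit networks and minimizers\<close>

text \<open>The curve has constant speed \<open>l\<close>, hence the parameter is the normalized arclength.\<close>

lemma curve_with_indicatrix:
  fixes \<theta> :: "real \<Rightarrow> 'a::euclidean_space"
  assumes \<theta>: "H1_path \<theta> h" and n: "\<And>x. x \<in> {0..1} \<Longrightarrow> norm (\<theta> x) = 1" and l: "l > 0"
    and \<kappa>: "\<And>t. \<kappa> t = p + l *\<^sub>R integral {0..t} \<theta>"
  shows "regular_curve \<kappa>" "curve_length \<kappa> = l" "\<And>x. x \<in> {0..1} \<Longrightarrow> indicatrix \<kappa> x = \<theta> x"
proof -
  have hL: "L2 lborel01 h" and prim: "\<And>t. t \<in> {0..1} \<Longrightarrow> \<theta> t = \<theta> 0 + (LINT s:{0..t}|lborel. h s)"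
    using \<theta> unfolding H1_path_def by blast+
  have \<kappa>f: "\<kappa> = (\<lambda>t. p + l *\<^sub>R integral {0..t} \<theta>)" using \<kappa> by blast
  have d: "(\<kappa> has_vector_derivative l *\<^sub>R \<theta> t) (at t within {0..1})" if "t \<in> {0..1}" for t
    unfolding \<kappa>f using integral_has_vector_derivative[OF H1_path_continuous[OF \<theta>] that]
    by (auto intro!: derivative_eq_intros)
  have L: "L2 lborel01 (\<lambda>t. l *\<^sub>R h t)" by (rule L2_scale[OF hL])
  have v: "l *\<^sub>R \<theta> t = l *\<^sub>R \<theta> 0 + (LINT s:{0..t}|lborel. l *\<^sub>R h s)" if "t \<in> {0..1}" for t
    using arg_cong[OF prim[OF that], of "\<lambda>x. l *\<^sub>R x"] by (simp only: scaleR_add_right set_integral_scaleR_right)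
  have H: "H2_curve \<kappa>" by (rule H2_curveI(1)[OF d L v])
  have vel: "velocity \<kappa> t = l *\<^sub>R \<theta> t" if "t \<in> {0..1}" for t
    by (rule H2_curveI(2)[OF d L v]) (use that in simp_all)
  have sp: "norm (velocity \<kappa> t) = l" if "t \<in> {0..1}" for t using vel[OF that] n[OF that] l by simp
  show reg: "regular_curve \<kappa>"
  proof -
    have "velocity \<kappa> t \<noteq> 0" if "t \<in> {0..1}" for t using sp[OF that] l by auto
    then show ?thesis unfolding regular_curve_def using H by blast
  qed
  have pr: "(LINT s:{0..t}|lborel. norm (velocity \<kappa> s)) = l * t" if t: "t \<in> {0..1}" for t
  proof -
    have "(LINT s:{0..t}|lborel. norm (velocity \<kappa> s)) = (LINT s:{0..t}|lborel. l)"
      by (rule set_lebesgue_integral_cong) (use sp t in auto)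
    also have "\<dots> = l * t" using t by (simp add: set_lebesgue_integral_def)
    finally show ?thesis .
  qed
  show len: "curve_length \<kappa> = l" unfolding curve_length_def using pr[of 1] by simp
  fix x :: real assume x: "x \<in> {0..1}"
  have "arclength_param \<kappa> x = x" using pr[OF x] l by (simp add: arclength_param_def len)
  moreover have "indicatrix \<kappa> (arclength_param \<kappa> x) = sgn (velocity \<kappa> x)"
    using indicatrix[OF reg] x unfolding is_indicatrix_def by blast
  ultimately have "indicatrix \<kappa> x = sgn (l *\<^sub>R \<theta> x)" by (simp only: vel[OF x])
  also have "\<dots> = \<theta> x" using l n[OF x] by (simp add: sgn_div_norm)
  finally show "indicatrix \<kappa> x = \<theta> x" .
qed

lemma indicatrix_cong:
  assumes "\<forall>t\<in>{0..1}. c t = e t"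
  shows "indicatrix c = indicatrix e"
proof -
  have v: "velocity c t = velocity e t" if "t \<in> {0..1}" for t by (rule velocity_cong[OF assms that])
  have a: "arclength_param c t = arclength_param e t" if t: "t \<in> {0..1}" for t
  proof -
    have "(LINT s:{0..t}|lborel. norm (velocity c s)) = (LINT s:{0..t}|lborel. norm (velocity e s))"
      by (rule set_lebesgue_integral_cong) (use v t in auto)
    then show ?thesis by (simp only: arclength_param_def curve_length_cong[OF assms])
  qed
  have "c 0 = e 0" "c 1 = e 1" using assms by auto
  moreover have "(\<forall>t\<in>{0..1}. arclength_param c t \<in> {0..1} \<and> \<theta> (arclength_param c t) = sgn (velocity c t))
    \<longleftrightarrow> (\<forall>t\<in>{0..1}. arclength_param e t \<in> {0..1} \<and> \<theta> (arclength_param e t) = sgn (velocity e t))" for \<theta>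
    by (rule ball_cong[OF refl]) (simp only: v a)
  moreover have "velocity c 0 = velocity e 0" "velocity c 1 = velocity e 1" by (rule v, simp)+
  ultimately have "is_indicatrix c = is_indicatrix e"
    unfolding is_indicatrix_def fun_eq_iff by (simp only: curve_length_cong[OF assms] bending_energy_cong[OF assms] simp_thms)
  then show ?thesis by (simp add: indicatrix_def)
qed

text \<open>The chords converge, so there are vertex positions whose differences are the limits of the
  chords, and the edges are obtained by integrating \<open>\<theta> i\<close>. The sequence itself need not converge,
  since its components may drift apart.\<close>

lemma limit_realization:
  fixes D :: "nat \<Rightarrow> nat \<Rightarrow> real ^ 'd"
  assumes R: "N_graph N R" and reg: "\<And>n. \<Gamma>s n \<in> C_Reg N R D"
    and lim: "\<And>i. i \<in> {1..N} \<Longrightarrow> edge_limit (\<lambda>n. edge_curve R (\<Gamma>s n) i) (l i) (\<beta> i) (\<theta> i)"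
  shows "\<exists>\<Gamma>\<in>C_Deg N R D. network_energy N R \<Gamma> \<le> (\<Sum>i\<in>{1..N}. \<beta> i + l i)"
proof -
  have \<theta>c: "continuous_on {0..1} (\<theta> i)" if "i \<in> {1..N}" for i by (rule edge_limit_continuous[OF lim[OF that]])
  have "(\<lambda>n. \<Gamma>s n (proj R (1, i)) - \<Gamma>s n (proj R (0, i))) \<longlonglongrightarrow> l i *\<^sub>R (LINT t:{0..1}|lborel. \<theta> i t)" if "i \<in> {1..N}" for i
    using edge_limit_chord[OF lim[OF that]] by (simp add: edge_curve_ends)
  from converging_differences_potential[where S="{1..N}" and P=\<Gamma>s and b="\<lambda>i. proj R (1, i)" and a="\<lambda>i. proj R (0, i)"
      and w="\<lambda>i. l i *\<^sub>R (LINT t:{0..1}|lborel. \<theta> i t)", OF _ this]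
  obtain P where P: "\<And>i. i \<in> {1..N} \<Longrightarrow> P (proj R (1, i)) - P (proj R (0, i)) = l i *\<^sub>R (LINT t:{0..1}|lborel. \<theta> i t)"
    by blast
  define \<kappa> where "\<kappa> i t = P (proj R (0, i)) + l i *\<^sub>R integral {0..t} (\<theta> i)" for i t
  have kc: "continuous_on {0..1} (\<kappa> i)" if "i \<in> {1..N}" for i
    unfolding \<kappa>_def
    by (intro continuous_intros indefinite_integral_continuous_1 integrable_continuous_real \<theta>c that)
  have k0: "\<kappa> i 0 = P (proj R (0, i))" if "i \<in> {1..N}" for i by (simp add: \<kappa>_def)
  have k1: "\<kappa> i 1 = P (proj R (1, i))" if "i \<in> {1..N}" for i
  proof -
    have "(LINT t:{0..1}|lborel. \<theta> i t) = integral {0..1} (\<theta> i)"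
      by (rule set_LINT_eq_integral(1)[OF continuous_integrable_lborel01[OF \<theta>c[OF that]]]) simp_all
    then show ?thesis using P[OF that] by (simp add: \<kappa>_def algebra_simps)
  qed
  obtain \<Gamma> where edge: "\<And>i. i \<in> {1..N} \<Longrightarrow> \<forall>t\<in>{0..1}. edge_curve R \<Gamma> i t = \<kappa> i t"
    and cm: "\<And>S. continuous_map (subgraph_topology N R S) euclidean \<Gamma>"
    using glue_curves[OF R kc k0 k1] by blast
  have lpos: "0 \<le> l i" if "i \<in> {1..N}" for i
    using lim[OF that] unfolding edge_limit_def
    by (intro LIMSEQ_le_const[of "\<lambda>n. curve_length (edge_curve R (\<Gamma>s n) i)"]) (auto intro: curve_length_nonneg)
  have K: "regular_curve (\<kappa> i)" "curve_length (\<kappa> i) = l i" "x \<in> {0..1} \<Longrightarrow> indicatrix (\<kappa> i) x = \<theta> i x"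
    if i: "i \<in> {1..N}" "l i \<noteq> 0" for i x
  proof -
    obtain h where h: "H1_path (\<theta> i) h" using edge_limit_H1[OF lim[OF i(1)]] by blast
    have l: "l i > 0" using lpos[OF i(1)] i(2) by simp
    have k: "\<kappa> i t = P (proj R (0, i)) + l i *\<^sub>R integral {0..t} (\<theta> i)" for t by (simp add: \<kappa>_def)
    note C = curve_with_indicatrix[OF h edge_limit_norm[OF lim[OF i(1)]] l k]
    show "regular_curve (\<kappa> i)" "curve_length (\<kappa> i) = l i" by (rule C(1), simp) (rule C(2), simp)
    show "indicatrix (\<kappa> i) x = \<theta> i x" if "x \<in> {0..1}" by (rule C(3)) (use that in simp_all)
  qed
  have sing: "singular_curve (edge_curve R \<Gamma> i)" if "i \<in> {1..N}" "l i = 0" for i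
    unfolding singular_curve_cong[OF edge[OF that(1)]]
    by (simp add: singular_curve_def constant_on_def \<kappa>_def that(2))
  have regE: "regular_curve (edge_curve R \<Gamma> i)" if "i \<in> {1..N}" "l i \<noteq> 0" for i
    unfolding regular_curve_cong[OF edge[OF that(1)]] by (rule K(1)[OF that])
  have net: "network N R {1..N} \<Gamma>" using sing regE by (intro networkI cm) blast
  have S: "Sing R {1..N} \<Gamma> = {i \<in> {1..N}. l i = 0}"
    using sing regE singular_not_regular by (auto simp: Sing_def)
  have len: "curve_length (edge_curve R \<Gamma> i) = l i" if "i \<in> {1..N}" "l i \<noteq> 0" for i
    unfolding curve_length_cong[OF edge[OF that(1)]] by (rule K(2)[OF that])
  have ind: "indicatrix (edge_curve R \<Gamma> i) x = \<theta> i x" if "i \<in> {1..N}" "l i \<noteq> 0" "x \<in> {0..1}" for i x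
    unfolding indicatrix_cong[OF edge[OF that(1)]] by (rule K(3)[OF that])
  have "\<Gamma> \<in> C_Deg N R D" by (rule limit_network(1)[OF R reg lim net S len ind])
  moreover have "network_energy N R \<Gamma> \<le> (\<Sum>i\<in>{1..N}. \<beta> i + l i)"
    by (rule limit_network(2)[OF R reg lim net S len ind])
  ultimately show ?thesis by blast
qed

theorem theorem4p8:
  fixes N :: nat
    and R :: "(point \<times> point) set"
    and D :: "nat \<Rightarrow> nat \<Rightarrow> real ^ 'd"
  assumes "N \<ge> 1"
    and "CARD('d) \<ge> 2"
    and "N_graph N R"
    and "assigned_angles N D"
  shows "(\<forall>\<Gamma>inf :: point set \<Rightarrow> real ^ 'd. network N R {1..N} \<Gamma>inf \<longrightarrow>
            relaxed_energy N R D \<Gamma>inf =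
              Inf {liminf (\<lambda>n. ereal (network_energy N R (\<Gamma>s n))) | \<Gamma>s.
                     (\<forall>n. \<Gamma>s n \<in> C_Reg N R D) \<and> weakly_converges_network N R \<Gamma>s \<Gamma>inf})
       \<and> (\<exists>\<Gamma> :: point set \<Rightarrow> real ^ 'd. network N R {1..N} \<Gamma> \<and>
            (\<forall>\<Gamma>' :: point set \<Rightarrow> real ^ 'd. network N R {1..N} \<Gamma>' \<longrightarrow>
               relaxed_energy N R D \<Gamma> \<le> relaxed_energy N R D \<Gamma>'))"
proof (intro conjI allI impI)
  fix \<Gamma>inf :: "point set \<Rightarrow> real ^ 'd"
  assume net: "network N R {1..N} \<Gamma>inf"
  let ?A = "{liminf (\<lambda>n. ereal (network_energy N R (\<Gamma>s n))) | \<Gamma>s.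
                     (\<forall>n. \<Gamma>s n \<in> C_Reg N R D) \<and> weakly_converges_network N R \<Gamma>s \<Gamma>inf}"
  show "relaxed_energy N R D \<Gamma>inf = Inf ?A"
  proof (rule antisym)
    show "relaxed_energy N R D \<Gamma>inf \<le> Inf ?A"
    proof (rule Inf_greatest)
      fix x assume "x \<in> ?A"
      then obtain \<Gamma>s where reg: "\<And>n. \<Gamma>s n \<in> C_Reg N R D" and w: "weakly_converges_network N R \<Gamma>s \<Gamma>inf"
        and x: "x = liminf (\<lambda>n. ereal (network_energy N R (\<Gamma>s n)))" by blast
      obtain r :: "nat \<Rightarrow> nat" where r: "strict_mono r"
        and lim: "((\<lambda>n. ereal (network_energy N R (\<Gamma>s n))) \<circ> r) \<longlonglongrightarrow> x"
        unfolding x using liminf_subseq_lim[of "\<lambda>n. ereal (network_energy N R (\<Gamma>s n))"] by blast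
      have x0: "0 \<le> x"
        by (rule LIMSEQ_le_const[OF lim]) (auto simp: network_energy_nonneg)
      show "relaxed_energy N R D \<Gamma>inf \<le> x"
      proof (cases x)
        case (real m)
        then have "(\<lambda>n. network_energy N R (\<Gamma>s (r n))) \<longlonglongrightarrow> m" using lim by (simp add: o_def)
        from lower_semicontinuity[OF assms(3) reg weakly_converges_network_subseq[OF w r] net this]
        show ?thesis by (simp add: relaxed_energy_def real)
      qed (use x0 in simp_all)
    qed
    show "Inf ?A \<le> relaxed_energy N R D \<Gamma>inf"
    proof (cases "\<Gamma>inf \<in> C_Deg N R D")
      case True
      then obtain \<Gamma>s where reg: "\<And>n. \<Gamma>s n \<in> C_Reg N R D" and w: "weakly_converges_network N R \<Gamma>s \<Gamma>inf"
        and E: "(\<lambda>n. network_energy N R (\<Gamma>s n)) \<longlonglongrightarrow> network_energy N R \<Gamma>inf"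
        using recovery_sequence[OF assms(3)] by blast
      have "(\<lambda>n. ereal (network_energy N R (\<Gamma>s n))) \<longlonglongrightarrow> ereal (network_energy N R \<Gamma>inf)"
        using E by simp
      then have "liminf (\<lambda>n. ereal (network_energy N R (\<Gamma>s n))) = relaxed_energy N R D \<Gamma>inf"
        using True by (simp add: relaxed_energy_def lim_imp_Liminf)
      then have "relaxed_energy N R D \<Gamma>inf \<in> ?A" using reg w by force
      then show ?thesis by (rule Inf_lower)
    qed (simp add: relaxed_energy_def)
  qed
next
  show "\<exists>\<Gamma> :: point set \<Rightarrow> real ^ 'd. network N R {1..N} \<Gamma> \<and>
            (\<forall>\<Gamma>' :: point set \<Rightarrow> real ^ 'd. network N R {1..N} \<Gamma>' \<longrightarrow>
               relaxed_energy N R D \<Gamma> \<le> relaxed_energy N R D \<Gamma>')"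
  proof (cases "C_Deg N R D = {}")
    case True
    have "network N R {1..N} (\<lambda>_. 0 :: real ^ 'd)"
      by (intro networkI) (auto simp: singular_curve_def constant_on_def edge_curve_def)
    then show ?thesis using True by (intro exI[of _ "\<lambda>_. 0"]) (simp add: relaxed_energy_def)
  next
    case False
    define m where "m = (INF \<Gamma>\<in>C_Deg N R D. network_energy N R \<Gamma>)"
    have bb: "bdd_below (network_energy N R ` C_Deg N R D)"
      by (rule bdd_belowI2[of _ 0]) (rule network_energy_nonneg)
    have mle: "m \<le> network_energy N R \<Gamma>" if "\<Gamma> \<in> C_Deg N R D" for \<Gamma>
      unfolding m_def by (rule cINF_lower[OF bb that])
    define \<epsilon> where "\<epsilon> n = 1 / real (Suc n)" for n
    have \<epsilon>0: "\<epsilon> \<longlonglongrightarrow> 0" unfolding \<epsilon>_def by (rule LIMSEQ_Suc[OF lim_1_over_n])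
    have \<epsilon>pos: "\<epsilon> n > 0" "\<epsilon> n \<le> 1" for n by (simp_all add: \<epsilon>_def)
    have "\<exists>\<Gamma>\<in>C_Reg N R D. network_energy N R \<Gamma> < m + 2 * \<epsilon> n" for n
    proof -
      have ne: "network_energy N R ` C_Deg N R D \<noteq> {}" using False by simp
      obtain \<Gamma> where \<Gamma>: "\<Gamma> \<in> C_Deg N R D" "network_energy N R \<Gamma> < m + \<epsilon> n"
        using cInf_lessD[OF ne, of "m + \<epsilon> n"] \<epsilon>pos[of n] unfolding m_def by auto
      obtain \<tau> where d: "network N R {1..N} \<Gamma>" "angle_condition_with R {1..N} D \<Gamma> \<tau>"
        "stratified_straight_with N R (Sing R {1..N} \<Gamma>) D \<tau>" using \<Gamma>(1) by (auto simp: C_Deg_def)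
      obtain \<Gamma>' where "\<Gamma>' \<in> C_Reg N R D" "\<bar>network_energy N R \<Gamma>' - network_energy N R \<Gamma>\<bar> < \<epsilon> n"
        using degenerate_approximation[OF assms(3) d \<epsilon>pos(1)[of n]] by blast
      then show ?thesis using \<Gamma>(2) by (intro bexI[of _ \<Gamma>']) (auto simp: abs_less_iff)
    qed
    then obtain \<Gamma>s where reg: "\<And>n. \<Gamma>s n \<in> C_Reg N R D" and E: "\<And>n. network_energy N R (\<Gamma>s n) < m + 2 * \<epsilon> n"
      by metis
    have bd: "network_energy N R (\<Gamma>s n) \<le> m + 2" for n using E[of n] \<epsilon>pos(2)[of n] by linarith
    obtain r l \<beta> \<theta> where r: "strict_mono r"
      and limits: "\<forall>i\<in>{1..N}. edge_limit (\<lambda>n. edge_curve R (\<Gamma>s (r n)) i) (l i) (\<beta> i) (\<theta> i)"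
      using network_compactness[where \<Gamma>s=\<Gamma>s, OF reg bd] by blast
    have lim: "edge_limit (\<lambda>n. edge_curve R (\<Gamma>s (r n)) i) (l i) (\<beta> i) (\<theta> i)" if "i \<in> {1..N}" for i
      by (rule bspec[OF limits that])
    have "(\<Sum>i\<in>{1..N}. \<beta> i + l i) \<le> m"
    proof (rule LIMSEQ_le[OF edge_limits_energy[OF lim]])
      have "(\<lambda>n. m + 2 * \<epsilon> (r n)) \<longlonglongrightarrow> m + 2 * 0"
        by (intro tendsto_intros filterlim_compose[OF \<epsilon>0 filterlim_subseq[OF r]])
      then show "(\<lambda>n. m + 2 * \<epsilon> (r n)) \<longlonglongrightarrow> m" by simp
      show "\<exists>n0. \<forall>n\<ge>n0. network_energy N R (\<Gamma>s (r n)) \<le> m + 2 * \<epsilon> (r n)"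
        using E less_imp_le by blast
    qed
    moreover obtain \<Gamma> where \<Gamma>: "\<Gamma> \<in> C_Deg N R D" "network_energy N R \<Gamma> \<le> (\<Sum>i\<in>{1..N}. \<beta> i + l i)"
      using limit_realization[OF assms(3) reg lim] by blast
    ultimately have "network_energy N R \<Gamma> \<le> m" by linarith
    then have "relaxed_energy N R D \<Gamma> \<le> relaxed_energy N R D \<Gamma>'" for \<Gamma>'
      using \<Gamma>(1) mle[of \<Gamma>'] by (auto simp: relaxed_energy_def)
    moreover have "network N R {1..N} \<Gamma>" using \<Gamma>(1) by (simp add: C_Deg_def)
    ultimately show ?thesis by blast
  qed
qed

end
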